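(* For any partitions $\alpha$ and $\beta$ the following identities hold between linear operators on $\mathrm{Sym}$, where $\lambda$, $\tau$ and $\nu$ each run over the set of all partitions: \begin{align*} D_{\beta}U_{\alpha}&=\sum_{\lambda} U_{\alpha/\lambda} D_{\beta/\lambda},\\ U_{\alpha}D_{\beta}&=\sum_{\lambda} (-1)^{|\lambda|} D_{\beta/\lambda'} U_{\alpha/\lambda},\\ K_{\beta} U_{\alpha} &=\sum_{\lambda} U_{s_{\beta/\lambda} \ast s_{\alpha}} K_{\lambda},\\ D_{\alpha}K_{\beta} &=\sum_{\lambda} K_{\lambda} D_{s_{\beta/\lambda} \ast s_{\alpha}},\\ \overline{K}_{\beta} U_{\alpha}&=\sum_{\tau,\nu} U_{(s_{\beta/\nu} \ast s_{\tau})\, s_{\alpha/\tau}}\, \overline{K}_{\nu},\\ D_{\alpha} \overline{K}_{\beta} &=\sum_{\tau,\nu} \overline{K}_{\nu}\, D_{(s_{\beta/\nu} \ast s_{\tau})\, s_{\alpha/\tau}}. \end{align*}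
   Context: $\mathrm{Sym}$ is the algebra of symmetric functions over $\mathbb{Q}$, with Schur basis $(s_\lambda)$, power sums $p_\lambda$, complete homogeneous functions $h_n$ ($h_0=1$, $h_n=0$ for $n<0$), and the Hall inner product (Schur functions orthonormal). $\lambda'$ is the conjugate partition of $\lambda$ and $|\lambda|$ its size. The skew Schur function is $s_{\alpha/\lambda}=\sum_\mu c^{\alpha}_{\lambda,\mu}s_\mu$ with $c^{\alpha}_{\lambda,\mu}$ the Littlewood--Richardson coefficients; it is $0$ unless $\lambda\subseteq\alpha$. The Kronecker product $\ast$ is the bilinear product on $\mathrm{Sym}$ with $p_\lambda\ast p_\mu=\delta_{\lambda\mu}z_\lambda p_\lambda$, where $z_\lambda=\prod_i i^{m_i}m_i!$ and $m_i$ is the number of parts of $\lambda$ equal to $i$ (so products of homogeneous elements of different degrees vanish). For $f\in\mathrm{Sym}$: $U_f(g)=fg$; $D_f$ is the adjoint of $U_f$ for the Hall inner product; $K_f(g)=f\ast g$. For a partition $\lambda$ and $g$ homogeneous of degree $n$, $\overline{K}_\lambda(g)=s_{(n-|\lambda|,\lambda_1,\lambda_2,\ldots)}\ast g$, extended linearly in $g$, where for any integer sequence $s_{(\alpha_1,\ldots,\alpha_N)}=\det(h_{\alpha_i+j-i})_{i,j=1,\ldots,N}$ (Jacobi--Trudi). The definition is extended linearly to $\overline{K}_f$ for $f\in \mathrm{Sym}$, with $\overline{K}_{s_\lambda}=\overline{K}_\lambda$. For each family $P\in\{U,D,K\}$, $P_\lambda:=P_{s_\lambda}$ and $P_{\alpha/\lambda}:=P_{s_{\alpha/\lambda}}$.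 Products of operators are compositions. *)

theory Defs
  imports
    "HOL-Library.Multiset"
    "HOL-Library.Groups_Big_Fun"
    "HOL-Library.Function_Algebras"
    "Jordan_Normal_Form.Determinant"
begin

section \<open>Integer partitions\<close>

typedef partition = "{xs :: nat list. sorted_wrt (\<ge>) xs \<and> 0 \<notin> set xs}"
  morphisms parts Abs_partition
  by (rule exI[of _ "[]"]) simp

setup_lifting type_definition_partition

definition psize :: "partition \<Rightarrow> nat" where
  "psize lam = sum_list (parts lam)"

text \<open>With 0-based \<open>j\<close>, the \<open>j\<close>-th part of the conjugate is the number of parts exceeding \<open>j\<close>.\<close>

lift_definition conj_partition :: "partition \<Rightarrow> partition"
  is "\<lambda>xs. map (\<lambda>j. length (filter (\<lambda>x. j < x) xs)) [0..<(if xs = [] then 0 else hd xs)]"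
proof -
  fix xs :: "nat list"
  let ?c = "\<lambda>j. length (filter (\<lambda>x. j < x) xs)"
  have "?c b \<le> ?c a" if "a < b" for a b
    using that by (induction xs) auto
  then have "sorted_wrt (\<lambda>a b. ?c b \<le> ?c a) [0..<n]" for n
    by (intro sorted_wrt_mono_rel[OF _ sorted_wrt_upt]) simp
  moreover have "?c j \<noteq> 0" if "xs \<noteq> []" "j < hd xs" for j
    using that by (auto simp: filter_empty_conv intro!: bexI[of _ "hd xs"])
  ultimately show "sorted_wrt (\<ge>) (map ?c [0..<(if xs = [] then 0 else hd xs)]) \<and>
        0 \<notin> set (map ?c [0..<(if xs = [] then 0 else hd xs)])"
    by (cases "xs = []") (auto simp only: sorted_wrt_map set_map set_upt if_True if_False
          atLeastLessThan_iff image_iff, auto)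
qed

definition zee :: "partition \<Rightarrow> nat" where
  "zee lam = (\<Prod>i\<in>set (parts lam). i ^ count_list (parts lam) i * fact (count_list (parts lam) i))"

section \<open>The algebra of symmetric functions over the rationals\<close>

text \<open>
  Symmetric functions are the formal power series of bounded degree in variables
  \<open>x\<^sub>0, x\<^sub>1, \<dots>\<close> that are invariant under permuting the variables.
  A monomial is encoded as the multiset of the indices of its variables (with multiplicity),
  so its degree is the size of the multiset and multiplication of monomials is multiset sum;
  a power series is the function sending each monomial to its coefficient.
\<close>

definition symmetric_series :: "(nat multiset \<Rightarrow> rat) \<Rightarrow> bool" where
  "symmetric_series f \<longleftrightarrow>
     (\<exists>d. \<forall>M. f M \<noteq> 0 \<longrightarrow> size M \<le> d) \<and>
     (\<forall>\<pi> M. bij \<pi> \<longrightarrow> f (image_mset \<pi> M) = f M)"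

lemma symmetric_seriesI:
  assumes "\<And>M. f M \<noteq> 0 \<Longrightarrow> size M \<le> d"
    and "\<And>\<pi> M. bij \<pi> \<Longrightarrow> f (image_mset \<pi> M) = f M"
  shows "symmetric_series f"
  using assms unfolding symmetric_series_def by blast

lemma symmetric_seriesD:
  "symmetric_series f \<Longrightarrow> bij \<pi> \<Longrightarrow> f (image_mset \<pi> M) = f M"
  unfolding symmetric_series_def by blast

typedef sym = "{f. symmetric_series f}"
  morphisms mcoeff Abs_sym
  by (rule exI[of _ "\<lambda>_. 0"]) (simp add: symmetric_series_def)

setup_lifting type_definition_sym

lemma finite_submultisets: "finite {A. A \<subseteq># (M :: 'a multiset)}"
proof (induction M)
  case (add x M)
  have "{A. A \<subseteq># add_mset x M} \<subseteq> {A. A \<subseteq># M} \<union> add_mset x ` {A. A \<subseteq># M}"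
  proof
    fix A assume "A \<in> {A. A \<subseteq># add_mset x M}"
    then have A: "A \<subseteq># add_mset x M" by simp
    show "A \<in> {A. A \<subseteq># M} \<union> add_mset x ` {A. A \<subseteq># M}"
    proof (cases "x \<in># A")
      case True
      then obtain B where B: "A = add_mset x B" by (metis insert_DiffM)
      with A show ?thesis by auto
    next
      case False
      then have "count A y \<le> count M y" for y
        using mset_subset_eq_count[OF A, of y] by (cases "y = x") (auto simp: not_in_iff)
      then show ?thesis by (simp add: subseteq_mset_def)
    qed
  qed
  with add show ?case by (meson finite_UnI finite_imageI finite_subset)
qed simp

lemma sum_submultisets_image:
  fixes \<pi> :: "nat \<Rightarrow> nat"
  assumes "bij \<pi>"
  shows "(\<Sum>A | A \<subseteq># image_mset \<pi> M. F A) = (\<Sum>A | A \<subseteq># M. F (image_mset \<pi> A))"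
proof -
  let ?\<rho> = "inv_into UNIV \<pi>"
  have inv: "image_mset ?\<rho> (image_mset \<pi> A) = A" "image_mset \<pi> (image_mset ?\<rho> A) = A" for A
    using assms
    by (simp_all add: image_mset.compositionality comp_def bij_is_inj bij_is_surj surj_f_inv_f)
  have "image_mset ?\<rho> A \<subseteq># M" if "A \<subseteq># image_mset \<pi> M" for A
    using image_mset_subseteq_mono[OF that, of ?\<rho>] by (simp only: inv)
  then show ?thesis
    by (intro sum.reindex_bij_witness[where i = "image_mset \<pi>" and j = "image_mset ?\<rho>"])
       (auto simp only: inv mem_Collect_eq intro: image_mset_subseteq_mono)
qed

lemma sum_submultisets_assoc:
  "(\<Sum>A | A \<subseteq># M. \<Sum>B | B \<subseteq># A. F B (A - B) (M - A)) =
   (\<Sum>B | B \<subseteq># M. \<Sum>C | C \<subseteq># M - B. F B C (M - B - C))"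
proof -
  have "(\<Sum>A | A \<subseteq># M. \<Sum>B | B \<subseteq># A. F B (A - B) (M - A)) =
        (\<Sum>(A, B)\<in>(SIGMA A:{A. A \<subseteq># M}. {B. B \<subseteq># A}). F B (A - B) (M - A))"
    by (rule sum.Sigma) (auto simp: finite_submultisets)
  also have "\<dots> = (\<Sum>(B, C)\<in>(SIGMA B:{B. B \<subseteq># M}. {C. C \<subseteq># M - B}). F B C (M - B - C))"
  proof (rule sum.reindex_bij_witness[where i = "\<lambda>(B, C). (B + C, B)" and j = "\<lambda>(A, B). (B, A - B)"],
      goal_cases)
    case (1 a)
    then show ?case by (auto simp: subset_mset.add_diff_inverse)
  next
    case (2 a)
    then show ?case
      by (auto simp: subseteq_mset_def diff_le_mono intro: order_trans)
  next
    case (3 b)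
    then show ?case by auto
  next
    case (4 b)
    then show ?case by (auto simp: subset_mset.le_diff_conv2 add.commute)
  next
    case (5 a)
    then obtain A B where a: "a = (A, B)" "A \<subseteq># M" "B \<subseteq># A" by auto
    then have "M - B - (A - B) = M - A" by (simp flip: diff_diff_add add: subset_mset.add_diff_inverse diff_diff_add)
    then show ?case using a by simp
  qed
  also have "\<dots> = (\<Sum>B | B \<subseteq># M. \<Sum>C | C \<subseteq># M - B. F B C (M - B - C))"
    by (rule sum.Sigma[symmetric]) (auto simp: finite_submultisets)
  finally show ?thesis .
qed

lemma sum_submultisets_commute:
  "(\<Sum>A | A \<subseteq># M. F A (M - A)) = (\<Sum>A | A \<subseteq># M. F (M - A) A)"
proof -
  have "M - (M - A) = A" if "A \<subseteq># M" for A
    using that by (auto simp: multiset_eq_iff subseteq_mset_def)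
  then show ?thesis
    by (intro sum.reindex_bij_witness[where i = "\<lambda>A. M - A" and j = "\<lambda>A. M - A"]) auto
qed

instantiation sym :: comm_ring_1
begin

lift_definition zero_sym :: sym is "\<lambda>_. 0" by (simp add: symmetric_series_def)

lift_definition one_sym :: sym is "\<lambda>M. if M = {#} then 1 else 0"
  by (auto simp: symmetric_series_def)

lift_definition plus_sym :: "sym \<Rightarrow> sym \<Rightarrow> sym" is "\<lambda>f g M. f M + g M"
proof -
  fix f g :: "nat multiset \<Rightarrow> rat"
  assume f: "symmetric_series f" and g: "symmetric_series g"
  obtain d where d: "\<And>M. f M \<noteq> 0 \<Longrightarrow> size M \<le> d" using f by (auto simp: symmetric_series_def)
  obtain e where e: "\<And>M. g M \<noteq> 0 \<Longrightarrow> size M \<le> e" using g by (auto simp: symmetric_series_def)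
  show "symmetric_series (\<lambda>M. f M + g M)"
  proof (rule symmetric_seriesI[where d = "max d e"])
    fix M assume "f M + g M \<noteq> 0"
    then have "f M \<noteq> 0 \<or> g M \<noteq> 0" by auto
    then show "size M \<le> max d e" using d e by (auto simp: le_max_iff_disj)
  qed (simp add: symmetric_seriesD[OF f] symmetric_seriesD[OF g])
qed

lift_definition uminus_sym :: "sym \<Rightarrow> sym" is "\<lambda>f M. - f M"
  by (auto simp: symmetric_series_def)

definition minus_sym :: "sym \<Rightarrow> sym \<Rightarrow> sym" where "minus_sym f g = f + (- g)"

lift_definition times_sym :: "sym \<Rightarrow> sym \<Rightarrow> sym" is "\<lambda>f g M. \<Sum>A | A \<subseteq># M. f A * g (M - A)"
proof -
  fix f g :: "nat multiset \<Rightarrow> rat"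
  assume f: "symmetric_series f" and g: "symmetric_series g"
  obtain d where d: "\<And>M. f M \<noteq> 0 \<Longrightarrow> size M \<le> d" using f by (auto simp: symmetric_series_def)
  obtain e where e: "\<And>M. g M \<noteq> 0 \<Longrightarrow> size M \<le> e" using g by (auto simp: symmetric_series_def)
  show "symmetric_series (\<lambda>M. \<Sum>A | A \<subseteq># M. f A * g (M - A))"
  proof (rule symmetric_seriesI[where d = "d + e"])
    fix M assume "(\<Sum>A | A \<subseteq># M. f A * g (M - A)) \<noteq> 0"
    then obtain A where A: "A \<in> {A. A \<subseteq># M}" "f A * g (M - A) \<noteq> 0"
      by (rule sum.not_neutral_contains_not_neutral)
    then have "size A \<le> d" "size (M - A) \<le> e" "A + (M - A) = M"
      using d[of A] e[of "M - A"] by (auto simp: subset_mset.add_diff_inverse)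
    then show "size M \<le> d + e" by (metis add_mono size_union)
  next
    fix \<pi> :: "nat \<Rightarrow> nat" and M assume \<pi>: "bij \<pi>"
    have "(\<Sum>A | A \<subseteq># image_mset \<pi> M. f A * g (image_mset \<pi> M - A)) =
          (\<Sum>A | A \<subseteq># M. f (image_mset \<pi> A) * g (image_mset \<pi> M - image_mset \<pi> A))"
      by (rule sum_submultisets_image[OF \<pi>])
    also have "\<dots> = (\<Sum>A | A \<subseteq># M. f A * g (M - A))"
      by (rule sum.cong)
         (auto simp: image_mset_Diff[symmetric] symmetric_seriesD[OF f \<pi>] symmetric_seriesD[OF g \<pi>])
    finally show "(\<Sum>A | A \<subseteq># image_mset \<pi> M. f A * g (image_mset \<pi> M - A)) =
                  (\<Sum>A | A \<subseteq># M. f A * g (M - A))" .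
  qed
qed

instance
proof
  fix a b c :: sym
  show "a * b * c = a * (b * c)"
  proof (transfer, rule ext)
    fix a b c :: "nat multiset \<Rightarrow> rat" and M
    show "(\<Sum>A | A \<subseteq># M. (\<Sum>B | B \<subseteq># A. a B * b (A - B)) * c (M - A)) =
          (\<Sum>A | A \<subseteq># M. a A * (\<Sum>B | B \<subseteq># M - A. b B * c (M - A - B)))"
      using sum_submultisets_assoc[of "\<lambda>x y z. a x * b y * c z" M]
      by (simp add: sum_distrib_left sum_distrib_right mult.assoc)
  qed
  show "a * b = b * a"
  proof (transfer, rule ext)
    fix a b :: "nat multiset \<Rightarrow> rat" and M
    show "(\<Sum>A | A \<subseteq># M. a A * b (M - A)) = (\<Sum>A | A \<subseteq># M. b A * a (M - A))"
      using sum_submultisets_commute[of "\<lambda>x y. a x * b y" M] by (simp add: mult.commute)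
  qed
  show "1 * a = a"
  proof (transfer, rule ext)
    fix a :: "nat multiset \<Rightarrow> rat" and M
    have "(\<Sum>A | A \<subseteq># M. (if A = {#} then 1 else 0) * a (M - A)) =
          (\<Sum>A\<in>{{#}}. (if A = {#} then 1 else 0) * a (M - A))"
      by (rule sum.mono_neutral_right) (auto simp: finite_submultisets)
    then show "(\<Sum>A | A \<subseteq># M. (if A = {#} then 1 else 0) * a (M - A)) = a M" by simp
  qed
  show "(a + b) * c = a * c + b * c"
    by (transfer, rule ext) (simp add: distrib_right sum.distrib)
  show "(0 :: sym) \<noteq> 1"
    by transfer (metis zero_neq_one)
qed (unfold minus_sym_def, (transfer, auto simp: fun_eq_iff)+)

end

lift_definition sym_scale :: "rat \<Rightarrow> sym \<Rightarrow> sym" (infixr "*\<^sub>Q" 75) is "\<lambda>c f M. c * f M"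
  by (auto simp: symmetric_series_def)

global_interpretation sym: vector_space sym_scale
  by unfold_locales (transfer, auto simp: fun_eq_iff algebra_simps)+

lift_definition homogeneous_component :: "nat \<Rightarrow> sym \<Rightarrow> sym"
  is "\<lambda>n f M. if size M = n then f M else 0"
  by (auto simp: symmetric_series_def)

section \<open>Complete homogeneous functions, power sums and Schur functions\<close>

lift_definition complete_h :: "int \<Rightarrow> sym" is "\<lambda>n M. if int (size M) = n then 1 else 0"
proof -
  fix n :: int
  show "symmetric_series (\<lambda>M. if int (size M) = n then 1 else 0)"
    by (rule symmetric_seriesI[where d = "nat n"]) (auto split: if_splits)
qed

lift_definition power_sum :: "nat \<Rightarrow> sym" is "\<lambda>n M. if \<exists>i. M = replicate_mset n i then 1 else 0"
proof -
  fix n :: nat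
  have *: "(\<exists>i. image_mset \<pi> M = replicate_mset n i) \<longleftrightarrow> (\<exists>i. M = replicate_mset n i)"
    if "bij \<pi>" for \<pi> :: "nat \<Rightarrow> nat" and M
  proof
    assume "\<exists>i. image_mset \<pi> M = replicate_mset n i"
    then obtain i where "image_mset \<pi> M = replicate_mset n i" ..
    then have "image_mset (inv_into UNIV \<pi>) (image_mset \<pi> M) = replicate_mset n (inv_into UNIV \<pi> i)" by simp
    then show "\<exists>i. M = replicate_mset n i"
      using that by (auto simp: image_mset.compositionality comp_def bij_is_inj)
  qed auto
  show "symmetric_series (\<lambda>M. if \<exists>i. M = replicate_mset n i then 1 else 0)"
    by (rule symmetric_seriesI[where d = n]) (auto simp: * split: if_splits)
qed

definition power_prod :: "partition \<Rightarrow> sym" where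
  "power_prod lam = prod_list (map power_sum (parts lam))"

definition schur_seq :: "int list \<Rightarrow> sym" where
  "schur_seq a = det (mat (length a) (length a) (\<lambda>(i, j). complete_h (a ! i + int j - int i)))"

definition schur :: "partition \<Rightarrow> sym" where
  "schur lam = schur_seq (map int (parts lam))"

text \<open>
  The coordinate of \<open>f\<close> at \<open>b lam\<close>, for a basis of the space of symmetric functions given as an
  injective family \<open>b\<close> indexed by partitions.
  It is used only for the Schur functions and the products of power sums, both of which are bases;
  the bilinear operations fixed by their values on a basis are defined through it.
\<close>

definition coord :: "(partition \<Rightarrow> sym) \<Rightarrow> sym \<Rightarrow> partition \<Rightarrow> rat" where
  "coord b f lam = sym.representation (range b) f (b lam)"

definition hall :: "sym \<Rightarrow> sym \<Rightarrow> rat" where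
  "hall f g = Sum_any (\<lambda>lam. coord schur f lam * coord schur g lam)"

definition kronecker :: "sym \<Rightarrow> sym \<Rightarrow> sym" where
  "kronecker f g = Sum_any (\<lambda>lam.
     (coord power_prod f lam * coord power_prod g lam * of_nat (zee lam)) *\<^sub>Q power_prod lam)"

definition lr_coeff :: "partition \<Rightarrow> partition \<Rightarrow> partition \<Rightarrow> rat" where
  "lr_coeff al lam mu = coord schur (schur lam * schur mu) al"

definition skew_schur :: "partition \<Rightarrow> partition \<Rightarrow> sym" where
  "skew_schur al lam = Sum_any (\<lambda>mu. lr_coeff al lam mu *\<^sub>Q schur mu)"

section \<open>The operators\<close>

definition U_op :: "sym \<Rightarrow> sym \<Rightarrow> sym" where
  "U_op f g = f * g"

definition D_op :: "sym \<Rightarrow> sym \<Rightarrow> sym" where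
  "D_op f = (THE D. \<forall>g h. hall (U_op f g) h = hall g (D h))"

definition K_op :: "sym \<Rightarrow> sym \<Rightarrow> sym" where
  "K_op f g = kronecker f g"

definition Kbar_part :: "partition \<Rightarrow> sym \<Rightarrow> sym" where
  "Kbar_part lam g = Sum_any (\<lambda>n.
     kronecker (schur_seq ((int n - int (psize lam)) # map int (parts lam))) (homogeneous_component n g))"

definition Kbar_op :: "sym \<Rightarrow> sym \<Rightarrow> sym" where
  "Kbar_op f g = Sum_any (\<lambda>lam. coord schur f lam *\<^sub>Q Kbar_part lam g)"

text \<open>
  An identity whose right-hand side is a sum over all partitions means that only finitely many
  terms are nonzero and that they add up to the left-hand side.  Finiteness is asserted explicitly
  because \<^const>\<open>Sum_any\<close> is \<open>0\<close> on families of infinite support.  The operators on symmetric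
  functions are added pointwise, via the library's instance for functions.
\<close>

definition has_finite_sum :: "('i \<Rightarrow> 'a :: comm_monoid_add) \<Rightarrow> 'a \<Rightarrow> bool" (infixr "has'_finite'_sum" 46)
  where "F has_finite_sum S \<longleftrightarrow> finite {i. F i \<noteq> 0} \<and> S = Sum_any F"

end

theory Submission
  imports Defs "HOL-Computational_Algebra.Formal_Power_Series" "HOL-Library.Infinite_Set"
begin


text \<open>
  The argument takes place in power-sum coordinates. The products \<open>p\<^sub>A\<close> of power sums over
  multisets \<open>A\<close> of positive integers form a basis on which multiplication is union of multisets and
  the Kronecker product is diagonal. For the bilinear form with
  \<open>\<langle>p\<^sub>A, p\<^sub>B\<rangle> = z\<^sub>A \<delta>\<^sub>A\<^sub>B\<close>, write \<open>f\<^sup>\<bottom>\<close> for the adjoint of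
  multiplication by \<open>f\<close>; then \<open>p\<^sub>n\<^sup>\<bottom>\<close> is the derivation
  \<open>n \<partial>/\<partial>p\<^sub>n\<close>, for \<open>n > 0\<close>.
  
  This form is the Hall inner product, because Jacobi--Trudi determinants are orthonormal for it. The
  generating series \<open>\<Sum> h\<^sub>n\<^sup>\<bottom> t\<^sup>n\<close> is multiplicative, so it acts entrywise on
  determinants, and column operations show that \<open>h\<^sub>k\<^sup>\<bottom>\<close> annihilates \<open>s\<^sub>a\<close> for
  \<open>k > a\<^sub>1\<close> and removes the first row for \<open>k = a\<^sub>1\<close>
  (\<open>skew_complete_h_schur_seq_top\<close>). The same method applied to the signed elementary functions
  \<open>(-1)\<^sup>j e\<^sub>j\<close> turns the expansion of a determinant along its first row into Bernstein's
  formula \<open>s\<^bsub>(m,a)\<^esub> = \<Sum>\<^sub>j h\<^bsub>m+j\<^esub> ((-1)\<^sup>j e\<^sub>j)\<^sup>\<bottom> s\<^sub>a\<close>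
  (\<open>schur_seq_Cons\<close>). Together they give
  \<open>\<langle>s\<^bsub>(m,a)\<^esub>, f\<rangle> = \<langle>s\<^sub>a, h\<^sub>m\<^sup>\<bottom> f\<rangle>\<close> whenever
  \<open>h\<^sub>k\<^sup>\<bottom> f = 0\<close> for all \<open>k > m\<close>, and orthonormality follows by recursion on the rows. The
  same recursion evaluates the pairing of \<open>s\<^sub>\<lambda>\<close> with the antipode of the Schur function of the
  conjugate partition as \<open>\<plusminus>1\<close>; two unit vectors of a positive definite form with this pairing are
  equal up to sign.
  
  The sum of \<open>\<Phi>(s\<^sub>\<lambda>, s\<^sub>\<lambda>\<^sup>\<bottom> f)\<close> over all \<open>\<lambda>\<close> evaluates a bilinear map
  \<open>\<Phi>\<close> on the coproduct of \<open>f\<close>. Like any sum over a pair of dual bases it may be computed from the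
  \<open>p\<^sub>A\<close> instead (\<open>sum_schur_eq_sum_pp\<close>), and multiplicativity of the coproduct becomes a rule for
  passing from \<open>f\<close> to \<open>p\<^sub>n f\<close> (\<open>coproduct_sum_power_sum\<close>). Each operator identity is
  therefore stated with an arbitrary \<open>f\<close> in place of \<open>s\<^sub>\<beta>\<close> and proved by induction on \<open>f\<close>, from
  \<open>1\<close> to \<open>p\<^sub>n f\<close>. The inputs are the Leibniz rule for \<open>p\<^sub>n\<^sup>\<bottom>\<close> and the formula
  \<open>(p\<^sub>n f) * g = p\<^sub>n (f * p\<^sub>n\<^sup>\<bottom> g)\<close> for the Kronecker product. In the second identity the
  coproduct is twisted by the antipode, which produces the sign and the conjugate partition.
  
  For the stabilised Kronecker operators, Bernstein's formula gives \<open>K\<close>-bar of \<open>f\<close> as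
  the image of \<open>f[X - 1]\<close> under the linear map sending \<open>p\<^sub>A\<close> to the operator
  \<open>g \<mapsto> p\<^sub>A (p\<^sub>A\<^sup>\<bottom> g)\<close>, which makes the passage from \<open>f\<close> to \<open>p\<^sub>n f\<close> explicit
  (\<open>stable_op_power_sum_mult\<close>). Finally, the operators \<open>K\<close> and \<open>K\<close>-bar are self-adjoint, so
  the identities for their composites with \<open>D\<close> are the adjoints of those for their composites
  with \<open>U\<close>.
\<close>

section \<open>Partitions as multisets of positive parts\<close>

definition shape :: "partition \<Rightarrow> nat multiset" where
  "shape lam = mset (parts lam)"

lemma parts_sorted: "sorted_wrt (\<ge>) (parts lam)" and parts_pos: "0 \<notin> set (parts lam)"
  using parts[of lam] by auto

lemma zero_notin_shape [simp]: "0 \<notin># shape lam"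
  by (simp add: shape_def parts_pos)

lemma sorted_rev_parts: "sorted (rev (parts lam))"
  using parts_sorted[of lam] by (simp add: sorted_wrt_rev)

lemma shape_eq_iff [simp]: "shape lam = shape mu \<longleftrightarrow> lam = mu"
proof
  assume "shape lam = shape mu"
  then have "sort (parts lam) = sort (parts mu)"
    by (metis shape_def mset_sort properties_for_sort sorted_sort)
  moreover have "sort (parts nu) = rev (parts nu)" for nu
    by (rule properties_for_sort) (simp_all add: sorted_rev_parts)
  ultimately have "parts lam = parts mu" by simp
  then show "lam = mu" by (simp add: parts_inject)
qed auto

lemma shape_surj:
  assumes "0 \<notin># A"
  shows "\<exists>lam. shape lam = A"
proof -
  let ?xs = "rev (sorted_list_of_multiset A)"
  have "sorted_wrt (\<ge>) ?xs" by (simp add: sorted_wrt_rev)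
  moreover have "0 \<notin> set ?xs" using assms by simp
  ultimately have "shape (Abs_partition ?xs) = A"
    by (simp add: shape_def Abs_partition_inverse)
  then show ?thesis ..
qed

definition partition_of :: "nat multiset \<Rightarrow> partition" where
  "partition_of A = (THE lam. shape lam = A)"

lemma partition_of_shape [simp]: "partition_of (shape lam) = lam"
  by (auto simp: partition_of_def)

lemma shape_partition_of [simp]: "0 \<notin># A \<Longrightarrow> shape (partition_of A) = A"
  using shape_surj[of A] by auto

lemma psize_shape: "psize lam = \<Sum>\<^sub># (shape lam)"
  by (simp add: psize_def shape_def sum_mset_sum_list)

definition positive_multisets :: "nat \<Rightarrow> nat multiset set" where
  "positive_multisets N = {A. 0 \<notin># A \<and> \<Sum>\<^sub># A \<le> N}"

lemma size_le_sum_mset: "0 \<notin># A \<Longrightarrow> size A \<le> \<Sum>\<^sub># (A :: nat multiset)"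
  by (induction A) auto

lemma finite_positive_multisets [simp, intro]: "finite (positive_multisets N)"
proof (rule finite_subset[OF _ finite_submultisets])
  show "positive_multisets N \<subseteq> {A. A \<subseteq># repeat_mset N (mset_set {..N})}"
  proof (clarsimp simp: positive_multisets_def subseteq_mset_def)
    fix A :: "nat multiset" and i
    assume A: "0 \<notin># A" "\<Sum>\<^sub># A \<le> N"
    have "count A i \<le> N"
      using size_le_sum_mset[OF A(1)] A(2) count_le_size[of A i] by linarith
    moreover have "i \<le> N" if "i \<in># A"
      using that A(2) by (metis le_add1 le_trans sum_mset.remove)
    ultimately show "count A i \<le> N * count (mset_set {..N}) i"
      by (cases "i \<in># A") (auto simp: not_in_iff)
  qed
qed

lemma bij_betw_shape: "bij_betw shape {lam. psize lam \<le> N} (positive_multisets N)"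
  by (rule bij_betwI[where g = partition_of]) (auto simp: positive_multisets_def psize_shape)

lemma finite_psize_le [simp, intro]: "finite {lam. psize lam \<le> N}"
  using bij_betw_finite[OF bij_betw_shape] by simp

definition zee_mset :: "nat multiset \<Rightarrow> rat" where
  "zee_mset A = of_nat (\<Prod>i\<in>set_mset A. i ^ count A i * fact (count A i))"

lemma zee_shape: "of_nat (zee lam) = zee_mset (shape lam)"
  by (simp add: zee_def zee_mset_def shape_def count_mset)

lemma zee_mset_empty [simp]: "zee_mset {#} = 1"
  by (simp add: zee_mset_def)

text \<open>
  The single recursion through which the numbers \<open>z\<close> enter; it mirrors
  \<open>p\<^sub>n\<^sup>\<bottom> p\<^bsub>A+n\<^esub> = n (m\<^sub>n(A) + 1) p\<^sub>A\<close>. For \<open>n = 0\<close> both sides vanish, so that a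
  weight \<open>1 / z\<^sub>A\<close>, being \<open>1 / 0 = 0\<close> there, discards the multisets containing \<open>0\<close>.
\<close>

lemma zee_mset_add_mset:
  "zee_mset (add_mset n A) = of_nat n * of_nat (Suc (count A n)) * zee_mset A"
proof -
  let ?f = "\<lambda>A i. i ^ count A i * fact (count A i) :: nat"
  have *: "zee_mset B = of_nat (\<Prod>i\<in>set_mset (A + {#n#}). ?f B i)" if "B \<subseteq># A + {#n#}" for B
    unfolding zee_mset_def using set_mset_mono[OF that]
    by (intro arg_cong[where f = of_nat] prod.mono_neutral_left) (simp_all add: not_in_iff)
  have "(\<Prod>i\<in>set_mset (A + {#n#}). ?f (A + {#n#}) i) =
        ?f (A + {#n#}) n * (\<Prod>i\<in>set_mset (A + {#n#}) - {n}. ?f (A + {#n#}) i)"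
    by (subst prod.remove[of _ n]) auto
  also have "(\<Prod>i\<in>set_mset (A + {#n#}) - {n}. ?f (A + {#n#}) i) =
        (\<Prod>i\<in>set_mset (A + {#n#}) - {n}. ?f A i)"
    by (rule prod.cong) auto
  also have "?f (A + {#n#}) n = n * Suc (count A n) * ?f A n"
    by (simp add: algebra_simps)
  also have "\<dots> * (\<Prod>i\<in>set_mset (A + {#n#}) - {n}. ?f A i) =
       n * Suc (count A n) * (\<Prod>i\<in>set_mset (A + {#n#}). ?f A i)"
    by (subst (2) prod.remove[of _ n]) auto
  finally show ?thesis
    using *[of A] *[of "A + {#n#}"] by (simp add: distrib_left)
qed

lemma zee_mset_eq_0_iff [simp]: "zee_mset A = 0 \<longleftrightarrow> 0 \<in># A"
  by (induction A) (auto simp: zee_mset_add_mset)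

lemma zee_mset_nonneg: "zee_mset A \<ge> 0"
  unfolding zee_mset_def by (rule of_nat_0_le_iff)

section \<open>Coordinates with respect to a basis\<close>

definition basis_family :: "(partition \<Rightarrow> sym) \<Rightarrow> bool" where
  "basis_family b \<longleftrightarrow> inj b \<and> sym.independent (range b) \<and> sym.span (range b) = UNIV"

lemma coord_add: "basis_family b \<Longrightarrow> coord b (f + g) lam = coord b f lam + coord b g lam"
  by (simp add: coord_def basis_family_def sym.representation_add)

lemma coord_scale: "basis_family b \<Longrightarrow> coord b (c *\<^sub>Q f) lam = c * coord b f lam"
  by (simp add: coord_def basis_family_def sym.representation_scale)

lemma coord_zero [simp]: "coord b 0 lam = 0"
  by (simp add: coord_def sym.representation_zero)

lemma coord_basis: "basis_family b \<Longrightarrow> coord b (b mu) lam = (if lam = mu then 1 else 0)"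
  by (auto simp: coord_def basis_family_def sym.representation_basis inj_eq)

lemma finite_coord: "basis_family b \<Longrightarrow> finite {lam. coord b f lam \<noteq> 0}"
  using finite_vimageI[OF sym.finite_representation[of "range b" f], of b]
  by (auto simp: coord_def basis_family_def vimage_def)

lemma sum_coord:
  assumes b: "basis_family b" and "finite T" "{lam. coord b f lam \<noteq> 0} \<subseteq> T"
  shows "(\<Sum>lam\<in>T. coord b f lam *\<^sub>Q b lam) = f"
proof -
  let ?r = "sym.representation (range b) f"
  have inj: "inj_on b S" for S using b by (meson basis_family_def inj_on_subset subset_UNIV)
  have "f = (\<Sum>v | ?r v \<noteq> 0. ?r v *\<^sub>Q v)"
    using b by (intro sym.sum_nonzero_representation_eq[symmetric]) (auto simp: basis_family_def)
  also have "{v. ?r v \<noteq> 0} = b ` {lam. coord b f lam \<noteq> 0}"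
    using sym.representation_ne_zero[of "range b" f] by (auto simp: coord_def image_iff)
  also have "(\<Sum>v\<in>\<dots>. ?r v *\<^sub>Q v) = (\<Sum>lam | coord b f lam \<noteq> 0. coord b f lam *\<^sub>Q b lam)"
    by (subst sum.reindex[OF inj]) (simp add: coord_def)
  also have "\<dots> = (\<Sum>lam\<in>T. coord b f lam *\<^sub>Q b lam)"
    using assms by (intro sum.mono_neutral_left) auto
  finally show ?thesis by simp
qed

section \<open>Products of power sums form a basis\<close>

text \<open>
  Products of power sums are indexed by multisets rather than partitions, so that products correspond to
  unions and the derivation \<open>n \<partial>/\<partial>p\<^sub>n\<close> to the removal of an element. A multiset containing
  \<open>0\<close> is harmless but redundant, because the zeroth power sum is \<open>1\<close>.
\<close>

definition pp :: "nat multiset \<Rightarrow> sym" where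
  "pp A = prod_mset (image_mset power_sum A)"

lemma pp_empty [simp]: "pp {#} = 1" and
  pp_add_mset: "pp (add_mset n A) = power_sum n * pp A" and
  pp_union: "pp (A + B) = pp A * pp B"
  by (simp_all add: pp_def)

lemma power_prod_pp: "power_prod lam = pp (shape lam)"
  by (simp add: power_prod_def pp_def shape_def prod_mset_prod_list flip: mset_map)

lemma power_sum_0 [simp]: "power_sum 0 = 1"
  by transfer (auto simp: fun_eq_iff)

text \<open>
  The monomial with exponents \<open>xs\<close> on the variables with indices \<open>is\<close>; an index may be repeated, which
  is how a product of power sums contributes to monomials with fewer variables than it has factors.
\<close>

definition blowup :: "nat list \<Rightarrow> nat list \<Rightarrow> nat multiset" where
  "blowup xs is = sum_list (map2 replicate_mset xs is)"

lemma blowup_simps [simp]: "blowup [] is = {#}" "blowup xs [] = {#}"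
  "blowup (x # xs) (i # is) = replicate_mset x i + blowup xs is"
  by (simp_all add: blowup_def)

lemma size_blowup: "length is = length xs \<Longrightarrow> size (blowup xs is) = sum_list xs"
  by (induction xs "is" rule: list_induct2') auto

lemma set_blowup: "length is = length xs \<Longrightarrow> 0 \<notin> set xs \<Longrightarrow> set_mset (blowup xs is) = set is"
  by (induction xs "is" rule: list_induct2') auto

lemma set_blowup_subset: "set_mset (blowup xs is) \<subseteq> set is"
  by (induction xs "is" rule: list_induct2') auto

lemma map_count_blowup:
  "length is = length xs \<Longrightarrow> distinct is \<Longrightarrow> map (count (blowup xs is)) is = xs"
proof (induction xs "is" rule: list_induct2')
  case (4 x xs i "is")
  then have "i \<notin># blowup xs is" using set_blowup_subset[of xs "is"] by auto
  then have "count (blowup xs is) i = 0" by (simp add: not_in_iff)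
  moreover have "map (count (replicate_mset x i + blowup xs is)) is = map (count (blowup xs is)) is"
    using 4 by (intro map_cong) auto
  ultimately show ?case using 4 by (simp cong: map_cong)
qed auto

lemma image_blowup: "length is = length xs \<Longrightarrow> image_mset \<pi> (blowup xs is) = blowup xs (map \<pi> is)"
  by (induction xs "is" rule: list_induct2') auto

lemma mcoeff_times: "mcoeff (f * g) M = (\<Sum>A | A \<subseteq># M. mcoeff f A * mcoeff g (M - A))"
  by (simp add: times_sym.rep_eq)

lemma mcoeff_one: "mcoeff 1 M = (if M = {#} then 1 else 0)"
  by (simp add: one_sym.rep_eq)

lemma mcoeff_power_sum: "mcoeff (power_sum n) M = (if \<exists>i. M = replicate_mset n i then 1 else 0)"
  by (simp add: power_sum.rep_eq)

lemma mcoeff_add: "mcoeff (f + g) M = mcoeff f M + mcoeff g M"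
  and mcoeff_scale: "mcoeff (c *\<^sub>Q f) M = c * mcoeff f M"
  and mcoeff_0 [simp]: "mcoeff 0 M = 0"
  and mcoeff_minus: "mcoeff (- f) M = - mcoeff f M"
  by (simp_all add: plus_sym.rep_eq sym_scale.rep_eq zero_sym.rep_eq uminus_sym.rep_eq)

lemma mcoeff_diff: "mcoeff (f - g) M = mcoeff f M - mcoeff g M"
  by (metis diff_conv_add_uminus mcoeff_add mcoeff_minus)

lemma mcoeff_sum: "mcoeff (sum f T) M = (\<Sum>t\<in>T. mcoeff (f t) M)"
  by (induction T rule: infinite_finite_induct) (auto simp: mcoeff_add)

lemma sym_eqI: "(\<And>M. mcoeff f M = mcoeff g M) \<Longrightarrow> f = g"
  by (simp add: mcoeff_inject fun_eq_iff flip: mcoeff_inject)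

lemma mcoeff_power_prod_support:
  assumes "mcoeff (prod_list (map power_sum xs)) M \<noteq> 0"
  shows "\<exists>is. length is = length xs \<and> M = blowup xs is"
  using assms
proof (induction xs arbitrary: M)
  case (Cons x xs)
  obtain A where A: "A \<subseteq># M" "mcoeff (power_sum x) A \<noteq> 0"
      "mcoeff (prod_list (map power_sum xs)) (M - A) \<noteq> 0"
    using Cons.prems by (auto simp: mcoeff_times elim!: sum.not_neutral_contains_not_neutral)
  obtain i where i: "A = replicate_mset x i"
    using A(2) by (auto simp: mcoeff_power_sum split: if_splits)
  obtain "is" where "length is = length xs" "M - A = blowup xs is" using Cons.IH[OF A(3)] by auto
  then show ?case
    using A(1) i by (intro exI[of _ "i # is"]) (simp, metis subset_mset.add_diff_inverse)
qed (simp add: mcoeff_one split: if_splits)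

lemma mcoeff_power_prod_nonneg: "mcoeff (prod_list (map power_sum xs)) M \<ge> 0"
  by (induction xs arbitrary: M)
     (auto simp: mcoeff_one mcoeff_times mcoeff_power_sum intro!: sum_nonneg mult_nonneg_nonneg)

lemma mcoeff_power_prod_pos:
  "length is = length xs \<Longrightarrow> mcoeff (prod_list (map power_sum xs)) (blowup xs is) > 0"
proof (induction xs "is" rule: list_induct2')
  case (4 x xs i "is")
  let ?M = "blowup (x # xs) (i # is)"
  let ?t = "\<lambda>A. mcoeff (power_sum x) A * mcoeff (prod_list (map power_sum xs)) (?M - A)"
  have "0 < ?t (replicate_mset x i)" using 4 by (auto simp: mcoeff_power_sum)
  also have "\<dots> \<le> sum ?t {A. A \<subseteq># ?M}"
    by (rule member_le_sum)
       (auto simp: finite_submultisets mcoeff_power_sum mcoeff_power_prod_nonneg)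
  finally show ?case by (simp add: mcoeff_times)
qed (auto simp: mcoeff_one)

definition std_monomial :: "partition \<Rightarrow> nat multiset" where
  "std_monomial lam = blowup (parts lam) [0..<length (parts lam)]"

lemma mcoeff_power_prod_std_pos: "mcoeff (power_prod lam) (std_monomial lam) > 0"
  by (simp add: power_prod_def std_monomial_def mcoeff_power_prod_pos)

text \<open>
  A monomial of \<open>p\<^sub>\<mu>\<close> arises by choosing a variable for every part of \<open>\<mu>\<close>. To reach as many variables
  as \<open>\<lambda>\<close> has parts, at least that many parts are needed, and with no more than that many the
  choices are distinct, so that the parts of \<open>\<mu>\<close> are exactly the exponents. Hence products of power
  sums are triangular for the order by number of parts, which yields both independence and spanning.
\<close>

lemma mcoeff_power_prod_triangular:
  assumes "mcoeff (power_prod mu) (std_monomial lam) \<noteq> 0" "length (parts mu) \<le> length (parts lam)"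
  shows "mu = lam"
proof -
  let ?M = "std_monomial lam"
  obtain "is" where js: "length is = length (parts mu)" "?M = blowup (parts mu) is"
    using assms mcoeff_power_prod_support unfolding power_prod_def by blast
  have set1: "set_mset ?M = set is" using js by (simp add: set_blowup parts_pos)
  have set2: "set_mset ?M = set [0..<length (parts lam)]"
    unfolding std_monomial_def by (simp add: set_blowup parts_pos)
  have "card (set is) = length (parts lam)"
    using distinct_card[of "[0..<length (parts lam)]"] set1 set2 by (metis distinct_upt length_upt diff_zero)
  then have "distinct is"
    using assms(2) js(1) card_length[of "is"] by (intro card_distinct) linarith
  then have "mset is = mset [0..<length (parts lam)]"
    using set1 set2 by (metis distinct_upt mset_set_set)
  moreover have "parts mu = map (count ?M) is"
    using js \<open>distinct is\<close> by (simp add: map_count_blowup)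
  moreover have "parts lam = map (count ?M) [0..<length (parts lam)]"
    unfolding std_monomial_def by (simp add: map_count_blowup)
  ultimately have "shape mu = shape lam" unfolding shape_def by (metis mset_map)
  then show ?thesis by simp
qed

lemma finite_bij_extension:
  fixes A B :: "nat set"
  assumes "finite A" "bij_betw f A B"
  obtains \<pi> where "bij \<pi>" "\<And>a. a \<in> A \<Longrightarrow> \<pi> a = f a"
proof -
  have inf: "infinite (- A)" "infinite (- B)"
    using assms bij_betw_finite[OF assms(2)] by (simp_all add: finite_compl)
  let ?g = "enumerate (- B) \<circ> the_inv_into UNIV (enumerate (- A))"
  have "bij_betw ?g (- A) (- B)"
    using inf by (intro bij_betw_trans[OF bij_betw_the_inv_into]) (rule bij_enumerate, assumption)+
  then obtain g where g: "bij_betw g (- A) (- B)" ..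
  define \<pi> where "\<pi> = (\<lambda>x. if x \<in> A then f x else g x)"
  have "bij_betw \<pi> (A \<union> - A) (B \<union> - B)"
    unfolding \<pi>_def by (rule bij_betw_disjoint_Un) (use assms g in auto)
  then show ?thesis by (intro that[of \<pi>]) (auto simp: \<pi>_def)
qed

text \<open>
  A symmetric series is determined by its coefficients at the standard monomials, since every monomial
  is a renaming of one of them: list its variables by decreasing exponent.
\<close>

lemma monomial_orbit:
  fixes M :: "nat multiset"
  obtains lam \<pi> where "bij \<pi>" "M = image_mset \<pi> (std_monomial lam)"
    "length (parts lam) = card (set_mset M)"
proof -
  define ys where "ys = rev (sort_key (count M) (sorted_list_of_set (set_mset M)))"
  have ys: "distinct ys" "set ys = set_mset M" by (simp_all add: ys_def)
  define xs where "xs = map (count M) ys"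
  have "sorted_wrt (\<ge>) xs"
    by (simp add: xs_def ys_def rev_map[symmetric] sorted_wrt_rev)
  moreover have "0 \<notin> set xs" using ys by (auto simp: xs_def simp flip: count_greater_zero_iff)
  ultimately have parts: "parts (Abs_partition xs) = xs" by (simp add: Abs_partition_inverse)
  have "count (blowup (map c zs) zs) i = (if i \<in> set zs then c i else 0)" if "distinct zs" for c zs i
    using that by (induction zs) auto
  then have M: "M = blowup xs ys"
    using ys by (auto simp: xs_def multiset_eq_iff not_in_iff)
  have len: "length ys = length xs" by (simp add: xs_def)
  obtain \<pi> where \<pi>: "bij \<pi>" "\<And>i. i \<in> {..<length ys} \<Longrightarrow> \<pi> i = ys ! i"
    using finite_bij_extension[OF _ bij_betw_nth[OF ys(1) refl refl]] by blast
  have "ys = map \<pi> [0..<length ys]" using \<pi>(2) by (intro nth_equalityI) auto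
  then have "M = image_mset \<pi> (std_monomial (Abs_partition xs))"
    using M len by (simp add: std_monomial_def parts image_blowup)
  with \<pi>(1) show ?thesis
    by (rule that) (simp only: parts len[symmetric] distinct_card[OF ys(1), unfolded ys(2)])
qed

lemma mcoeff_perm: "bij \<pi> \<Longrightarrow> mcoeff f (image_mset \<pi> M) = mcoeff f M"
  using mcoeff[of f] by (auto intro: symmetric_seriesD)

lemma mcoeff_bounded: obtains d where "\<And>M. mcoeff f M \<noteq> 0 \<Longrightarrow> size M \<le> d"
  using mcoeff[of f] by (auto simp: symmetric_series_def)

text \<open>
  Induction on the largest number \<open>k\<close> of variables in a monomial of \<open>f\<close>: subtracting suitable multiples
  of the products of \<open>Suc k\<close> power sums removes all monomials with \<open>Suc k\<close> variables, and by
  triangularity these subtractions do not interfere with each other.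
\<close>

lemma in_span_power_prod_aux:
  "(\<And>M. mcoeff f M \<noteq> 0 \<Longrightarrow> card (set_mset M) \<le> k) \<Longrightarrow> f \<in> sym.span (range power_prod)"
proof (induction k arbitrary: f)
  case 0
  have "f = mcoeff f {#} *\<^sub>Q power_prod (partition_of {#})"
    using 0 by (intro sym_eqI) (force simp: power_prod_pp mcoeff_scale mcoeff_one)
  then show ?case by (metis sym.span_base sym.span_scale rangeI)
next
  case (Suc k)
  obtain d where d: "\<And>M. mcoeff f M \<noteq> 0 \<Longrightarrow> size M \<le> d" using mcoeff_bounded by blast
  define T where "T = {lam. length (parts lam) = Suc k \<and> mcoeff f (std_monomial lam) \<noteq> 0}"
  have "T \<subseteq> {lam. psize lam \<le> d}"
    using d by (force simp: T_def std_monomial_def size_blowup psize_def dest!: d)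
  then have fin: "finite T" by (rule finite_subset) auto
  define c where
    "c lam = mcoeff f (std_monomial lam) / mcoeff (power_prod lam) (std_monomial lam)" for lam
  define s where "s = (\<Sum>lam\<in>T. c lam *\<^sub>Q power_prod lam)"
  have "f - s \<in> sym.span (range power_prod)"
  proof (rule Suc.IH)
    fix M assume nz: "mcoeff (f - s) M \<noteq> 0"
    obtain lam \<pi> where lam: "bij \<pi>" "M = image_mset \<pi> (std_monomial lam)"
        "length (parts lam) = card (set_mset M)"
      by (rule monomial_orbit)
    have nz': "mcoeff (f - s) (std_monomial lam) \<noteq> 0" using nz lam by (simp add: mcoeff_perm)
    have tri: "mcoeff (power_prod mu) (std_monomial lam) = 0"
      if "mu \<in> T" "mu \<noteq> lam" "card (set_mset M) \<ge> Suc k" for mu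
      using that mcoeff_power_prod_triangular[of mu lam] lam(3) by (auto simp: T_def)
    show "card (set_mset M) \<le> k"
    proof (rule ccontr)
      assume "\<not> ?thesis"
      then have ge: "card (set_mset M) \<ge> Suc k" by simp
      have "mcoeff s (std_monomial lam) =
          (\<Sum>mu\<in>T. if mu = lam then mcoeff f (std_monomial lam) else 0)"
        unfolding s_def mcoeff_sum mcoeff_scale
        by (rule sum.cong) (use tri[OF _ _ ge] mcoeff_power_prod_std_pos[of lam] in \<open>auto simp: c_def\<close>)
      also have "\<dots> = mcoeff f (std_monomial lam)"
      proof (cases "lam \<in> T")
        case False
        moreover have "mcoeff f (std_monomial lam) = 0"
        proof (rule ccontr)
          assume "mcoeff f (std_monomial lam) \<noteq> 0"
          then have "mcoeff f M \<noteq> 0" using lam by (simp add: mcoeff_perm)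
          then have "card (set_mset M) = Suc k" using Suc.prems ge by (simp add: order_antisym)
          then show False using False \<open>mcoeff f (std_monomial lam) \<noteq> 0\<close> lam(3) by (simp add: T_def)
        qed
        ultimately show ?thesis using fin by simp
      qed (use fin in simp)
      finally show False using nz' by (simp add: mcoeff_diff)
    qed
  qed
  moreover have "s \<in> sym.span (range power_prod)"
    unfolding s_def by (intro sym.span_sum sym.span_scale sym.span_base) auto
  ultimately show ?case using sym.span_add by fastforce
qed

lemma span_power_prod: "sym.span (range power_prod) = UNIV"
proof -
  have "f \<in> sym.span (range power_prod)" for f
  proof -
    obtain d where d: "\<And>M. mcoeff f M \<noteq> 0 \<Longrightarrow> size M \<le> d" using mcoeff_bounded by blast
    have "card (set_mset M) \<le> size M" for M :: "nat multiset"
      by (induction M) (auto simp: card_insert_if)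
    then show ?thesis using d by (intro in_span_power_prod_aux[of _ d]) (meson le_trans)
  qed
  then show ?thesis by auto
qed

text \<open>
  In a linear relation, look at the standard monomial of a partition with the largest number of parts:
  by triangularity it occurs in only one term.
\<close>

lemma power_prod_lin_indep:
  assumes "finite T" "(\<Sum>lam\<in>T. c lam *\<^sub>Q power_prod lam) = 0" "lam0 \<in> T"
  shows "c lam0 = 0"
proof (rule ccontr)
  assume "c lam0 \<noteq> 0"
  define S where "S = {lam \<in> T. c lam \<noteq> 0}"
  have S: "finite S" "S \<noteq> {}" using assms \<open>c lam0 \<noteq> 0\<close> by (auto simp: S_def)
  define m where "m = Max (length ` parts ` S)"
  have "m \<in> length ` parts ` S" using S unfolding m_def by (intro Max_in) auto
  moreover have "length (parts mu) \<le> m" if "mu \<in> S" for mu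
    using S that unfolding m_def by (intro Max_ge) auto
  ultimately obtain lam where lam: "lam \<in> S" "\<And>mu. mu \<in> S \<Longrightarrow> length (parts mu) \<le> length (parts lam)"
    by blast
  have "0 = mcoeff (\<Sum>mu\<in>T. c mu *\<^sub>Q power_prod mu) (std_monomial lam)" using assms by simp
  also have "\<dots> = (\<Sum>mu\<in>T. if mu = lam then c lam * mcoeff (power_prod lam) (std_monomial lam) else 0)"
    unfolding mcoeff_sum mcoeff_scale
    by (rule sum.cong) (use lam mcoeff_power_prod_triangular[of _ lam] in \<open>auto simp: S_def\<close>)
  also have "\<dots> = c lam * mcoeff (power_prod lam) (std_monomial lam)"
    using lam(1) assms(1) by (simp add: S_def)
  finally show False using lam(1) mcoeff_power_prod_std_pos[of lam] by (auto simp: S_def)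
qed

lemma independent_familyI:
  fixes b :: "partition \<Rightarrow> sym"
  assumes indep: "\<And>T c lam. finite T \<Longrightarrow> (\<Sum>lam\<in>T. c lam *\<^sub>Q b lam) = 0 \<Longrightarrow> lam \<in> T \<Longrightarrow> c lam = 0"
  shows "inj b \<and> sym.independent (range b)"
proof -
  have inj: "inj b"
  proof
    fix lam mu assume eq: "b lam = b mu"
    show "lam = mu"
    proof (rule ccontr)
      assume "lam \<noteq> mu"
      then show False
        using eq indep[of "{lam, mu}" "\<lambda>x. if x = lam then 1 else -1" lam]
        by (simp add: sym.scale_left_distrib[symmetric])
    qed
  qed
  have "sym.independent (range b)"
    unfolding sym.independent_explicit_module
  proof (intro allI impI)
    fix T u v
    assume T: "finite T" "T \<subseteq> range b" "(\<Sum>v\<in>T. u v *\<^sub>Q v) = 0" "v \<in> T"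
    obtain S where S: "T = b ` S" using T(2) by (auto simp: subset_image_iff)
    have injS: "inj_on b S" using inj by (meson inj_on_subset subset_UNIV)
    have "finite S" using T(1) S injS finite_imageD by blast
    moreover have "(\<Sum>lam\<in>S. u (b lam) *\<^sub>Q b lam) = 0" using T(3) S by (simp add: sum.reindex[OF injS])
    ultimately show "u v = 0" using indep[of S "u \<circ> b"] T(4) S by auto
  qed
  then show ?thesis using inj by simp
qed

lemma basis_power_prod: "basis_family power_prod"
  unfolding basis_family_def
  using span_power_prod independent_familyI[of power_prod] power_prod_lin_indep by blast


section \<open>Linear maps determined on products of power sums\<close>

text \<open>
  The coordinate is \<open>0\<close> at multisets containing \<open>0\<close>, which represent no basis element.
\<close>

definition pcoord :: "sym \<Rightarrow> nat multiset \<Rightarrow> rat" where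
  "pcoord f A = (if 0 \<in># A then 0 else coord power_prod f (partition_of A))"

lemma pcoord_zero_part: "0 \<in># A \<Longrightarrow> pcoord f A = 0"
  by (simp add: pcoord_def)

lemma pcoord_add: "pcoord (f + g) A = pcoord f A + pcoord g A"
  and pcoord_scale: "pcoord (c *\<^sub>Q f) A = c * pcoord f A"
  and pcoord_0 [simp]: "pcoord 0 A = 0"
  by (simp_all add: pcoord_def coord_add coord_scale basis_power_prod)

lemma pcoord_pp:
  assumes "0 \<notin># B"
  shows "pcoord (pp B) A = (if A = B then 1 else 0)"
proof -
  have B: "pp B = power_prod (partition_of B)" using assms by (simp add: power_prod_pp)
  have "partition_of A = partition_of B \<longleftrightarrow> A = B" if "0 \<notin># A"
    using assms that by (metis shape_partition_of)
  then show ?thesis using assms unfolding B by (auto simp: pcoord_def coord_basis basis_power_prod)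
qed

lemma finite_pcoord: "finite {A. pcoord f A \<noteq> 0}"
proof (rule finite_subset)
  show "{A. pcoord f A \<noteq> 0} \<subseteq> shape ` {lam. coord power_prod f lam \<noteq> 0}"
    by (auto simp: pcoord_def image_iff split: if_splits) (metis shape_partition_of)
qed (simp add: finite_coord basis_power_prod)

lemma sum_pcoord:
  assumes "finite T" "{A. pcoord f A \<noteq> 0} \<subseteq> T"
  shows "(\<Sum>A\<in>T. pcoord f A *\<^sub>Q pp A) = f"
proof -
  let ?S = "{lam. coord power_prod f lam \<noteq> 0}"
  have "(\<Sum>A\<in>T. pcoord f A *\<^sub>Q pp A) = (\<Sum>A\<in>shape ` ?S. pcoord f A *\<^sub>Q pp A)"
    using assms
    by (intro sum.mono_neutral_cong_right)
       (auto simp: pcoord_def image_iff split: if_splits, metis shape_partition_of)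
  also have "\<dots> = (\<Sum>lam\<in>?S. coord power_prod f lam *\<^sub>Q power_prod lam)"
    by (subst sum.reindex) (auto simp: inj_on_def pcoord_def power_prod_pp)
  also have "\<dots> = f"
    by (rule sum_coord[OF basis_power_prod]) (auto simp: finite_coord basis_power_prod)
  finally show ?thesis .
qed

lemma sym_induct_pp [case_names zero add scale pp]:
  assumes "P 0" "\<And>f g. P f \<Longrightarrow> P g \<Longrightarrow> P (f + g)" "\<And>c f. P f \<Longrightarrow> P (c *\<^sub>Q f)"
    "\<And>A. 0 \<notin># A \<Longrightarrow> P (pp A)"
  shows "P f"
proof -
  have "P (\<Sum>A\<in>T. pcoord f A *\<^sub>Q pp A)" if "finite T" "T \<subseteq> {A. pcoord f A \<noteq> 0}" for T
    using that by (induction T rule: finite_induct)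
       (auto intro!: assms simp: pcoord_def split: if_splits)
  from this[OF finite_pcoord order_refl] show ?thesis
    by (simp add: sum_pcoord finite_pcoord)
qed

text \<open>
  The power sums generate the algebra. This is the induction principle behind all product formulas below.
\<close>

lemma sym_induct_power_sum [case_names one add scale power_sum]:
  assumes one: "P 1" and add: "\<And>f g. P f \<Longrightarrow> P g \<Longrightarrow> P (f + g)"
    and scale: "\<And>c f. P f \<Longrightarrow> P (c *\<^sub>Q f)"
    and power_sum: "\<And>n f. n > 0 \<Longrightarrow> P f \<Longrightarrow> P (power_sum n * f)"
  shows "P f"
proof (induction f rule: sym_induct_pp)
  case zero
  show ?case using scale[OF one, of 0] by simp
next
  case (pp A)
  then show ?case by (induction A) (auto simp: pp_add_mset intro!: one power_sum)
qed (auto intro: add scale)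

definition is_linear :: "(sym \<Rightarrow> sym) \<Rightarrow> bool" where
  "is_linear T \<longleftrightarrow> (\<forall>f g. T (f + g) = T f + T g) \<and> (\<forall>c f. T (c *\<^sub>Q f) = c *\<^sub>Q T f)"

lemma is_linearI: "(\<And>f g. T (f + g) = T f + T g) \<Longrightarrow> (\<And>c f. T (c *\<^sub>Q f) = c *\<^sub>Q T f) \<Longrightarrow> is_linear T"
  by (simp add: is_linear_def)

lemma linear_add: "is_linear T \<Longrightarrow> T (f + g) = T f + T g"
  and linear_scale: "is_linear T \<Longrightarrow> T (c *\<^sub>Q f) = c *\<^sub>Q T f"
  by (simp_all add: is_linear_def)

lemma linear_0: "is_linear T \<Longrightarrow> T 0 = 0"
  using linear_scale[of T 0 0] by simp

lemma linear_minus: "is_linear T \<Longrightarrow> T (- f) = - T f"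
  using linear_scale[of T "-1" f] by simp

lemma linear_diff: "is_linear T \<Longrightarrow> T (f - g) = T f - T g"
  using linear_add[of T f "- g"] linear_minus[of T g] by simp

lemma linear_sum: "is_linear T \<Longrightarrow> T (sum f S) = (\<Sum>s\<in>S. T (f s))"
  by (induction S rule: infinite_finite_induct) (auto simp: linear_0 linear_add)

lemma linear_ext_pp:
  assumes "is_linear S" "is_linear T" "\<And>A. 0 \<notin># A \<Longrightarrow> S (pp A) = T (pp A)"
  shows "S f = T f"
  by (induction f rule: sym_induct_pp) (auto simp: assms linear_0 linear_add linear_scale)

lemma scale_mult_left: "(c *\<^sub>Q f) * g = c *\<^sub>Q (f * g)"
  and scale_mult_right: "f * (c *\<^sub>Q g) = c *\<^sub>Q (f * g)"
proof -
  show *: "(c *\<^sub>Q f) * g = c *\<^sub>Q (f * g)" for f g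
    by (rule sym_eqI) (simp add: mcoeff_times mcoeff_scale sum_distrib_left mult.assoc)
  show "f * (c *\<^sub>Q g) = c *\<^sub>Q (f * g)"
    using *[of g f] by (simp add: mult.commute)
qed

lemmas sym_linear_simps =
  distrib_left distrib_right sym.scale_right_distrib scale_mult_left scale_mult_right

lemma is_linear_compose: "is_linear S \<Longrightarrow> is_linear T \<Longrightarrow> is_linear (\<lambda>f. S (T f))"
  and is_linear_id: "is_linear (\<lambda>f. f)"
  and is_linear_const_0: "is_linear (\<lambda>f. 0)"
  and is_linear_plus: "is_linear S \<Longrightarrow> is_linear T \<Longrightarrow> is_linear (\<lambda>f. S f + T f)"
  and is_linear_uminus: "is_linear S \<Longrightarrow> is_linear (\<lambda>f. - S f)"
  and is_linear_minus: "is_linear S \<Longrightarrow> is_linear T \<Longrightarrow> is_linear (\<lambda>f. S f - T f)"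
  and is_linear_scale: "is_linear S \<Longrightarrow> is_linear (\<lambda>f. c *\<^sub>Q S f)"
  and is_linear_times: "is_linear S \<Longrightarrow> is_linear (\<lambda>f. g * S f)"
  and is_linear_times': "is_linear S \<Longrightarrow> is_linear (\<lambda>f. S f * g)"
  by (simp_all add: is_linear_def sym_linear_simps sym.scale_right_diff_distrib mult.commute)

lemma is_linear_sum: "(\<And>i. i \<in> I \<Longrightarrow> is_linear (T i)) \<Longrightarrow> is_linear (\<lambda>f. \<Sum>i\<in>I. T i f)"
  by (induction I rule: infinite_finite_induct) (simp_all add: is_linear_const_0 is_linear_plus)

lemmas linear_intros = is_linear_id is_linear_const_0 is_linear_plus is_linear_uminus
  is_linear_minus is_linear_scale is_linear_times is_linear_times' is_linear_sum

text \<open>The linear map with prescribed values on the products of power sums.\<close>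

definition extend_pp :: "(nat multiset \<Rightarrow> sym) \<Rightarrow> sym \<Rightarrow> sym" where
  "extend_pp \<phi> f = (\<Sum>A | pcoord f A \<noteq> 0. pcoord f A *\<^sub>Q \<phi> A)"

lemma extend_pp_superset:
  "finite T \<Longrightarrow> {A. pcoord f A \<noteq> 0} \<subseteq> T \<Longrightarrow> extend_pp \<phi> f = (\<Sum>A\<in>T. pcoord f A *\<^sub>Q \<phi> A)"
  unfolding extend_pp_def by (rule sum.mono_neutral_left) auto

lemma extend_pp_pp [simp]: "0 \<notin># A \<Longrightarrow> extend_pp \<phi> (pp A) = \<phi> A"
  by (subst extend_pp_superset[of "{A}"]) (auto simp: pcoord_pp)

lemma is_linear_extend_pp: "is_linear (extend_pp \<phi>)"
proof (rule is_linearI)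
  fix f g c
  let ?T = "{A. pcoord f A \<noteq> 0} \<union> {A. pcoord g A \<noteq> 0}"
  have T: "finite ?T" by (simp add: finite_pcoord)
  have "extend_pp \<phi> (f + g) = (\<Sum>A\<in>?T. pcoord (f + g) A *\<^sub>Q \<phi> A)"
    "extend_pp \<phi> f = (\<Sum>A\<in>?T. pcoord f A *\<^sub>Q \<phi> A)"
    "extend_pp \<phi> g = (\<Sum>A\<in>?T. pcoord g A *\<^sub>Q \<phi> A)"
    by (rule extend_pp_superset[OF T]; auto simp: pcoord_add)+
  then show "extend_pp \<phi> (f + g) = extend_pp \<phi> f + extend_pp \<phi> g"
    by (simp add: pcoord_add sym.scale_left_distrib sum.distrib)
  have "extend_pp \<phi> (c *\<^sub>Q f) = (\<Sum>A | pcoord f A \<noteq> 0. pcoord (c *\<^sub>Q f) A *\<^sub>Q \<phi> A)"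
    by (rule extend_pp_superset) (auto simp: finite_pcoord pcoord_scale)
  then show "extend_pp \<phi> (c *\<^sub>Q f) = c *\<^sub>Q extend_pp \<phi> f"
    by (simp add: extend_pp_def pcoord_scale sym.scale_sum_right)
qed

section \<open>The bilinear form making products of power sums orthogonal\<close>

definition form :: "sym \<Rightarrow> sym \<Rightarrow> rat" where
  "form f g = (\<Sum>A | pcoord f A \<noteq> 0. zee_mset A * pcoord f A * pcoord g A)"

lemma form_superset:
  assumes "finite T" "{A. pcoord f A \<noteq> 0} \<inter> {A. pcoord g A \<noteq> 0} \<subseteq> T"
  shows "form f g = (\<Sum>A\<in>T. zee_mset A * pcoord f A * pcoord g A)"
proof -
  let ?S = "{A. pcoord f A \<noteq> 0} \<inter> {A. pcoord g A \<noteq> 0}"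
  have "form f g = (\<Sum>A\<in>?S. zee_mset A * pcoord f A * pcoord g A)"
    unfolding form_def by (rule sum.mono_neutral_right) (auto simp: finite_pcoord)
  also have "\<dots> = (\<Sum>A\<in>T. zee_mset A * pcoord f A * pcoord g A)"
    using assms by (intro sum.mono_neutral_left) auto
  finally show ?thesis .
qed

lemma form_commute: "form f g = form g f"
  unfolding form_def[of g f]
  by (subst form_superset[of "{A. pcoord g A \<noteq> 0}"]) (auto simp: finite_pcoord mult_ac)

lemma form_add_left: "form (f + g) h = form f h + form g h"
  and form_scale_left: "form (c *\<^sub>Q f) h = c * form f h"
proof -
  have *: "form k h = (\<Sum>A | pcoord h A \<noteq> 0. zee_mset A * pcoord k A * pcoord h A)" for k
    by (rule form_superset) (auto simp: finite_pcoord)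
  show "form (f + g) h = form f h + form g h" "form (c *\<^sub>Q f) h = c * form f h"
    by (simp_all add: * pcoord_add pcoord_scale sum.distrib sum_distrib_left algebra_simps)
qed

lemma form_add_right: "form h (f + g) = form h f + form h g"
  and form_scale_right: "form h (c *\<^sub>Q f) = c * form h f"
  by (simp_all add: form_commute[of h] form_add_left form_scale_left)

lemma form_0 [simp]: "form 0 f = 0" "form f 0 = 0"
  using form_scale_left[of 0 0 f] form_scale_right[of f 0 0] by simp_all

lemma form_minus: "form (- f) g = - form f g" "form f (- g) = - form f g"
  using form_scale_left[of "-1" f g] form_scale_right[of f "-1" g] by simp_all

lemma form_diff: "form (f - h) g = form f g - form h g" "form f (g - h) = form f g - form f h"
  using form_add_left[of f "- h" g] form_add_right[of f g "- h"] by (simp_all add: form_minus)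

lemma form_sum_left: "form (sum f S) g = (\<Sum>s\<in>S. form (f s) g)"
  and form_sum_right: "form g (sum f S) = (\<Sum>s\<in>S. form g (f s))"
  by (induction S rule: infinite_finite_induct; simp add: form_add_left form_add_right)+

lemma form_pp: "0 \<notin># A \<Longrightarrow> form (pp A) g = zee_mset A * pcoord g A"
  by (subst form_superset[of "{A}"]) (auto simp: pcoord_pp)

lemma form_pp_pp: "0 \<notin># A \<Longrightarrow> 0 \<notin># B \<Longrightarrow> form (pp A) (pp B) = (if A = B then zee_mset A else 0)"
  by (auto simp: form_pp pcoord_pp)

text \<open>
  The form is a sum of squares with the positive weights \<open>z\<^sub>A\<close>.
\<close>

lemma form_self_eq_0:
  assumes "form f f = 0"
  shows "f = 0"
proof -
  have "(\<Sum>A | pcoord f A \<noteq> 0. zee_mset A * pcoord f A * pcoord f A) = 0"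
    using assms by (simp add: form_def)
  then have "\<forall>A\<in>{A. pcoord f A \<noteq> 0}. zee_mset A * pcoord f A * pcoord f A = 0"
    by (subst (asm) sum_nonneg_eq_0_iff)
       (auto simp: finite_pcoord mult.assoc zee_mset_nonneg intro!: mult_nonneg_nonneg)
  then have "pcoord f A = 0" for A
    by (cases "0 \<in># A") (auto simp: pcoord_zero_part)
  then show ?thesis using sum_pcoord[of "{}" f] by simp
qed

lemma form_nondegenerate: "(\<And>g. form g f = form g h) \<Longrightarrow> f = h"
  using form_self_eq_0[of "f - h"] by (simp add: form_diff)

section \<open>Skewing operators\<close>

text \<open>
  The derivation \<open>n \<partial>/\<partial>p\<^sub>n\<close>, as \<open>count A n\<close> is the exponent of \<open>p\<^sub>n\<close> in \<open>p\<^sub>A\<close>.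
\<close>

definition d_power :: "nat \<Rightarrow> sym \<Rightarrow> sym" where
  "d_power n = extend_pp (\<lambda>A. of_nat (n * count A n) *\<^sub>Q pp (A - {#n#}))"

lemma is_linear_d_power: "is_linear (d_power n)"
  by (simp add: d_power_def is_linear_extend_pp)

lemma d_power_pp: "0 \<notin># A \<Longrightarrow> d_power n (pp A) = of_nat (n * count A n) *\<^sub>Q pp (A - {#n#})"
  by (simp add: d_power_def)

lemma d_power_adjoint:
  assumes "n > 0"
  shows "form (power_sum n * f) g = form f (d_power n g)"
proof (induction f rule: sym_induct_pp)
  case (pp A)
  show ?case
  proof (induction g rule: sym_induct_pp)
    case (pp B)
    have "form (power_sum n * pp A) (pp B) = (if add_mset n A = B then zee_mset B else 0)"
      using pp \<open>0 \<notin># A\<close> assms form_pp_pp[of "add_mset n A" B] by (simp add: pp_add_mset)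
    moreover have "form (pp A) (pp (B - {#n#})) = (if A = B - {#n#} then zee_mset A else 0)"
      using pp \<open>0 \<notin># A\<close> by (subst form_pp_pp) (auto dest: in_diffD)
    moreover have "add_mset n A = B \<longleftrightarrow> A = B - {#n#}" if "n \<in># B"
      using that by auto
    ultimately have "form (power_sum n * pp A) (pp B) =
        of_nat (n * count B n) * form (pp A) (pp (B - {#n#}))"
      using zee_mset_add_mset[of n "B - {#n#}"] by (cases "n \<in># B") (auto simp: not_in_iff)
    then show ?case using pp by (simp add: d_power_pp form_scale_right)
  qed (simp_all add: linear_0 linear_add linear_scale is_linear_d_power form_add_right form_scale_right)
qed (simp_all add: sym_linear_simps form_add_left form_scale_left)

lemma d_power_mult: "d_power n (f * g) = d_power n f * g + f * d_power n g"
proof (induction f rule: sym_induct_pp)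
  case (pp A)
  show ?case
  proof (induction g rule: sym_induct_pp)
    case (pp B)
    have A: "of_nat (n * count A n) *\<^sub>Q (pp (A - {#n#}) * pp B) = of_nat (n * count A n) *\<^sub>Q pp (A + B - {#n#})"
      by (cases "n \<in># A") (auto simp: not_in_iff simp flip: pp_union)
    have B: "of_nat (n * count B n) *\<^sub>Q (pp A * pp (B - {#n#})) = of_nat (n * count B n) *\<^sub>Q pp (A + B - {#n#})"
      by (cases "n \<in># B") (auto simp: not_in_iff simp flip: pp_union)
    have "d_power n (pp A * pp B) = of_nat (n * count (A + B) n) *\<^sub>Q pp (A + B - {#n#})"
      using pp \<open>0 \<notin># A\<close> d_power_pp[of "A + B" n] by (simp add: pp_union)
    also have "\<dots> = of_nat (n * count A n) *\<^sub>Q pp (A + B - {#n#}) + of_nat (n * count B n) *\<^sub>Q pp (A + B - {#n#})"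
      by (simp add: distrib_left sym.scale_left_distrib[symmetric])
    finally show ?case
      using pp \<open>0 \<notin># A\<close> by (simp only: A[symmetric] B[symmetric]) (simp add: d_power_pp scale_mult_left scale_mult_right)
  qed (simp_all add: linear_0 linear_add linear_scale is_linear_d_power sym_linear_simps algebra_simps)
qed (simp_all add: linear_0 linear_add linear_scale is_linear_d_power sym_linear_simps algebra_simps)

lemma d_power_1 [simp]: "d_power n 1 = 0"
  using d_power_pp[of "{#}" n] by simp

lemma d_power_power_sum: "n > 0 \<Longrightarrow> d_power k (power_sum n) = (if k = n then of_nat n *\<^sub>Q 1 else 0)"
  using d_power_pp[of "{#n#}" k] by (auto simp: pp_add_mset)

text \<open>
  Adjoints of products are composites of adjoints in the opposite order, so the adjoints of the generators
  \<open>p\<^sub>n\<close> suffice.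
\<close>

lemma adjoint_exists: "\<exists>T. \<forall>g h. form (f * g) h = form g (T h)"
proof (induction f rule: sym_induct_power_sum)
  case one
  show ?case by (rule exI[of _ "\<lambda>h. h"]) simp
next
  case (add f g)
  then obtain S T where "\<forall>k h. form (f * k) h = form k (S h)" "\<forall>k h. form (g * k) h = form k (T h)" by blast
  then show ?case by (intro exI[of _ "\<lambda>h. S h + T h"]) (simp add: distrib_right form_add_left form_add_right)
next
  case (scale c f)
  then obtain S where "\<forall>k h. form (f * k) h = form k (S h)" by blast
  then show ?case by (intro exI[of _ "\<lambda>h. c *\<^sub>Q S h"]) (simp add: scale_mult_left form_scale_left form_scale_right)
next
  case (power_sum n f)
  then obtain S where "\<forall>k h. form (f * k) h = form k (S h)" by blast
  then show ?case
    using power_sum by (intro exI[of _ "\<lambda>h. S (d_power n h)"]) (simp add: mult.assoc d_power_adjoint)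
qed

definition skew :: "sym \<Rightarrow> sym \<Rightarrow> sym" where
  "skew f = (SOME T. \<forall>g h. form (f * g) h = form g (T h))"

lemma skew_adjoint: "form (f * g) h = form g (skew f h)"
  unfolding skew_def using someI_ex[OF adjoint_exists[of f]] by (rule allE) (erule allE)

lemma skew_unique: "(\<And>g. form (f * g) h = form g k) \<Longrightarrow> skew f h = k"
  by (rule form_nondegenerate) (simp add: skew_adjoint[symmetric])

lemma is_linear_skew: "is_linear (skew f)"
  by (intro is_linearI skew_unique) (simp_all add: form_add_right form_scale_right skew_adjoint)

lemma is_linear_skew_left: "is_linear (\<lambda>f. skew f h)"
  by (intro is_linearI skew_unique)
     (simp_all add: form_add_right form_scale_right form_add_left form_scale_left sym_linear_simps skew_adjoint)

lemma skew_1 [simp]: "skew 1 h = h"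
  by (rule skew_unique) simp

lemma skew_mult: "skew (f * g) h = skew f (skew g h)"
proof (rule skew_unique)
  fix k
  show "form (f * g * k) h = form k (skew f (skew g h))"
    using skew_adjoint[of g "f * k" h] skew_adjoint[of f k] by (simp add: mult_ac)
qed

lemma skew_power_sum: "n > 0 \<Longrightarrow> skew (power_sum n) h = d_power n h"
  by (rule skew_unique) (simp add: d_power_adjoint)

lemma skew_commute: "skew f (skew g h) = skew g (skew f h)"
  using skew_mult[of f g h] skew_mult[of g f h] by (simp add: mult.commute)

lemma skew_0 [simp]: "skew f 0 = 0" "skew 0 f = 0"
  by (simp_all add: linear_0[OF is_linear_skew] linear_0[OF is_linear_skew_left])

lemmas skew_linear_simps =
  linear_add[OF is_linear_skew] linear_scale[OF is_linear_skew]
  linear_add[OF is_linear_skew_left] linear_scale[OF is_linear_skew_left]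
  linear_minus[OF is_linear_skew] linear_minus[OF is_linear_skew_left]


section \<open>Homogeneous elements\<close>

definition homog :: "int \<Rightarrow> sym \<Rightarrow> bool" where
  "homog n f \<longleftrightarrow> (\<forall>M. mcoeff f M \<noteq> 0 \<longrightarrow> int (size M) = n)"

lemma homog_0 [simp]: "homog n 0"
  by (simp add: homog_def)

lemma homog_1 [simp]: "homog 0 1"
  by (simp add: homog_def mcoeff_one)

lemma homog_add: "homog n f \<Longrightarrow> homog n g \<Longrightarrow> homog n (f + g)"
  by (force simp: homog_def mcoeff_add)

lemma homog_scale: "homog n f \<Longrightarrow> homog n (c *\<^sub>Q f)"
  by (simp add: homog_def mcoeff_scale)

lemma homog_uminus: "homog n f \<Longrightarrow> homog n (- f)"
  by (simp add: homog_def mcoeff_minus)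

lemma homog_sum: "(\<And>i. i \<in> I \<Longrightarrow> homog n (f i)) \<Longrightarrow> homog n (sum f I)"
  by (induction I rule: infinite_finite_induct) (auto simp: homog_add)

lemma homog_mult:
  assumes "homog m f" "homog n g"
  shows "homog (m + n) (f * g)"
  unfolding homog_def
proof (intro allI impI)
  fix M assume "mcoeff (f * g) M \<noteq> 0"
  then obtain A where A: "A \<subseteq># M" "mcoeff f A \<noteq> 0" "mcoeff g (M - A) \<noteq> 0"
    by (auto simp: mcoeff_times elim!: sum.not_neutral_contains_not_neutral)
  then have "size M = size A + size (M - A)"
    by (metis size_union subset_mset.add_diff_inverse)
  then show "int (size M) = m + n" using A assms by (simp add: homog_def)
qed

lemma homog_prod: "(\<And>i. i \<in> I \<Longrightarrow> homog (d i) (f i)) \<Longrightarrow> homog (sum d I) (prod f I)"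
  by (induction I rule: infinite_finite_induct) (auto simp: homog_mult)

lemma homog_power_sum: "homog (int n) (power_sum n)"
  by (auto simp: homog_def mcoeff_power_sum split: if_splits)

lemma homog_pp: "homog (int (\<Sum>\<^sub># A)) (pp A)"
  by (induction A) (auto simp: pp_add_mset intro: homog_mult homog_power_sum)

lemma mcoeff_homogeneous_component:
  "mcoeff (homogeneous_component n f) M = (if size M = n then mcoeff f M else 0)"
  by (simp add: homogeneous_component.rep_eq)

lemma is_linear_homogeneous_component: "is_linear (homogeneous_component n)"
  by (intro is_linearI sym_eqI) (simp_all add: mcoeff_homogeneous_component mcoeff_add mcoeff_scale)

lemma homogeneous_component_homog:
  "homog m f \<Longrightarrow> homogeneous_component n f = (if int n = m then f else 0)"
  by (intro sym_eqI) (auto simp: mcoeff_homogeneous_component homog_def)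

lemma pcoord_homogeneous_component:
  "pcoord (homogeneous_component n f) A = (if \<Sum>\<^sub># A = n then pcoord f A else 0)"
proof (induction f rule: sym_induct_pp)
  case (pp B)
  then show ?case
    using homogeneous_component_homog[OF homog_pp, of n B]
    by (auto simp: pcoord_pp simp del: of_nat_sum_mset)
qed (simp_all add: linear_0[OF is_linear_homogeneous_component] linear_add[OF is_linear_homogeneous_component]
  linear_scale[OF is_linear_homogeneous_component] pcoord_add pcoord_scale)

lemma pcoord_eqI: "(\<And>A. pcoord f A = pcoord g A) \<Longrightarrow> f = g"
proof -
  assume "\<And>A. pcoord f A = pcoord g A"
  then have "pcoord f = pcoord g" by (rule ext)
  then show "f = g"
    using sum_pcoord[OF finite_pcoord order_refl, of f] sum_pcoord[OF finite_pcoord order_refl, of g]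
    by metis
qed

lemma homog_iff_pcoord: "homog n f \<longleftrightarrow> (\<forall>A. pcoord f A \<noteq> 0 \<longrightarrow> int (\<Sum>\<^sub># A) = n)"
proof
  assume f: "homog n f"
  show "\<forall>A. pcoord f A \<noteq> 0 \<longrightarrow> int (\<Sum>\<^sub># A) = n"
  proof (intro allI impI)
    fix A assume "pcoord f A \<noteq> 0"
    then have "pcoord (homogeneous_component (\<Sum>\<^sub># A) f) A \<noteq> 0"
      by (simp add: pcoord_homogeneous_component)
    then show "int (\<Sum>\<^sub># A) = n"
      using homogeneous_component_homog[OF f, of "\<Sum>\<^sub># A"] by (auto split: if_splits)
  qed
next
  assume "\<forall>A. pcoord f A \<noteq> 0 \<longrightarrow> int (\<Sum>\<^sub># A) = n"
  then have "homog n (\<Sum>A | pcoord f A \<noteq> 0. pcoord f A *\<^sub>Q pp A)"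
    by (intro homog_sum homog_scale) (metis homog_pp mem_Collect_eq)
  then show "homog n f" by (simp add: sum_pcoord finite_pcoord)
qed

lemma form_homog: "homog m f \<Longrightarrow> homog n g \<Longrightarrow> m \<noteq> n \<Longrightarrow> form f g = 0"
  unfolding homog_iff_pcoord form_def by (intro sum.neutral) force

lemma pcoord_skew: "0 \<notin># A \<Longrightarrow> zee_mset A * pcoord (skew f g) A = form (pp A * f) g"
  using skew_adjoint[of f "pp A" g] by (simp add: form_pp mult.commute)

lemma skew_homog:
  assumes "homog m f" "homog n g"
  shows "homog (n - m) (skew f g)"
  unfolding homog_iff_pcoord
proof (intro allI impI)
  fix A assume nz: "pcoord (skew f g) A \<noteq> 0"
  then have "0 \<notin># A" using pcoord_zero_part by blast
  then have "form (pp A * f) g \<noteq> 0" using nz pcoord_skew[of A f g] by auto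
  then show "int (\<Sum>\<^sub># A) = n - m"
    using form_homog[OF homog_mult[OF homog_pp assms(1)] assms(2)] by fastforce
qed

lemma homog_neg: "homog n f \<Longrightarrow> n < 0 \<Longrightarrow> f = 0"
  by (intro sym_eqI) (auto simp: homog_def)

lemma skew_eq_0_degree: "homog m f \<Longrightarrow> homog n g \<Longrightarrow> n < m \<Longrightarrow> skew f g = 0"
  by (rule homog_neg[OF skew_homog]) auto

section \<open>Complete homogeneous functions\<close>

lemma mcoeff_complete_h: "mcoeff (complete_h n) M = (if int (size M) = n then 1 else 0)"
  by (simp add: complete_h.rep_eq)

lemma complete_h_0 [simp]: "complete_h 0 = 1"
  by (intro sym_eqI) (simp add: mcoeff_complete_h mcoeff_one)

lemma complete_h_neg [simp]: "n < 0 \<Longrightarrow> complete_h n = 0"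
  by (intro sym_eqI) (simp add: mcoeff_complete_h)

lemma homog_complete_h: "homog n (complete_h n)"
  by (auto simp: homog_def mcoeff_complete_h split: if_splits)

text \<open>
  Compare coefficients at a monomial \<open>M\<close> of degree \<open>m\<close>. The product \<open>p\<^sub>k h\<^bsub>m-k\<^esub>\<close> counts the
  variables with exponent at least \<open>k\<close> in \<open>M\<close>, and summing these numbers over \<open>k\<close> gives the sum of
  the exponents, which is \<open>m\<close>. Allowing any upper bound \<open>N \<ge> m\<close> avoids case distinctions when \<open>m\<close>
  is shifted.
\<close>

lemma newton:
  assumes "m \<le> int N"
  shows "of_int m *\<^sub>Q complete_h m = (\<Sum>k\<in>{1..N}. power_sum k * complete_h (m - int k))"
proof (rule sym_eqI)
  fix M :: "nat multiset"
  have summand: "mcoeff (power_sum k * complete_h (m - int k)) M =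
      (if int (size M) = m then of_nat (card {i \<in> set_mset M. k \<le> count M i}) else 0)"
    if "k \<in> {1..N}" for k
  proof -
    let ?R = "{A. A \<subseteq># M \<and> (\<exists>i. A = replicate_mset k i)}"
    have "mcoeff (power_sum k * complete_h (m - int k)) M =
       (\<Sum>A\<in>?R. mcoeff (complete_h (m - int k)) (M - A))"
      unfolding mcoeff_times
      by (rule sum.mono_neutral_cong_right) (auto simp: finite_submultisets mcoeff_power_sum)
    also have "\<dots> = (\<Sum>A\<in>?R. if int (size M) = m then 1 else 0)"
    proof (rule sum.cong)
      fix A assume A: "A \<in> ?R"
      then have "size (M - A) = size M - k" "k \<le> size M"
        using size_mset_mono[of A M] by (auto simp: size_Diff_submset)
      then show "mcoeff (complete_h (m - int k)) (M - A) = (if int (size M) = m then 1 else 0)"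
        by (auto simp: mcoeff_complete_h)
    qed simp
    also have "?R = replicate_mset k ` {i \<in> set_mset M. k \<le> count M i}"
    proof -
      have "i \<in># M" if "replicate_mset k i \<subseteq># M" for i
        using mset_subset_eqD[OF that, of i] \<open>k \<in> {1..N}\<close> by simp
      then show ?thesis by (auto simp: image_iff count_le_replicate_mset_subset_eq)
    qed
    also have "(\<Sum>A\<in>\<dots>. if int (size M) = m then 1 else 0 :: rat) =
        (if int (size M) = m then of_nat (card {i \<in> set_mset M. k \<le> count M i}) else 0)"
      using that by (subst sum.reindex) (auto simp: inj_on_def replicate_mset_eq_iff)
    finally show ?thesis .
  qed
  have count: "(\<Sum>k\<in>{1..N}. card {i \<in> set_mset M. k \<le> count M i}) = size M" if "size M \<le> N"
  proof -
    have "(\<Sum>k\<in>{1..N}. card {i \<in> set_mset M. k \<le> count M i}) =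
        (\<Sum>k\<in>{1..N}. \<Sum>i\<in>set_mset M. if k \<le> count M i then 1 else 0)"
      by (intro sum.cong) (auto simp: sum.If_cases Int_def)
    also have "\<dots> = (\<Sum>i\<in>set_mset M. \<Sum>k\<in>{1..N}. if k \<le> count M i then 1 else 0)"
      by (rule sum.swap)
    also have "\<dots> = (\<Sum>i\<in>set_mset M. count M i)"
    proof (rule sum.cong)
      fix i
      have "{1..N} \<inter> {k. k \<le> count M i} = {1..count M i}"
        using that count_le_size[of M i] by auto
      then show "(\<Sum>k\<in>{1..N}. if k \<le> count M i then 1 else 0) = count M i"
        by (simp add: sum.If_cases)
    qed simp
    finally show ?thesis by (simp add: size_multiset_overloaded_eq)
  qed
  show "mcoeff (of_int m *\<^sub>Q complete_h m) M =
      mcoeff (\<Sum>k\<in>{1..N}. power_sum k * complete_h (m - int k)) M"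
    unfolding mcoeff_sum using assms count
    by (auto simp: summand mcoeff_scale mcoeff_complete_h simp flip: of_nat_sum)
qed

lemma scale_cancel: "c \<noteq> 0 \<Longrightarrow> c *\<^sub>Q f = c *\<^sub>Q g \<Longrightarrow> f = g"
  by (simp add: sym.scale_cancel_left)

lemma of_nat_scale_1: "of_nat n * f = of_nat n *\<^sub>Q f"
  by (induction n) (simp_all add: distrib_right sym.scale_left_distrib)

text \<open>
  Apply the derivation to Newton's recursion: the term \<open>j = k\<close> contributes \<open>k h\<^bsub>m-k\<^esub>\<close>, and by
  induction the remaining terms form Newton's recursion for \<open>h\<^bsub>m-k\<^esub>\<close>.
\<close>

lemma d_power_complete_h:
  assumes "k > 0"
  shows "d_power k (complete_h m) = complete_h (m - int k)"
proof (cases "m < 0")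
  case True
  then show ?thesis using assms by (simp add: linear_0 is_linear_d_power)
next
  case False
  have "d_power k (complete_h (int n)) = complete_h (int n - int k)" for n
  proof (induction n rule: less_induct)
    case (less n)
    show ?case
    proof (cases "n = 0")
      case False
      have "of_int (int n) *\<^sub>Q d_power k (complete_h (int n)) =
          (\<Sum>j\<in>{1..n}. d_power k (power_sum j * complete_h (int n - int j)))"
        by (subst linear_scale[OF is_linear_d_power, symmetric], subst newton[of _ n])
           (simp_all add: linear_sum is_linear_d_power)
      also have "\<dots> = (\<Sum>j\<in>{1..n}. (if j = k then of_nat k *\<^sub>Q complete_h (int n - int k) else 0)
          + power_sum j * complete_h (int n - int k - int j))"
      proof (rule sum.cong)
        fix j assume j: "j \<in> {1..n}"
        then have "d_power k (complete_h (int (n - j))) = complete_h (int (n - j) - int k)"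
          by (intro less.IH) auto
        then show "d_power k (power_sum j * complete_h (int n - int j)) =
            (if j = k then of_nat k *\<^sub>Q complete_h (int n - int k) else 0)
          + power_sum j * complete_h (int n - int k - int j)"
          using j by (simp add: d_power_mult d_power_power_sum of_nat_diff scale_mult_left algebra_simps)
      qed simp
      also have "\<dots> = of_nat k *\<^sub>Q complete_h (int n - int k) + of_int (int n - int k) *\<^sub>Q complete_h (int n - int k)"
        using assms by (subst newton[of _ n]) (auto simp: sum.distrib)
      also have "\<dots> = of_int (int n) *\<^sub>Q complete_h (int n - int k)"
        by (simp add: sym.scale_left_distrib[symmetric])
      finally show ?thesis using False by (simp add: scale_cancel)
    qed (use assms in simp)
  qed
  from this[of "nat m"] False show ?thesis by simp
qed

section \<open>The antipode\<close>

text \<open>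
  The algebra automorphism with \<open>p\<^sub>n \<mapsto> -p\<^sub>n\<close>, that is, the antipode of the Hopf algebra. It is used instead
  of the involution \<open>\<omega>\<close>, from which it differs by the sign \<open>(-1)\<^sup>n\<close> in degree \<open>n\<close>, because the
  signs of Bernstein's formula and of the second operator identity are absorbed in it.
\<close>

definition antipode :: "sym \<Rightarrow> sym" where
  "antipode = extend_pp (\<lambda>A. (-1) ^ size A *\<^sub>Q pp A)"

lemma is_linear_antipode: "is_linear antipode"
  by (simp add: antipode_def is_linear_extend_pp)

lemmas antipode_linear_simps = linear_0[OF is_linear_antipode] linear_add[OF is_linear_antipode]
  linear_scale[OF is_linear_antipode] linear_minus[OF is_linear_antipode]

lemma antipode_pp: "0 \<notin># A \<Longrightarrow> antipode (pp A) = (-1) ^ size A *\<^sub>Q pp A"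
  by (simp add: antipode_def)

lemma antipode_1 [simp]: "antipode 1 = 1"
  using antipode_pp[of "{#}"] by simp

lemma antipode_mult: "antipode (f * g) = antipode f * antipode g"
proof (induction f rule: sym_induct_pp)
  case (pp A)
  show ?case
  proof (induction g rule: sym_induct_pp)
    case (pp B)
    then show ?case using \<open>0 \<notin># A\<close> antipode_pp[of "A + B"]
      by (simp add: antipode_pp pp_union scale_mult_left scale_mult_right power_add)
  qed (simp_all add: antipode_linear_simps sym_linear_simps)
qed (simp_all add: antipode_linear_simps sym_linear_simps)

lemma antipode_antipode [simp]: "antipode (antipode f) = f"
  by (rule linear_ext_pp[of "\<lambda>f. antipode (antipode f)" "\<lambda>f. f"])
     (simp_all add: is_linear_compose is_linear_antipode is_linear_id antipode_pp
        linear_scale[OF is_linear_antipode] flip: power_mult_distrib)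

lemma antipode_power_sum: "n > 0 \<Longrightarrow> antipode (power_sum n) = - power_sum n"
  using antipode_pp[of "{#n#}"] by (simp add: pp_add_mset)

lemma pcoord_antipode: "pcoord (antipode f) A = (-1) ^ size A * pcoord f A"
  by (induction f rule: sym_induct_pp)
     (auto simp: antipode_linear_simps antipode_pp pcoord_add pcoord_scale pcoord_pp algebra_simps)

lemma form_antipode: "form (antipode f) (antipode g) = form f g"
proof -
  have *: "zee_mset A * ((-1) ^ size A * pcoord f A) * ((-1) ^ size A * pcoord g A) = zee_mset A * pcoord f A * pcoord g A" for A
    by (cases "even (size A)") auto
  show ?thesis
    by (subst form_superset[of "{A. pcoord f A \<noteq> 0}"])
       (auto simp: pcoord_antipode finite_pcoord * form_def)
qed

lemma homog_antipode: "homog n f \<Longrightarrow> homog n (antipode f)"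
  by (simp add: homog_iff_pcoord pcoord_antipode)

text \<open>
  The antipode is a multiplicative isometry and an involution, so it transports adjoints.
\<close>

lemma antipode_skew: "antipode (skew f g) = skew (antipode f) (antipode g)"
proof (rule skew_unique[symmetric])
  fix k
  have "form (antipode f * k) (antipode g) = form (antipode (f * antipode k)) (antipode g)"
    by (simp add: antipode_mult)
  also have "\<dots> = form (antipode k) (skew f g)" by (simp add: form_antipode skew_adjoint)
  also have "\<dots> = form k (antipode (skew f g))"
    using form_antipode[of "antipode k" "skew f g"] by simp
  finally show "form (antipode f * k) (antipode g) = form k (antipode (skew f g))" .
qed

text \<open>
  This is \<open>(-1)\<^sup>n e\<^sub>n\<close>, with \<open>e\<^sub>n\<close> the elementary symmetric function.
\<close>

definition signed_e :: "int \<Rightarrow> sym" where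
  "signed_e n = antipode (complete_h n)"

lemma signed_e_0 [simp]: "signed_e 0 = 1"
  and signed_e_neg [simp]: "n < 0 \<Longrightarrow> signed_e n = 0"
  and homog_signed_e: "homog n (signed_e n)"
  by (simp_all add: signed_e_def antipode_linear_simps homog_antipode homog_complete_h)

lemma antipode_signed_e: "antipode (signed_e n) = complete_h n"
  by (simp add: signed_e_def)

lemma d_power_signed_e:
  assumes "k > 0"
  shows "d_power k (signed_e m) = - signed_e (m - int k)"
proof -
  have "d_power k (signed_e m) = - antipode (skew (power_sum k) (complete_h m))"
    unfolding antipode_skew using assms
    by (simp add: antipode_power_sum skew_linear_simps skew_power_sum signed_e_def)
  then show ?thesis using assms by (simp add: skew_power_sum d_power_complete_h signed_e_def)
qed

section \<open>Generating series of skewing operators\<close>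

text \<open>
  The commutator of \<open>u\<^sup>\<bottom>\<close> with multiplication by \<open>p\<^sub>n\<close>: this is the adjoint form of the Leibniz
  rule for \<open>p\<^sub>n\<^sup>\<bottom>\<close> applied to a product with the factor \<open>u\<close>.
\<close>

lemma skew_power_sum_mult:
  assumes "n > 0"
  shows "skew u (power_sum n * f) = power_sum n * skew u f + skew (d_power n u) f"
proof (rule skew_unique)
  fix k
  have "form (u * k) (power_sum n * f) = form (d_power n (u * k)) f"
    using d_power_adjoint[OF assms, of f "u * k"] by (simp add: form_commute)
  also have "\<dots> = form k (skew (d_power n u) f) + form (d_power n k) (skew u f)"
    by (simp add: d_power_mult form_add_left skew_adjoint)
  also have "form (d_power n k) (skew u f) = form k (power_sum n * skew u f)"
    using d_power_adjoint[OF assms, of "skew u f" k] by (simp add: form_commute)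
  finally show "form (u * k) (power_sum n * f) = form k (power_sum n * skew u f + skew (d_power n u) f)"
    by (simp add: form_add_right)
qed

definition h_skew :: "sym \<Rightarrow> sym fps" where
  "h_skew f = Abs_fps (\<lambda>n. skew (complete_h (int n)) f)"

lemma h_skew_nth [simp]: "fps_nth (h_skew f) n = skew (complete_h (int n)) f"
  by (simp add: h_skew_def)

lemma skew_complete_h_1: "skew (complete_h (int n)) 1 = (if n = 0 then 1 else 0)"
  using skew_eq_0_degree[OF homog_complete_h homog_1, of "int n"] by auto

lemma h_skew_1 [simp]: "h_skew 1 = 1"
  by (rule fps_ext) (simp add: skew_complete_h_1)

lemma h_skew_add: "h_skew (f + g) = h_skew f + h_skew g"
  by (rule fps_ext) (simp add: skew_linear_simps)

lemma h_skew_power_sum_mult: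
  assumes "n > 0"
  shows "h_skew (power_sum n * f) = (fps_const (power_sum n) + fps_X ^ n) * h_skew f"
proof (rule fps_ext)
  fix k
  show "fps_nth (h_skew (power_sum n * f)) k =
      fps_nth ((fps_const (power_sum n) + fps_X ^ n) * h_skew f) k"
    using assms
    by (cases "k < n")
       (simp_all add: skew_power_sum_mult d_power_complete_h distrib_right fps_X_power_mult_nth of_nat_diff)
qed

lemma h_skew_scale: "h_skew (c *\<^sub>Q f) = fps_const (c *\<^sub>Q 1) * h_skew f"
  by (rule fps_ext) (simp add: skew_linear_simps scale_mult_left)

text \<open>
  The operators \<open>h\<^sub>n\<^sup>\<bottom>\<close> satisfy \<open>h\<^sub>n\<^sup>\<bottom>(f g) = \<Sum> h\<^sub>i\<^sup>\<bottom> f \<cdot> h\<^bsub>n-i\<^esub>\<^sup>\<bottom> g\<close>.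
  It is enough to let \<open>f\<close> run through the generators, on which the series acts as multiplication by
  \<open>p\<^sub>n + t\<^sup>n\<close> by the commutator formula.
\<close>

lemma h_skew_mult: "h_skew (f * g) = h_skew f * h_skew g"
proof (induction f rule: sym_induct_power_sum)
  case (power_sum n f)
  then show ?case by (simp add: mult.assoc h_skew_power_sum_mult)
qed (simp_all add: distrib_right h_skew_add scale_mult_left h_skew_scale mult.assoc)

interpretation h_skew: comm_ring_hom h_skew
  by unfold_locales
     (simp_all add: h_skew_add h_skew_mult, rule fps_ext, simp)

lemma newton_skew:
  "of_nat k *\<^sub>Q skew (complete_h (int k)) f = (\<Sum>j\<in>{1..k}. skew (complete_h (int (k - j))) (d_power j f))"
proof -
  have "of_nat k *\<^sub>Q skew (complete_h (int k)) f = skew (of_int (int k) *\<^sub>Q complete_h (int k)) f"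
    by (simp add: skew_linear_simps)
  also have "\<dots> = (\<Sum>j\<in>{1..k}. skew (power_sum j * complete_h (int k - int j)) f)"
    by (subst newton[of _ k]) (simp_all add: linear_sum[OF is_linear_skew_left])
  also have "\<dots> = (\<Sum>j\<in>{1..k}. skew (complete_h (int (k - j))) (d_power j f))"
    by (intro sum.cong) (auto simp: skew_mult skew_commute[of "power_sum _"] skew_power_sum of_nat_diff)
  finally show ?thesis .
qed

lemma skew_complete_h_complete_h: "skew (complete_h (int k)) (complete_h m) = complete_h (m - int k)"
proof (induction k arbitrary: m rule: less_induct)
  case (less k)
  show ?case
  proof (cases "k = 0")
    case False
    have "of_nat k *\<^sub>Q skew (complete_h (int k)) (complete_h m) = (\<Sum>j\<in>{1..k}. complete_h (m - int k))"
      unfolding newton_skew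
    proof (rule sum.cong)
      fix j assume "j \<in> {1..k}"
      then show "skew (complete_h (int (k - j))) (d_power j (complete_h m)) = complete_h (m - int k)"
        using less.IH[of "k - j" "m - int j"] by (simp add: d_power_complete_h of_nat_diff)
    qed simp
    also have "\<dots> = of_nat k *\<^sub>Q complete_h (m - int k)" by (simp add: of_nat_scale_1)
    finally show ?thesis using False by (simp add: scale_cancel)
  qed simp
qed

text \<open>
  In Newton's recursion for \<open>h\<^sub>k\<^sup>\<bottom>\<close> with \<open>k \<ge> 2\<close>, by induction only the terms \<open>j = k - 1\<close> and
  \<open>j = k\<close> survive, and they cancel.
\<close>

lemma skew_complete_h_signed_e:
  "skew (complete_h (int k)) (signed_e m) =
     (if k = 0 then signed_e m else if k = 1 then - signed_e (m - 1) else 0)"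
proof (induction k arbitrary: m rule: less_induct)
  case (less k)
  consider "k = 0" | "k = 1" | "k \<ge> 2" by linarith
  then show ?case
  proof cases
    case 2
    then show ?thesis using newton_skew[of 1 "signed_e m"] by (simp add: d_power_signed_e)
  next
    case 3
    have "of_nat k *\<^sub>Q skew (complete_h (int k)) (signed_e m) =
        (\<Sum>j\<in>{1..k}. skew (complete_h (int (k - j))) (- signed_e (m - int j)))"
      unfolding newton_skew by (intro sum.cong) (auto simp: d_power_signed_e)
    also have "\<dots> = (\<Sum>j\<in>{k - 1, k}. skew (complete_h (int (k - j))) (- signed_e (m - int j)))"
    proof (intro sum.mono_neutral_right ballI)
      fix j assume "j \<in> {1..k} - {k - 1, k}"
      then show "skew (complete_h (int (k - j))) (- signed_e (m - int j)) = 0"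
        using less.IH[of "k - j" "m - int j"] by (auto simp: skew_linear_simps)
    qed (use 3 in auto)
    also have "\<dots> = 0"
      using 3 less.IH[of 1 "m - int (k - 1)"] by (simp add: skew_linear_simps of_nat_diff)
    finally show ?thesis using 3 by (simp add: scale_cancel)
  qed simp
qed

lemma h_skew_signed_e: "h_skew (signed_e m) = fps_const (signed_e m) - fps_X * fps_const (signed_e (m - 1))"
  by (rule fps_ext) (auto simp: skew_complete_h_signed_e fps_nth_Abs_fps)

definition e_skew :: "sym \<Rightarrow> sym fps" where
  "e_skew f = Abs_fps (\<lambda>n. skew (signed_e (int n)) f)"

lemma e_skew_nth [simp]: "fps_nth (e_skew f) n = skew (signed_e (int n)) f"
  by (simp add: e_skew_def)

lemma e_skew_power_sum_mult:
  assumes "n > 0"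
  shows "e_skew (power_sum n * f) = (fps_const (power_sum n) - fps_X ^ n) * e_skew f"
proof (rule fps_ext)
  fix k
  show "fps_nth (e_skew (power_sum n * f)) k =
      fps_nth ((fps_const (power_sum n) - fps_X ^ n) * e_skew f) k"
    using assms
    by (cases "k < n")
       (simp_all add: skew_power_sum_mult d_power_signed_e left_diff_distrib fps_X_power_mult_nth
          skew_linear_simps of_nat_diff)
qed

lemma e_skew_1 [simp]: "e_skew 1 = 1"
  using skew_eq_0_degree[OF homog_signed_e homog_1] by (intro fps_ext) auto

lemma e_skew_add: "e_skew (f + g) = e_skew f + e_skew g"
  by (rule fps_ext) (simp add: skew_linear_simps)

lemma e_skew_scale: "e_skew (c *\<^sub>Q f) = fps_const (c *\<^sub>Q 1) * e_skew f"
  by (rule fps_ext) (simp add: skew_linear_simps scale_mult_left)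

lemma e_skew_mult: "e_skew (f * g) = e_skew f * e_skew g"
proof (induction f rule: sym_induct_power_sum)
  case (power_sum n f)
  then show ?case by (simp add: mult.assoc e_skew_power_sum_mult)
qed (simp_all add: distrib_right e_skew_add scale_mult_left e_skew_scale mult.assoc)

interpretation e_skew: comm_ring_hom e_skew
  by unfold_locales
     (simp_all add: e_skew_add e_skew_mult, rule fps_ext, simp)

lemma e_skew_complete_h:
  "e_skew (complete_h m) = fps_const (complete_h m) - fps_X * fps_const (complete_h (m - 1))"
proof (rule fps_ext)
  fix k
  have "skew (signed_e (int k)) (complete_h m) = antipode (skew (complete_h (int k)) (signed_e m))"
    by (simp add: antipode_skew antipode_signed_e signed_e_def[symmetric])
  then show "fps_nth (e_skew (complete_h m)) k =
      fps_nth (fps_const (complete_h m) - fps_X * fps_const (complete_h (m - 1))) k"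
    by (auto simp: skew_complete_h_signed_e antipode_signed_e antipode_linear_simps)
qed


section \<open>Jacobi--Trudi determinants\<close>

definition jt_matrix :: "int list \<Rightarrow> sym mat" where
  "jt_matrix a = mat (length a) (length a) (\<lambda>(i, j). complete_h (a ! i + int j - int i))"

lemma schur_seq_det: "schur_seq a = det (jt_matrix a)"
  by (simp add: schur_seq_def jt_matrix_def)

lemma jt_matrix_carrier [simp]: "jt_matrix a \<in> carrier_mat (length a) (length a)"
  by (simp add: jt_matrix_def)

lemma schur_seq_Nil [simp]: "schur_seq [] = 1"
  by (simp add: schur_seq_def det_def)

interpretation fps_const: comm_ring_hom "fps_const :: sym \<Rightarrow> sym fps"
  by unfold_locales (simp_all flip: fps_const_mult fps_const_add)

lemma homog_schur_seq: "homog (sum_list a) (schur_seq a)"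
proof -
  let ?l = "length a"
  have "homog (sum_list a) (signof p * (\<Prod>i = 0..<?l. jt_matrix a $$ (i, p i)))"
    if p: "p permutes {0..<?l}" for p
  proof -
    have "homog (\<Sum>i = 0..<?l. a ! i + int (p i) - int i) (\<Prod>i = 0..<?l. jt_matrix a $$ (i, p i))"
      using p by (intro homog_prod) (auto simp: jt_matrix_def homog_complete_h permutes_in_image)
    also have "(\<Sum>i = 0..<?l. a ! i + int (p i) - int i) = sum_list a"
      using sum.permute[OF p, of int]
      by (simp add: sum.distrib sum_subtractf sum_list_sum_nth comp_def)
    finally show ?thesis by (simp add: sign_def homog_uminus)
  qed
  then show ?thesis
    unfolding schur_seq_det det_def'[OF jt_matrix_carrier] by (intro homog_sum) auto
qed

text \<open>
  With \<open>G\<^sub>m = \<Sum> h\<^bsub>m-n\<^esub> t\<^sup>n\<close>, the relation \<open>G\<^bsub>m+1\<^esub> = h\<^bsub>m+1\<^esub> + t G\<^sub>m\<close> expresses every column of the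
  matrix \<open>(G\<^bsub>a\<^sub>i+j-i\<^esub>)\<close> through its first column and columns of constants. This is an entry of the
  corresponding factorisation of that matrix.
\<close>

lemma fps_column_recurrence:
  "(\<Sum>c\<le>j. (if c = 0 then h_skew (complete_h b) else fps_const (complete_h (b + int c))) * fps_X ^ (j - c))
    = h_skew (complete_h (b + int j))"
proof (induction j)
  case (Suc j)
  have "h_skew (complete_h (b + int (Suc j))) =
      fps_const (complete_h (b + int (Suc j))) + fps_X * h_skew (complete_h (b + int j))"
  proof (rule fps_ext)
    fix n
    show "fps_nth (h_skew (complete_h (b + int (Suc j)))) n = fps_nth (fps_const
        (complete_h (b + int (Suc j))) + fps_X * h_skew (complete_h (b + int j))) n"
      by (cases n) (simp_all only: fps_add_nth h_skew_nth skew_complete_h_complete_h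
          fps_X_mult_nth fps_nth_fps_const, simp_all add: algebra_simps)
  qed
  also have "fps_X * h_skew (complete_h (b + int j)) =
      (\<Sum>c\<le>j. (if c = 0 then h_skew (complete_h b) else fps_const (complete_h (b + int c))) * fps_X ^ (Suc j - c))"
    unfolding Suc[symmetric] by (auto simp: sum_distrib_left Suc_diff_le intro!: sum.cong)
  finally show ?case by simp
qed simp

text \<open>
  The series \<open>\<Sum> h\<^sub>n\<^sup>\<bottom> t\<^sup>n\<close> replaces the entries of the determinant by \<open>G\<^bsub>a\<^sub>i+j-i\<^esub>\<close>. Unitriangular
  column operations leave \<open>t\<close> in the first column only, and the claim is the coefficient of
  \<open>t\<^sup>k\<close> in the expansion along that column.
\<close>

lemma skew_complete_h_schur_seq:
  assumes "a \<noteq> []"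
  shows "skew (complete_h (int k)) (schur_seq a) =
    (\<Sum>i<length a. complete_h (a ! i - int i - int k) * cofactor (jt_matrix a) i 0)"
proof -
  let ?l = "length a"
  let ?M = "mat ?l ?l (\<lambda>(i, j). if j = 0 then h_skew (complete_h (a ! i - int i))
      else fps_const (complete_h (a ! i + int j - int i)))"
  let ?T = "mat ?l ?l (\<lambda>(c, j). if c \<le> j then fps_X ^ (j - c) else (0 :: sym fps))"
  have M: "?M \<in> carrier_mat ?l ?l" and T: "?T \<in> carrier_mat ?l ?l" by auto
  have "map_mat h_skew (jt_matrix a) = ?M * ?T"
  proof (rule eq_matI)
    fix i j assume ij: "i < dim_row (?M * ?T)" "j < dim_col (?M * ?T)"
    let ?b = "a ! i - int i"
    have "(?M * ?T) $$ (i, j) = (\<Sum>c\<in>{0..<?l}. (if c = 0 then h_skew (complete_h ?b)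
        else fps_const (complete_h (?b + int c))) * (if c \<le> j then fps_X ^ (j - c) else 0))"
      using ij by (auto simp: scalar_prod_def algebra_simps intro!: sum.cong)
    also have "\<dots> = (\<Sum>c\<le>j. (if c = 0 then h_skew (complete_h ?b)
        else fps_const (complete_h (?b + int c))) * fps_X ^ (j - c))"
      using ij by (intro sum.mono_neutral_cong_right) auto
    also have "\<dots> = map_mat h_skew (jt_matrix a) $$ (i, j)"
      using ij unfolding fps_column_recurrence by (simp add: jt_matrix_def algebra_simps)
    finally show "map_mat h_skew (jt_matrix a) $$ (i, j) = (?M * ?T) $$ (i, j)" by simp
  qed (auto simp: jt_matrix_def)
  then have "h_skew (schur_seq a) = det ?M * det ?T"
    unfolding schur_seq_det by (simp add: det_mult[OF M T, symmetric] flip: h_skew.hom_det)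
  moreover have "det ?T = 1"
  proof -
    have "diag_mat ?T = replicate ?l 1"
      by (rule nth_equalityI) (auto simp: diag_mat_def)
    moreover have "upper_triangular ?T" by auto
    ultimately show ?thesis using det_upper_triangular[OF _ T] by simp
  qed
  moreover have "det ?M = (\<Sum>i<?l. h_skew (complete_h (a ! i - int i)) * fps_const (cofactor (jt_matrix a) i 0))"
  proof -
    have "mat_delete ?M i 0 = map_mat fps_const (mat_delete (jt_matrix a) i 0)" if "i < ?l" for i
      using that by (intro eq_matI) (auto simp: mat_delete_def jt_matrix_def algebra_simps)
    then have "cofactor ?M i 0 = fps_const (cofactor (jt_matrix a) i 0)" if "i < ?l" for i
      using that by (simp add: cofactor_def fps_const.hom_mult fps_const.hom_power fps_const.hom_uminus)
    then show ?thesis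
      using assms by (subst laplace_expansion_column[OF M, of 0]) (auto intro!: sum.cong)
  qed
  ultimately have "h_skew (schur_seq a) =
      (\<Sum>i<?l. h_skew (complete_h (a ! i - int i)) * fps_const (cofactor (jt_matrix a) i 0))"
    by simp
  from arg_cong[OF this, of "\<lambda>F. fps_nth F k"] show ?thesis
    by (simp add: fps_sum_nth skew_complete_h_complete_h)
qed

lemma cofactor_jt_matrix_0: "cofactor (jt_matrix (m # a)) 0 0 = schur_seq a"
proof -
  have "mat_delete (jt_matrix (m # a)) 0 0 = jt_matrix a"
    by (rule eq_matI) (auto simp: mat_delete_def jt_matrix_def algebra_simps)
  then show ?thesis by (simp add: cofactor_def schur_seq_det)
qed

text \<open>
  The entries \<open>a\<^sub>i - i\<close> of the first column are largest at the top, strictly, so for \<open>k\<close> beyond the first part every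
  term of the expansion vanishes, and for \<open>k\<close> equal to it only the one with \<open>h\<^sub>0 = 1\<close> in the corner
  remains.
\<close>

lemma skew_complete_h_schur_seq_top:
  assumes "\<forall>x\<in>set a. x \<le> m"
  shows "int k > m \<Longrightarrow> skew (complete_h (int k)) (schur_seq (m # a)) = 0"
    and "int k = m \<Longrightarrow> skew (complete_h (int k)) (schur_seq (m # a)) = schur_seq a"
proof -
  have le: "(m # a) ! i \<le> m" if "i < length (m # a)" for i
    using assms nth_mem[OF that] by auto
  have neg: "complete_h ((m # a) ! i - int i - int k) = 0"
    if "int k > m \<or> int k = m \<and> i > 0" "i < length (m # a)" for i
    using le[OF that(2)] that(1) by (intro complete_h_neg) auto
  show "int k > m \<Longrightarrow> skew (complete_h (int k)) (schur_seq (m # a)) = 0"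
    by (subst skew_complete_h_schur_seq, simp, rule sum.neutral) (use neg in auto)
  assume k: "int k = m"
  have "skew (complete_h (int k)) (schur_seq (m # a)) =
      (\<Sum>i\<in>{0}. complete_h ((m # a) ! i - int i - int k) * cofactor (jt_matrix (m # a)) i 0)"
    using k neg by (subst skew_complete_h_schur_seq, simp, intro sum.mono_neutral_right) auto
  also have "\<dots> = schur_seq a" using k by (simp add: cofactor_jt_matrix_0)
  finally show "skew (complete_h (int k)) (schur_seq (m # a)) = schur_seq a" .
qed

text \<open>
  The series maps \<open>h\<^sub>m\<close> to \<open>h\<^sub>m - t h\<^bsub>m-1\<^esub>\<close>. Border the matrix of \<open>s\<^bsub>(m,a)\<^esub>\<close> by replacing its first row
  with \<open>1, t, t\<^sup>2, \<dots>\<close>; subtracting \<open>t\<close> times each column from the next one turns this row into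
  \<open>1, 0, 0, \<dots>\<close> and produces exactly those differences in the remaining entries. Computing the bordered determinant
  along its first row before and after the column operations gives the two sides.
\<close>

lemma e_skew_schur_seq:
  "e_skew (schur_seq a) =
     (\<Sum>j<Suc (length a). fps_X ^ j * fps_const (cofactor (jt_matrix (m # a)) 0 j))"
proof -
  let ?l = "Suc (length a)"
  let ?N = "mat ?l ?l (\<lambda>(i, j). if i = 0 then fps_X ^ j
      else fps_const (complete_h (a ! (i - 1) + int j - int i)))"
  let ?T = "mat ?l ?l (\<lambda>(c, j). if c = j then 1 else if Suc c = j then - fps_X else (0 :: sym fps))"
  have N: "?N \<in> carrier_mat ?l ?l" and T: "?T \<in> carrier_mat ?l ?l"
    and NT: "?N * ?T \<in> carrier_mat ?l ?l" by auto
  have "det ?T = 1"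
  proof -
    have "diag_mat ?T = replicate ?l 1"
      by (rule nth_equalityI) (auto simp: diag_mat_def simp del: upt_Suc replicate_Suc)
    moreover have "upper_triangular ?T" by auto
    ultimately show ?thesis using det_upper_triangular[OF _ T] by simp
  qed
  then have det_NT: "det (?N * ?T) = det ?N" by (simp add: det_mult[OF N T])
  have entry: "(?N * ?T) $$ (i, j) =
      (if j = 0 then ?N $$ (i, 0) else ?N $$ (i, j) - fps_X * ?N $$ (i, j - 1))"
    if "i < ?l" "j < ?l" for i j
  proof -
    have "(?N * ?T) $$ (i, j) = (\<Sum>c\<in>{0..<?l}. ?N $$ (i, c) * ?T $$ (c, j))"
      using that by (auto simp: scalar_prod_def intro!: sum.cong)
    also have "\<dots> = (\<Sum>c\<in>(if j = 0 then {0} else {j - 1, j}). ?N $$ (i, c) * ?T $$ (c, j))"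
      using that by (intro sum.mono_neutral_right) (auto split: if_splits)
    also have "\<dots> = (if j = 0 then ?N $$ (i, 0) else ?N $$ (i, j) - fps_X * ?N $$ (i, j - 1))"
      using that by (cases j) (auto simp: algebra_simps)
    finally show ?thesis .
  qed
  have "mat_delete (?N * ?T) 0 0 = map_mat e_skew (jt_matrix a)"
  proof (rule eq_matI)
    fix i j assume "i < dim_row (map_mat e_skew (jt_matrix a))" "j < dim_col (map_mat e_skew (jt_matrix a))"
    then show "mat_delete (?N * ?T) 0 0 $$ (i, j) = map_mat e_skew (jt_matrix a) $$ (i, j)"
      using entry[of "Suc i" "Suc j"]
      by (simp add: mat_delete_def jt_matrix_def e_skew_complete_h algebra_simps)
  qed (auto simp: mat_delete_def jt_matrix_def)
  then have "cofactor (?N * ?T) 0 0 = e_skew (schur_seq a)"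
    by (simp add: cofactor_def schur_seq_det)
  moreover have "det (?N * ?T) = (\<Sum>j<?l. (?N * ?T) $$ (0, j) * cofactor (?N * ?T) 0 j)"
    by (rule laplace_expansion_row[OF NT]) simp
  moreover have "(\<Sum>j<?l. (?N * ?T) $$ (0, j) * cofactor (?N * ?T) 0 j) =
      (\<Sum>j\<in>{0}. (?N * ?T) $$ (0, j) * cofactor (?N * ?T) 0 j)"
  proof (rule sum.mono_neutral_right)
    show "\<forall>j\<in>{..<?l} - {0}. (?N * ?T) $$ (0, j) * cofactor (?N * ?T) 0 j = 0"
    proof
      fix j assume "j \<in> {..<?l} - {0}"
      then have "(?N * ?T) $$ (0, j) = 0" using entry[of 0 j] by (cases j) auto
      then show "(?N * ?T) $$ (0, j) * cofactor (?N * ?T) 0 j = 0" by simp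
    qed
  qed auto
  moreover have "(?N * ?T) $$ (0, 0) = 1" using entry[of 0 0] by simp
  ultimately have "e_skew (schur_seq a) = det (?N * ?T)" by simp
  also have "\<dots> = (\<Sum>j<?l. ?N $$ (0, j) * cofactor ?N 0 j)"
    unfolding det_NT by (rule laplace_expansion_row[OF N]) simp
  also have "\<dots> = (\<Sum>j<?l. fps_X ^ j * fps_const (cofactor (jt_matrix (m # a)) 0 j))"
  proof (rule sum.cong)
    fix j assume j: "j \<in> {..<?l}"
    have "mat_delete ?N 0 j = map_mat fps_const (mat_delete (jt_matrix (m # a)) 0 j)"
      using j by (intro eq_matI) (auto simp: mat_delete_def jt_matrix_def)
    then show "?N $$ (0, j) * cofactor ?N 0 j = fps_X ^ j * fps_const (cofactor (jt_matrix (m # a)) 0 j)"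
      using j by (simp add: cofactor_def fps_const.hom_mult fps_const.hom_power fps_const.hom_uminus)
  qed simp
  finally show ?thesis .
qed

lemma skew_signed_e_schur_seq:
  "skew (signed_e (int k)) (schur_seq a) = (if k \<le> length a then cofactor (jt_matrix (m # a)) 0 k else 0)"
proof -
  have "skew (signed_e (int k)) (schur_seq a) = fps_nth (e_skew (schur_seq a)) k" by simp
  also have "\<dots> = (\<Sum>j<Suc (length a). if j = k then cofactor (jt_matrix (m # a)) 0 k else 0)"
    unfolding e_skew_schur_seq[of a m] fps_sum_nth
    by (rule sum.cong) (auto simp: fps_X_power_mult_nth)
  also have "\<dots> = (if k \<le> length a then cofactor (jt_matrix (m # a)) 0 k else 0)"
    by (subst sum.delta) auto
  finally show ?thesis .
qed

text \<open>
  Bernstein's formula: the cofactors of the first row are \<open>((-1)\<^sup>j e\<^sub>j)\<^sup>\<bottom> s\<^sub>a\<close>.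
\<close>

lemma schur_seq_Cons:
  "schur_seq (m # a) = (\<Sum>j\<le>length a. complete_h (m + int j) * skew (signed_e (int j)) (schur_seq a))"
proof -
  have "schur_seq (m # a) = (\<Sum>j<Suc (length a). jt_matrix (m # a) $$ (0, j) * cofactor (jt_matrix (m # a)) 0 j)"
    unfolding schur_seq_det by (rule laplace_expansion_row) (simp_all add: jt_matrix_def)
  also have "\<dots> = (\<Sum>j\<le>length a. complete_h (m + int j) * skew (signed_e (int j)) (schur_seq a))"
    by (rule sum.cong) (auto simp: skew_signed_e_schur_seq[of _ a m] jt_matrix_def)
  finally show ?thesis .
qed

text \<open>
  Moving the factors of Bernstein's formula to the other side leaves only the term \<open>j = 0\<close>.
\<close>

lemma form_schur_seq_Cons:
  assumes "\<And>k. k > m \<Longrightarrow> skew (complete_h (int k)) f = 0"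
  shows "form (schur_seq (int m # a)) f = form (schur_seq a) (skew (complete_h (int m)) f)"
proof -
  have "form (schur_seq (int m # a)) f =
      (\<Sum>j\<le>length a. form (skew (signed_e (int j)) (schur_seq a)) (skew (complete_h (int (m + j))) f))"
    by (simp add: schur_seq_Cons form_sum_left skew_adjoint)
  also have "\<dots> = (\<Sum>j\<in>{0}. form (skew (signed_e (int j)) (schur_seq a)) (skew (complete_h (int (m + j))) f))"
    using assms[of "m + _"] by (intro sum.mono_neutral_right) auto
  finally show ?thesis by simp
qed

section \<open>Orthonormality of the Schur functions\<close>

lemma form_1_1 [simp]: "form 1 1 = 1"
  using form_pp_pp[of "{#}" "{#}"] by simp

text \<open>
  Strip the first row from the sequence with the larger first part: by the preceding lemmas the other one
  either loses its first row too, when the first parts agree, or is annihilated.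
\<close>

lemma form_schur_seq:
  assumes "sorted_wrt (\<ge>) xs" "sorted_wrt (\<ge>) ys" "0 \<notin> set xs" "0 \<notin> set ys"
  shows "form (schur_seq (map int xs)) (schur_seq (map int ys)) = (if xs = ys then 1 else 0)"
  using assms
proof (induction xs arbitrary: ys)
  case Nil
  show ?case
  proof (cases ys)
    case (Cons y ys')
    then have "y > 0" using Nil by auto
    then have "form (schur_seq (map int ys)) 1 = 0"
      unfolding Cons list.map by (subst form_schur_seq_Cons) (auto simp: skew_complete_h_1)
    then show ?thesis using Cons by (simp add: form_commute)
  qed simp
next
  case (Cons x xs)
  show ?case
  proof (cases ys)
    case Nil
    have "x > 0" using Cons.prems by auto
    then have "form (schur_seq (map int (x # xs))) 1 = 0"
      unfolding list.map by (subst form_schur_seq_Cons) (auto simp: skew_complete_h_1)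
    then show ?thesis using Nil by simp
  next
    case ys: (Cons y ys')
    have tx: "skew (complete_h (int k)) (schur_seq (map int (x # xs))) =
        (if k = x then schur_seq (map int xs) else 0)" if "k \<ge> x" for k
      using that skew_complete_h_schur_seq_top[of "map int xs" "int x" k] Cons.prems by auto
    have ty: "skew (complete_h (int k)) (schur_seq (map int ys)) =
        (if k = y then schur_seq (map int ys') else 0)" if "k \<ge> y" for k
      using that skew_complete_h_schur_seq_top[of "map int ys'" "int y" k] Cons.prems ys by auto
    show ?thesis
    proof (cases "x \<ge> y")
      case True
      have "form (schur_seq (map int (x # xs))) (schur_seq (map int ys)) =
          form (schur_seq (map int xs)) (if x = y then schur_seq (map int ys') else 0)"
        using True by (subst list.map, subst form_schur_seq_Cons) (simp_all add: ty)
      also have "\<dots> = (if x # xs = ys then 1 else 0)"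
        using Cons.IH[of ys'] Cons.prems ys by auto
      finally show ?thesis .
    next
      case False
      have "form (schur_seq (map int ys)) (schur_seq (map int (x # xs))) =
          form (schur_seq (map int ys')) (skew (complete_h (int y)) (schur_seq (map int (x # xs))))"
        using False tx unfolding ys by (subst list.map, subst form_schur_seq_Cons) simp_all
      also have "\<dots> = 0" using False tx[of y] by simp
      finally show ?thesis using False ys by (simp add: form_commute)
    qed
  qed
qed

lemma form_schur: "form (schur lam) (schur mu) = (if lam = mu then 1 else 0)"
  using form_schur_seq[of "parts lam" "parts mu"]
  by (simp add: schur_def parts_sorted parts_pos parts_inject)

lemma homog_schur: "homog (int (psize lam)) (schur lam)"
proof -
  have "sum_list (map int xs) = int (sum_list xs)" for xs by (induction xs) auto
  then show ?thesis
    using homog_schur_seq[of "map int (parts lam)"] by (simp add: schur_def psize_def)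
qed

section \<open>The antipode of a Schur function\<close>

lemma fps_prod_top:
  fixes u v :: "'a \<Rightarrow> sym"
  assumes "finite I"
  shows "card I < k \<Longrightarrow> fps_nth (\<Prod>i\<in>I. fps_const (u i) - fps_X * fps_const (v i)) k = 0"
    and "fps_nth (\<Prod>i\<in>I. fps_const (u i) - fps_X * fps_const (v i)) (card I) = (-1) ^ card I * (\<Prod>i\<in>I. v i)"
  using assms
proof (induction I arbitrary: k rule: finite_induct)
  case (insert i I)
  have *: "fps_nth ((fps_const (u i) - fps_X * fps_const (v i)) * F) (Suc k) =
      u i * fps_nth F (Suc k) - v i * fps_nth F k" for F k
    by (simp add: left_diff_distrib mult.assoc)
  {
    case 1
    then show ?case using insert by (cases k) (auto simp: * simp del: fps_mult_nth)
  next
    case 2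
    then show ?case using insert by (simp add: * algebra_simps)
  }
qed simp_all

lemma h_skew_antipode_complete_h:
  "h_skew (antipode (complete_h n)) =
     fps_const (antipode (complete_h n)) - fps_X * fps_const (antipode (complete_h (n - 1)))"
  using h_skew_signed_e[of n] by (simp add: signed_e_def)

interpretation antipode: comm_ring_hom antipode
  by unfold_locales (simp_all add: antipode_mult antipode_linear_simps)

text \<open>
  The antipode of \<open>s\<^sub>a\<close> is a determinant in the functions \<open>(-1)\<^sup>n e\<^sub>n\<close>, whose entries the series
  \<open>\<Sum> h\<^sub>n\<^sup>\<bottom> t\<^sup>n\<close> makes linear in \<open>t\<close>. The degree is therefore at most the number of rows,
  and the leading coefficient takes the \<open>t\<close>-part of every entry. On column lengths,
  subtracting \<open>1\<close> everywhere deletes the first row of the diagram.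
\<close>

lemma skew_complete_h_antipode_schur_seq:
  shows "k > length a \<Longrightarrow> skew (complete_h (int k)) (antipode (schur_seq a)) = 0"
    and "skew (complete_h (int (length a))) (antipode (schur_seq a)) =
      (-1) ^ length a * antipode (schur_seq (map (\<lambda>x. x - 1) a))"
proof -
  let ?l = "length a"
  let ?u = "\<lambda>p i. antipode (complete_h (a ! i + int (p i) - int i))"
  let ?v = "\<lambda>p i. antipode (complete_h (a ! i - 1 + int (p i) - int i))"
  have less: "p i < ?l" if "p permutes {0..<?l}" "i < ?l" for p i
    using that permutes_in_image[of p "{0..<?l}" i] by simp
  have "h_skew (antipode (schur_seq a)) = (\<Sum>p | p permutes {0..<?l}. signof p *
      (\<Prod>i\<in>{0..<?l}. fps_const (?u p i) - fps_X * fps_const (?v p i)))"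
    unfolding schur_seq_det det_def'[OF jt_matrix_carrier]
    by (simp add: h_skew.hom_sum antipode.hom_sum h_skew.hom_mult antipode_mult h_skew.hom_prod
          antipode.hom_prod)
       (auto intro!: sum.cong prod.cong arg_cong2[where f = "(*)"]
          simp: jt_matrix_def h_skew_antipode_complete_h less algebra_simps)
  from arg_cong[OF this, of "\<lambda>F. fps_nth F k" for k]
  have nth: "skew (complete_h (int k)) (antipode (schur_seq a)) = (\<Sum>p | p permutes {0..<?l}. signof p *
      fps_nth (\<Prod>i\<in>{0..<?l}. fps_const (?u p i) - fps_X * fps_const (?v p i)) k)" for k
    by (auto simp: fps_sum_nth sign_def intro!: sum.cong)
  show "skew (complete_h (int k)) (antipode (schur_seq a)) = 0" if "k > ?l"
    unfolding nth using that by (intro sum.neutral) (simp add: fps_prod_top)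
  have "skew (complete_h (int ?l)) (antipode (schur_seq a)) = (\<Sum>p | p permutes {0..<?l}. signof p *
      ((-1) ^ ?l * (\<Prod>i\<in>{0..<?l}. ?v p i)))"
    unfolding nth using fps_prod_top(2)[of "{0..<?l}"] by simp
  also have "\<dots> = (-1) ^ ?l * antipode (schur_seq (map (\<lambda>x. x - 1) a))"
    unfolding schur_seq_det det_def'[OF jt_matrix_carrier] length_map
    by (simp add: antipode.hom_sum antipode_mult antipode.hom_prod sum_distrib_left mult.left_commute)
       (auto intro!: sum.cong prod.cong arg_cong2[where f = "(*)"] simp: jt_matrix_def less)
  finally show "skew (complete_h (int ?l)) (antipode (schur_seq a)) =
      (-1) ^ ?l * antipode (schur_seq (map (\<lambda>x. x - 1) a))" .
qed

text \<open>
  The last row of the matrix is \<open>0, \<dots>, 0, 1\<close>.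
\<close>

lemma schur_seq_append_0: "schur_seq (a @ [0]) = schur_seq a"
proof -
  let ?l = "length a"
  let ?J = "jt_matrix (a @ [0])"
  have J: "?J \<in> carrier_mat (Suc ?l) (Suc ?l)" using jt_matrix_carrier[of "a @ [0]"] by simp
  have "schur_seq (a @ [0]) = (\<Sum>j<Suc ?l. ?J $$ (?l, j) * cofactor ?J ?l j)"
    unfolding schur_seq_det by (rule laplace_expansion_row[OF J]) simp
  also have "\<dots> = (\<Sum>j\<in>{?l}. ?J $$ (?l, j) * cofactor ?J ?l j)"
    by (intro sum.mono_neutral_right) (auto simp: jt_matrix_def)
  also have "mat_delete ?J ?l ?l = jt_matrix a"
    by (rule eq_matI) (auto simp: mat_delete_def jt_matrix_def nth_append)
  then have "(\<Sum>j\<in>{?l}. ?J $$ (?l, j) * cofactor ?J ?l j) = schur_seq a"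
    by (simp add: cofactor_def schur_seq_det jt_matrix_def)
  finally show ?thesis .
qed

lemma schur_seq_append_zeros: "schur_seq (a @ replicate n 0) = schur_seq a"
proof (induction n)
  case (Suc n)
  then show ?case
    using schur_seq_append_0[of "a @ replicate n 0"] by (simp add: replicate_append_same)
qed simp

text \<open>
  The conjugate partition, padded with zeros to length \<open>n\<close>. Padding lets the first row of the diagram be
  deleted without changing the number of columns.
\<close>

definition column_lengths :: "nat \<Rightarrow> nat list \<Rightarrow> int list" where
  "column_lengths n xs = map (\<lambda>j. int (length (filter (\<lambda>x. j < x) xs))) [0..<n]"

lemma schur_seq_column_lengths:
  assumes "\<forall>x\<in>set xs. x \<le> m" "m \<le> n"
  shows "schur_seq (column_lengths n xs) = schur_seq (column_lengths m xs)"
proof -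
  have "column_lengths n xs = column_lengths m xs @ replicate (n - m) 0"
  proof (rule nth_equalityI)
    fix j assume j: "j < length (column_lengths n xs)"
    have "filter (\<lambda>x. j < x) xs = []" if "j \<ge> m"
      using assms(1) that by (auto simp: filter_empty_conv not_less)
    then show "column_lengths n xs ! j = (column_lengths m xs @ replicate (n - m) 0) ! j"
      using j assms(2) by (auto simp: column_lengths_def nth_append)
  qed (use assms in \<open>simp add: column_lengths_def\<close>)
  then show ?thesis by (simp add: schur_seq_append_zeros)
qed

text \<open>
  Strip the first row, of length \<open>x\<close>, on both sides: on the left by Bernstein's formula, on the right
  because \<open>x\<close> is the number of columns. Each step contributes the sign \<open>(-1)\<^sup>x\<close>.
\<close>

lemma form_schur_seq_conjugate:
  assumes "sorted_wrt (\<ge>) xs" "\<forall>x\<in>set xs. x \<le> n"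
  shows "form (schur_seq (map int xs)) (antipode (schur_seq (column_lengths n xs))) = (-1) ^ sum_list xs"
  using assms
proof (induction xs arbitrary: n)
  case Nil
  then have "schur_seq (column_lengths n []) = schur_seq (column_lengths 0 [])"
    by (intro schur_seq_column_lengths) auto
  then show ?case by (simp add: column_lengths_def)
next
  case (Cons x xs)
  let ?c = "column_lengths x (x # xs)"
  have len: "length ?c = x" by (simp add: column_lengths_def)
  have "schur_seq (column_lengths n (x # xs)) = schur_seq ?c"
    using Cons.prems by (intro schur_seq_column_lengths) auto
  then have "form (schur_seq (map int (x # xs))) (antipode (schur_seq (column_lengths n (x # xs)))) =
      form (schur_seq (map int xs)) (skew (complete_h (int x)) (antipode (schur_seq ?c)))"
    using skew_complete_h_antipode_schur_seq(1)[of ?c] len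
    by (simp add: form_schur_seq_Cons)
  also have "skew (complete_h (int x)) (antipode (schur_seq ?c)) =
      (-1) ^ x * antipode (schur_seq (map (\<lambda>x. x - 1) ?c))"
    using skew_complete_h_antipode_schur_seq(2)[of ?c] len by simp
  also have "map (\<lambda>x. x - 1) ?c = column_lengths x xs"
    by (auto simp: column_lengths_def)
  also have "form (schur_seq (map int xs)) ((-1) ^ x * antipode (schur_seq (column_lengths x xs))) =
      (-1) ^ x * form (schur_seq (map int xs)) (antipode (schur_seq (column_lengths x xs)))"
    by (cases "even x") (simp_all add: form_minus)
  also have "\<dots> = (-1) ^ sum_list (x # xs)"
    using Cons.prems by (subst Cons.IH) (auto simp: power_add)
  finally show ?case .
qed

lemma parts_conj_partition:
  "parts (conj_partition lam) = map (\<lambda>j. length (filter (\<lambda>x. j < x) (parts lam)))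
     [0..<(if parts lam = [] then 0 else hd (parts lam))]"
  by (simp add: conj_partition.rep_eq)

text \<open>
  Both sides are vectors of norm \<open>1\<close> whose inner product is \<open>1\<close>, so their difference has norm \<open>0\<close>.
\<close>

lemma antipode_schur_conj: "antipode (schur (conj_partition lam)) = (-1) ^ psize lam *\<^sub>Q schur lam"
proof -
  let ?t = "antipode (schur (conj_partition lam))"
  let ?n = "if parts lam = [] then 0 else hd (parts lam)"
  have "schur (conj_partition lam) = schur_seq (column_lengths ?n (parts lam))"
    by (simp add: schur_def parts_conj_partition column_lengths_def comp_def)
  moreover have "\<forall>x\<in>set (parts lam). x \<le> ?n"
    using parts_sorted[of lam] by (cases "parts lam") auto
  ultimately have st: "form (schur lam) ?t = (-1) ^ psize lam"
    using form_schur_seq_conjugate[OF parts_sorted, of lam ?n] by (simp add: schur_def psize_def)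
  have tt: "form ?t ?t = 1" by (simp add: form_antipode form_schur)
  let ?e = "(-1) ^ psize lam :: rat"
  have "form (?t - ?e *\<^sub>Q schur lam) (?t - ?e *\<^sub>Q schur lam) = 0"
    using st by (simp add: form_diff form_scale_left form_scale_right form_schur tt form_commute[of ?t "schur lam"]
      flip: power_mult_distrib)
  then show ?thesis using form_self_eq_0 by fastforce
qed

lemma antipode_schur: "antipode (schur lam) = (-1) ^ psize lam *\<^sub>Q schur (conj_partition lam)"
proof -
  have "schur (conj_partition lam) = (-1) ^ psize lam *\<^sub>Q antipode (schur lam)"
    using arg_cong[OF antipode_schur_conj[of lam], of antipode] by (simp add: antipode_linear_simps)
  then show ?thesis by (simp flip: power_mult_distrib)
qed


section \<open>The Schur basis\<close>

lemma schur_lin_indep: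
  assumes "finite T" "(\<Sum>lam\<in>T. c lam *\<^sub>Q schur lam) = 0" "mu \<in> T"
  shows "c mu = 0"
proof -
  have "0 = form (\<Sum>lam\<in>T. c lam *\<^sub>Q schur lam) (schur mu)" using assms by simp
  also have "\<dots> = (\<Sum>lam\<in>T. if lam = mu then c mu else 0)"
    unfolding form_sum_left by (intro sum.cong) (auto simp: form_scale_left form_schur)
  finally show ?thesis using assms by simp
qed

lemma schur_inj: "inj schur" and schur_independent: "sym.independent (range schur)"
  using independent_familyI[of schur] schur_lin_indep by blast+

lemma pcoord_schur_support:
  assumes "psize lam \<le> N"
  shows "{A. pcoord (schur lam) A \<noteq> 0} \<subseteq> positive_multisets N"
proof
  fix A assume "A \<in> {A. pcoord (schur lam) A \<noteq> 0}"
  then have A: "pcoord (schur lam) A \<noteq> 0" by simp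
  then have "int (\<Sum>\<^sub># A) = int (psize lam)"
    using homog_schur[of lam] unfolding homog_iff_pcoord by blast
  moreover have "0 \<notin># A" using A pcoord_zero_part by blast
  ultimately show "A \<in> positive_multisets N"
    using assms unfolding positive_multisets_def by (simp del: of_nat_sum_mset)
qed

text \<open>
  Spanning by counting: up to degree \<open>N\<close> there are as many independent Schur functions as there are
  products of power sums, and the former lie in the span of the latter.
\<close>

lemma pp_in_span_schur:
  assumes "A \<in> positive_multisets N"
  shows "pp A \<in> sym.span (schur ` {lam. psize lam \<le> N})"
proof (rule ccontr)
  let ?S = "schur ` {lam. psize lam \<le> N}" and ?P = "pp ` positive_multisets N"
  assume notin: "pp A \<notin> sym.span ?S"
  have indep: "sym.independent ?S"
    by (rule sym.independent_mono[OF schur_independent]) auto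
  have "schur lam \<in> sym.span ?P" if "psize lam \<le> N" for lam
  proof -
    have "(\<Sum>A\<in>positive_multisets N. pcoord (schur lam) A *\<^sub>Q pp A) = schur lam"
      using that by (intro sum_pcoord pcoord_schur_support) auto
    then show ?thesis by (metis (no_types, lifting) image_eqI sym.span_base sym.span_scale sym.span_sum)
  qed
  then have "insert (pp A) ?S \<subseteq> sym.span ?P" using assms by (auto intro: sym.span_base)
  moreover have "sym.independent (insert (pp A) ?S)"
    using indep notin by (simp add: sym.independent_insert sym.span_base)
  ultimately have "card (insert (pp A) ?S) \<le> card ?P"
    using sym.independent_span_bound[of ?P "insert (pp A) ?S"] by auto
  also have "\<dots> \<le> card (positive_multisets N)" by (rule card_image_le) simp
  also have "\<dots> = card ?S"
    using bij_betw_same_card[OF bij_betw_shape[of N]] schur_inj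
    by (simp add: card_image inj_on_subset)
  also have "\<dots> < card (insert (pp A) ?S)"
    using notin by (subst card_insert_disjoint) (auto intro: sym.span_base)
  finally show False by simp
qed

lemma basis_schur: "basis_family schur"
proof -
  have "f \<in> sym.span (range schur)" for f
  proof (induction f rule: sym_induct_pp)
    case (pp A)
    have "pp A \<in> sym.span (schur ` {lam. psize lam \<le> \<Sum>\<^sub># A})"
      using pp by (intro pp_in_span_schur) (simp add: positive_multisets_def)
    moreover have "\<dots> \<subseteq> sym.span (range schur)" by (intro sym.span_mono) auto
    ultimately show ?case by blast
  qed (auto intro: sym.span_zero sym.span_add sym.span_scale)
  then show ?thesis using schur_inj schur_independent by (auto simp: basis_family_def)
qed

lemma coord_schur: "coord schur f lam = form f (schur lam)"
proof -
  let ?T = "{lam. coord schur f lam \<noteq> 0}"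
  have "form f (schur lam) = form (\<Sum>mu\<in>?T. coord schur f mu *\<^sub>Q schur mu) (schur lam)"
    by (simp add: sum_coord basis_schur finite_coord)
  also have "\<dots> = (\<Sum>mu\<in>?T. if mu = lam then coord schur f lam else 0)"
    unfolding form_sum_left by (intro sum.cong) (auto simp: form_scale_left form_schur)
  also have "\<dots> = coord schur f lam" by (simp add: finite_coord basis_schur)
  finally show ?thesis by simp
qed

lemma schur_expansion:
  assumes "finite T" "\<And>lam. form f (schur lam) \<noteq> 0 \<Longrightarrow> lam \<in> T"
  shows "(\<Sum>lam\<in>T. form f (schur lam) *\<^sub>Q schur lam) = f"
  using sum_coord[OF basis_schur assms(1), of f] assms(2) by (auto simp: coord_schur)

lemma hall_eq_form: "hall f g = form f g"
proof -
  let ?T = "{lam. form f (schur lam) \<noteq> 0}"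
  have T: "finite ?T" using finite_coord[OF basis_schur, of f] by (simp add: coord_schur)
  have "form f g = form (\<Sum>lam\<in>?T. form f (schur lam) *\<^sub>Q schur lam) g"
    using schur_expansion[OF T] by simp
  also have "\<dots> = (\<Sum>lam\<in>?T. form f (schur lam) * form g (schur lam))"
    by (simp add: form_sum_left form_scale_left form_commute[of g])
  also have "\<dots> = hall f g"
    unfolding hall_def coord_schur
    by (rule Sum_any.expand_superset[symmetric]) (use T in auto)
  finally show ?thesis by simp
qed

lemma D_op_eq_skew: "D_op f = skew f"
  unfolding D_op_def hall_eq_form U_op_def
proof (rule the_equality)
  fix D assume "\<forall>g h. form (f * g) h = form g (D h)"
  then show "D = skew f" by (intro ext skew_unique[symmetric]) simp
qed (simp add: skew_adjoint)

lemma skew_schur_eq: "skew_schur al lam = skew (schur lam) (schur al)"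
proof -
  have lr: "lr_coeff al lam mu = form (skew (schur lam) (schur al)) (schur mu)" for mu
    unfolding lr_coeff_def coord_schur skew_adjoint by (rule form_commute)
  have "finite {mu. lr_coeff al lam mu \<noteq> 0}"
    using finite_coord[OF basis_schur, of "skew (schur lam) (schur al)"] by (simp add: lr coord_schur)
  then have "skew_schur al lam = (\<Sum>mu | lr_coeff al lam mu \<noteq> 0. lr_coeff al lam mu *\<^sub>Q schur mu)"
    unfolding skew_schur_def by (intro Sum_any.expand_superset) auto
  also have "\<dots> = skew (schur lam) (schur al)"
    using \<open>finite _\<close> unfolding lr by (intro schur_expansion) auto
  finally show ?thesis .
qed

text \<open>
  The element \<open>\<Sum> b \<otimes> b\<^sup>*\<close>, over a basis and its dual, is independent of the basis; degree by degree the
  Schur functions are self-dual and \<open>p\<^sub>A\<close> is dual to \<open>p\<^sub>A / z\<^sub>A\<close>.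
\<close>

lemma sum_schur_eq_sum_pp:
  assumes lin1: "\<And>y. is_linear (\<lambda>x. \<Psi> x y)" and lin2: "\<And>x. is_linear (\<Psi> x)"
  shows "(\<Sum>lam | psize lam \<le> N. \<Psi> (schur lam) (schur lam)) =
    (\<Sum>A\<in>positive_multisets N. (1 / zee_mset A) *\<^sub>Q \<Psi> (pp A) (pp A))"
proof -
  let ?L = "{lam. psize lam \<le> N}" and ?P = "positive_multisets N"
  let ?k = "\<lambda>A lam. form (pp A) (schur lam)"
  have deg: "\<Sum>\<^sub># A = psize lam" if "?k A lam \<noteq> 0" for A lam
    using form_homog[OF homog_pp[of A] homog_schur[of lam]] that
    by (auto simp del: of_nat_sum_mset)
  have pp: "(\<Sum>lam\<in>?L. ?k A lam *\<^sub>Q schur lam) = pp A" if "A \<in> ?P" for A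
    using that deg by (intro schur_expansion) (auto simp: positive_multisets_def)
  have schur: "(\<Sum>A\<in>?P. (?k A lam / zee_mset A) *\<^sub>Q pp A) = schur lam" if "lam \<in> ?L" for lam
  proof -
    have "(\<Sum>A\<in>?P. (?k A lam / zee_mset A) *\<^sub>Q pp A) = (\<Sum>A\<in>?P. pcoord (schur lam) A *\<^sub>Q pp A)"
      by (intro sum.cong) (auto simp: form_pp positive_multisets_def)
    also have "\<dots> = schur lam"
      using that by (intro sum_pcoord pcoord_schur_support) auto
    finally show ?thesis .
  qed
  have "(\<Sum>A\<in>?P. (1 / zee_mset A) *\<^sub>Q \<Psi> (pp A) (pp A)) =
      (\<Sum>A\<in>?P. (1 / zee_mset A) *\<^sub>Q \<Psi> (pp A) (\<Sum>lam\<in>?L. ?k A lam *\<^sub>Q schur lam))"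
    by (intro sum.cong) (auto simp: pp)
  also have "\<dots> = (\<Sum>A\<in>?P. \<Sum>lam\<in>?L. (?k A lam / zee_mset A) *\<^sub>Q \<Psi> (pp A) (schur lam))"
    by (simp add: linear_sum[OF lin2] linear_scale[OF lin2] sym.scale_sum_right)
  also have "\<dots> = (\<Sum>lam\<in>?L. \<Sum>A\<in>?P. (?k A lam / zee_mset A) *\<^sub>Q \<Psi> (pp A) (schur lam))"
    by (rule sum.swap)
  also have "\<dots> = (\<Sum>lam\<in>?L. \<Psi> (\<Sum>A\<in>?P. (?k A lam / zee_mset A) *\<^sub>Q pp A) (schur lam))"
    by (simp add: linear_sum[OF lin1] linear_scale[OF lin1])
  also have "\<dots> = (\<Sum>lam\<in>?L. \<Psi> (schur lam) (schur lam))"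
    by (intro sum.cong) (auto simp: schur)
  finally show ?thesis by simp
qed

section \<open>The coproduct\<close>

text \<open>
  For \<open>c = 1\<close> this is \<open>\<Phi>\<close> evaluated on the coproduct
  \<open>\<Sum>\<^sub>A p\<^sub>A \<otimes> p\<^sub>A\<^sup>\<bottom> f / z\<^sub>A\<close> of \<open>f\<close>; for \<open>c = -1\<close> the antipode is applied to one of
  the two tensor factors first.
\<close>

definition coproduct_sum :: "rat \<Rightarrow> (sym \<Rightarrow> sym \<Rightarrow> sym) \<Rightarrow> sym \<Rightarrow> sym" where
  "coproduct_sum c \<Phi> f = Sum_any (\<lambda>A. (c ^ size A / zee_mset A) *\<^sub>Q \<Phi> (pp A) (skew (pp A) f))"

definition skew_support :: "sym \<Rightarrow> nat multiset set" where
  "skew_support f = {A. 0 \<notin># A \<and> skew (pp A) f \<noteq> 0}"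

lemma skew_support_homog: "homog (int N) f \<Longrightarrow> skew_support f \<subseteq> positive_multisets N"
  using skew_eq_0_degree[OF homog_pp, of "int N" f]
  by (force simp: skew_support_def positive_multisets_def not_le simp del: of_nat_sum_mset)

lemma finite_skew_support [simp, intro]: "finite (skew_support f)"
proof (induction f rule: sym_induct_pp)
  case zero
  show ?case by (simp add: skew_support_def)
next
  case (add f g)
  have "skew_support (f + g) \<subseteq> skew_support f \<union> skew_support g"
    by (auto simp: skew_support_def skew_linear_simps)
  then show ?case using add finite_subset by blast
next
  case (scale c f)
  have "skew_support (c *\<^sub>Q f) \<subseteq> skew_support f"
    by (auto simp: skew_support_def skew_linear_simps)
  then show ?case using scale finite_subset by blast
next
  case (pp B)
  show ?case using skew_support_homog[OF homog_pp] finite_subset by blast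
qed

locale linear_second =
  fixes \<Phi> :: "sym \<Rightarrow> sym \<Rightarrow> sym"
  assumes lin: "\<And>x. is_linear (\<Phi> x)"
begin

lemma coproduct_sum_superset:
  assumes "finite T" "skew_support f \<subseteq> T"
  shows "coproduct_sum c \<Phi> f = (\<Sum>A\<in>T. (c ^ size A / zee_mset A) *\<^sub>Q \<Phi> (pp A) (skew (pp A) f))"
  unfolding coproduct_sum_def
proof (rule Sum_any.expand_superset)
  show "{A. (c ^ size A / zee_mset A) *\<^sub>Q \<Phi> (pp A) (skew (pp A) f) \<noteq> 0} \<subseteq> T"
    using assms(2) by (auto simp: skew_support_def linear_0[OF lin])
qed (use assms in simp)

lemma is_linear_coproduct_sum: "is_linear (coproduct_sum c \<Phi>)"
proof (rule is_linearI)
  fix f g k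
  let ?T = "skew_support f \<union> skew_support g \<union> skew_support (f + g)"
  have *: "coproduct_sum c \<Phi> h = (\<Sum>A\<in>?T. (c ^ size A / zee_mset A) *\<^sub>Q \<Phi> (pp A) (skew (pp A) h))"
    if "h \<in> {f, g, f + g}" for h
    using that by (intro coproduct_sum_superset) auto
  show "coproduct_sum c \<Phi> (f + g) = coproduct_sum c \<Phi> f + coproduct_sum c \<Phi> g"
    by (simp add: * skew_linear_simps linear_add[OF lin] sym.scale_right_distrib sum.distrib)
  let ?S = "skew_support f \<union> skew_support (k *\<^sub>Q f)"
  have *: "coproduct_sum c \<Phi> h = (\<Sum>A\<in>?S. (c ^ size A / zee_mset A) *\<^sub>Q \<Phi> (pp A) (skew (pp A) h))"
    if "h \<in> {f, k *\<^sub>Q f}" for h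
    using that by (intro coproduct_sum_superset) auto
  show "coproduct_sum c \<Phi> (k *\<^sub>Q f) = k *\<^sub>Q coproduct_sum c \<Phi> f"
    by (simp add: * skew_linear_simps linear_scale[OF lin] sym.scale_sum_right mult.commute)
qed

lemma coproduct_sum_1: "coproduct_sum c \<Phi> 1 = \<Phi> 1 1"
proof -
  have "skew_support 1 \<subseteq> positive_multisets 0"
    using skew_support_homog[of 0 1] by simp
  also have "positive_multisets 0 \<subseteq> {{#}}"
  proof
    fix A assume "A \<in> positive_multisets 0"
    then have "size A \<le> 0" using size_le_sum_mset[of A] unfolding positive_multisets_def by force
    then show "A \<in> {{#}}" by simp
  qed
  finally show ?thesis by (subst coproduct_sum_superset[of "{{#}}"]) auto
qed

text \<open>
  The coproduct is multiplicative and \<open>p\<^sub>n\<close> is primitive. In detail, commuting \<open>p\<^sub>A\<^sup>\<bottom>\<close> past \<open>p\<^sub>n\<close>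
  leaves \<open>n m\<^sub>n(A) p\<^bsub>A-n\<^esub>\<^sup>\<bottom>\<close>, and the recursion of \<open>z\<^sub>A\<close> absorbs the factor after reindexing by
  \<open>A - n\<close>.
\<close>

lemma coproduct_sum_power_sum:
  assumes "n > 0"
  shows "coproduct_sum c \<Phi> (power_sum n * f) =
    coproduct_sum c (\<lambda>x y. c *\<^sub>Q \<Phi> (power_sum n * x) y + \<Phi> x (power_sum n * y)) f"
proof -
  let ?w = "\<lambda>A. c ^ size A / zee_mset A"
  let ?S = "skew_support f"
  let ?T = "?S \<union> add_mset n ` ?S"
  have T: "finite ?T" by simp
  have pos: "0 \<notin># A" if "A \<in> ?T" for A
    using that assms by (auto simp: skew_support_def)
  have skew_eq: "skew (pp A) (power_sum n * f) =
      power_sum n * skew (pp A) f + of_nat (n * count A n) *\<^sub>Q skew (pp (A - {#n#})) f"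
    if "0 \<notin># A" for A
    using that assms by (simp add: skew_power_sum_mult d_power_pp skew_linear_simps)
  have "skew_support (power_sum n * f) \<subseteq> ?T"
  proof
    fix A assume A: "A \<in> skew_support (power_sum n * f)"
    then have "skew (pp A) f \<noteq> 0 \<or> (n \<in># A \<and> skew (pp (A - {#n#})) f \<noteq> 0)"
      using skew_eq[of A] by (cases "n \<in># A") (auto simp: skew_support_def not_in_iff)
    then show "A \<in> ?T"
      using A by (auto simp: skew_support_def image_iff dest: in_diffD intro!: bexI[of _ "A - {#n#}"])
  qed
  then have "coproduct_sum c \<Phi> (power_sum n * f) =
      (\<Sum>A\<in>?T. ?w A *\<^sub>Q \<Phi> (pp A) (skew (pp A) (power_sum n * f)))"
    by (rule coproduct_sum_superset[OF T])
  also have "\<dots> = (\<Sum>A\<in>?T. ?w A *\<^sub>Q \<Phi> (pp A) (power_sum n * skew (pp A) f)) +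
      (\<Sum>A\<in>?T. (?w A * of_nat (n * count A n)) *\<^sub>Q \<Phi> (pp A) (skew (pp (A - {#n#})) f))"
    by (subst sum.distrib[symmetric], rule sum.cong)
       (auto simp: skew_eq pos linear_add[OF lin] linear_scale[OF lin] sym.scale_right_distrib
          simp del: Un_iff)
  also have "(\<Sum>A\<in>?T. ?w A *\<^sub>Q \<Phi> (pp A) (power_sum n * skew (pp A) f)) =
      (\<Sum>A\<in>?S. ?w A *\<^sub>Q \<Phi> (pp A) (power_sum n * skew (pp A) f))"
  proof (rule sum.mono_neutral_right[OF T])
    show "\<forall>A\<in>?T - ?S. ?w A *\<^sub>Q \<Phi> (pp A) (power_sum n * skew (pp A) f) = 0"
    proof
      fix A assume "A \<in> ?T - ?S"
      then have "skew (pp A) f = 0" using pos[of A] by (simp add: skew_support_def)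
      then show "?w A *\<^sub>Q \<Phi> (pp A) (power_sum n * skew (pp A) f) = 0"
        by (simp add: linear_0[OF lin])
    qed
  qed simp
  also have "(\<Sum>A\<in>?T. (?w A * of_nat (n * count A n)) *\<^sub>Q \<Phi> (pp A) (skew (pp (A - {#n#})) f)) =
      (\<Sum>A\<in>add_mset n ` ?S. (?w A * of_nat (n * count A n)) *\<^sub>Q \<Phi> (pp A) (skew (pp (A - {#n#})) f))"
  proof (rule sum.mono_neutral_right[OF T])
    show "\<forall>A\<in>?T - add_mset n ` ?S.
        (?w A * of_nat (n * count A n)) *\<^sub>Q \<Phi> (pp A) (skew (pp (A - {#n#})) f) = 0"
    proof
      fix A assume A: "A \<in> ?T - add_mset n ` ?S"
      show "(?w A * of_nat (n * count A n)) *\<^sub>Q \<Phi> (pp A) (skew (pp (A - {#n#})) f) = 0"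
      proof (cases "n \<in># A")
        case True
        then have "A - {#n#} \<notin> ?S" using A by (metis DiffD2 imageI insert_DiffM)
        moreover have "0 \<notin># A - {#n#}" using A pos[of A] by (meson DiffD1 in_diffD)
        ultimately have "skew (pp (A - {#n#})) f = 0" unfolding skew_support_def by blast
        then show ?thesis by (simp add: linear_0[OF lin])
      qed (simp add: not_in_iff)
    qed
  qed auto
  also have "\<dots> = (\<Sum>A\<in>?S. (?w A * c) *\<^sub>Q \<Phi> (power_sum n * pp A) (skew (pp A) f))"
  proof -
    have weight: "?w (add_mset n A) * of_nat (n * count (add_mset n A) n) = ?w A * c"
      if "A \<in> ?S" for A
    proof -
      let ?k = "of_nat n * of_nat (Suc (count A n)) :: rat"
      have "?k \<noteq> 0" using assms by simp
      moreover have "?w (add_mset n A) * of_nat (n * count (add_mset n A) n) = c * c ^ size A / (?k * zee_mset A) * ?k"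
        by (simp only: zee_mset_add_mset size_add_mset power_Suc count_add_mset if_True of_nat_mult refl simp_thms)
      ultimately show ?thesis by (simp del: of_nat_Suc)
    qed
    show ?thesis
      by (subst sum.reindex, simp add: inj_on_def, rule sum.cong)
         (simp_all only: comp_apply weight pp_add_mset add_mset_remove_trivial)
  qed
  finally have *: "coproduct_sum c \<Phi> (power_sum n * f) =
      (\<Sum>A\<in>?S. ?w A *\<^sub>Q (c *\<^sub>Q \<Phi> (power_sum n * pp A) (skew (pp A) f) + \<Phi> (pp A) (power_sum n * skew (pp A) f)))"
    by (simp add: sum.distrib sym.scale_right_distrib)
  interpret rhs: linear_second "\<lambda>x y. c *\<^sub>Q \<Phi> (power_sum n * x) y + \<Phi> x (power_sum n * y)"
    by unfold_locales
       (intro is_linear_plus is_linear_scale lin is_linear_compose[OF lin] is_linear_times is_linear_id)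
  show ?thesis unfolding * by (subst rhs.coproduct_sum_superset[of ?S]) auto
qed

lemma coproduct_sum_compose:
  assumes "is_linear T"
  shows "coproduct_sum c (\<lambda>x y. T (\<Phi> x y)) f = T (coproduct_sum c \<Phi> f)"
proof -
  interpret T: linear_second "\<lambda>x y. T (\<Phi> x y)"
    by unfold_locales (rule is_linear_compose[OF assms lin])
  show ?thesis
    by (simp add: coproduct_sum_superset[of "skew_support f"] T.coproduct_sum_superset[of "skew_support f"]
        linear_sum[OF assms] linear_scale[OF assms])
qed

lemma coproduct_sum_add:
  assumes "linear_second \<Psi>"
  shows "coproduct_sum c (\<lambda>x y. \<Phi> x y + \<Psi> x y) f = coproduct_sum c \<Phi> f + coproduct_sum c \<Psi> f"
proof -
  interpret \<Psi>: linear_second \<Psi> by fact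
  interpret sum: linear_second "\<lambda>x y. \<Phi> x y + \<Psi> x y"
    by unfold_locales (intro is_linear_plus lin \<Psi>.lin)
  show ?thesis
    by (simp add: coproduct_sum_superset[of "skew_support f"] \<Psi>.coproduct_sum_superset[of "skew_support f"]
        sum.coproduct_sum_superset[of "skew_support f"] sym.scale_right_distrib sum.distrib)
qed

lemma coproduct_sum_schur:
  assumes "\<And>y. is_linear (\<lambda>x. \<Phi> x y)" "homog (int N) f"
  shows "coproduct_sum 1 \<Phi> f = (\<Sum>lam | psize lam \<le> N. \<Phi> (schur lam) (skew (schur lam) f))"
proof -
  have "coproduct_sum 1 \<Phi> f = (\<Sum>A\<in>positive_multisets N. (1 / zee_mset A) *\<^sub>Q \<Phi> (pp A) (skew (pp A) f))"
    using skew_support_homog[OF assms(2)] by (subst coproduct_sum_superset) auto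
  also have "\<dots> = (\<Sum>lam | psize lam \<le> N. \<Phi> (schur lam) (skew (schur lam) f))"
    using assms(1) is_linear_compose[OF lin is_linear_skew_left]
    by (intro sum_schur_eq_sum_pp[symmetric, of "\<lambda>x y. \<Phi> x (skew y f)"])
  finally show ?thesis .
qed

text \<open>
  Since the antipode multiplies \<open>p\<^sub>A\<close> by \<open>(-1)\<close> to the number of its parts, the weights for
  \<open>c = -1\<close> arise by applying it to one of the two dual bases; on Schur functions it conjugates, up to sign.
\<close>

lemma coproduct_sum_schur_signed:
  assumes "\<And>y. is_linear (\<lambda>x. \<Phi> x y)" "homog (int N) f"
  shows "coproduct_sum (-1) \<Phi> f =
    (\<Sum>lam | psize lam \<le> N. (-1) ^ psize lam *\<^sub>Q \<Phi> (schur lam) (skew (schur (conj_partition lam)) f))"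
proof -
  let ?\<Psi> = "\<lambda>x y. \<Phi> x (skew (antipode y) f)"
  have "coproduct_sum (-1) \<Phi> f =
      (\<Sum>A\<in>positive_multisets N. ((-1) ^ size A / zee_mset A) *\<^sub>Q \<Phi> (pp A) (skew (pp A) f))"
    using skew_support_homog[OF assms(2)] by (subst coproduct_sum_superset) auto
  also have "\<dots> = (\<Sum>A\<in>positive_multisets N. (1 / zee_mset A) *\<^sub>Q ?\<Psi> (pp A) (pp A))"
    by (intro sum.cong)
       (auto simp: positive_multisets_def antipode_pp skew_linear_simps linear_scale[OF lin])
  also have "\<dots> = (\<Sum>lam | psize lam \<le> N. ?\<Psi> (schur lam) (schur lam))"
    using assms(1) is_linear_compose[OF is_linear_compose[OF lin is_linear_skew_left] is_linear_antipode]
    by (intro sum_schur_eq_sum_pp[symmetric])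
  also have "\<dots> = (\<Sum>lam | psize lam \<le> N. (-1) ^ psize lam *\<^sub>Q \<Phi> (schur lam) (skew (schur (conj_partition lam)) f))"
    by (simp add: antipode_schur skew_linear_simps linear_scale[OF lin])
  finally show ?thesis .
qed

end


section \<open>Skewing a product\<close>

lemma is_linear_skew_compose:
  assumes "is_linear T"
  shows "is_linear (\<lambda>x. skew (T x) h)" and "is_linear (\<lambda>x. skew f (T x))"
  using is_linear_compose[OF is_linear_skew_left assms] is_linear_compose[OF is_linear_skew assms]
  by auto

lemmas skew_linear_intros = linear_intros is_linear_skew_compose

lemma skew_power_sum_mult_left: "n > 0 \<Longrightarrow> skew (power_sum n * f) h = skew f (d_power n h)"
  by (simp add: mult.commute[of "power_sum n"] skew_mult skew_power_sum)

lemma d_power_skew: "n > 0 \<Longrightarrow> d_power n (skew f h) = skew f (d_power n h)"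
  using skew_commute[of "power_sum n" f h] by (simp add: skew_power_sum)

text \<open>
  In the step from \<open>f\<close> to \<open>p\<^sub>n f\<close>, the primitive element \<open>p\<^sub>n\<close> acts on either factor of the product, which is the
  Leibniz rule.
\<close>

lemma skew_product:
  "skew f (a * g) = coproduct_sum 1 (\<lambda>x y. skew x a * skew y g) f"
proof (induction f arbitrary: a g rule: sym_induct_power_sum)
  case one
  interpret linear_second "\<lambda>x y. skew x a * skew y g"
    by unfold_locales (intro skew_linear_intros)
  show ?case by (simp add: coproduct_sum_1)
next
  case (add f1 f2)
  interpret linear_second "\<lambda>x y. skew x a * skew y g"
    by unfold_locales (intro skew_linear_intros)
  show ?case by (simp add: skew_linear_simps add linear_add[OF is_linear_coproduct_sum])
next
  case (scale c f)
  interpret linear_second "\<lambda>x y. skew x a * skew y g"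
    by unfold_locales (intro skew_linear_intros)
  show ?case by (simp add: skew_linear_simps scale linear_scale[OF is_linear_coproduct_sum])
next
  case (power_sum n f)
  interpret \<Phi>: linear_second "\<lambda>x y. skew x a * skew y g"
    by unfold_locales (intro skew_linear_intros)
  interpret L: linear_second "\<lambda>x y. skew x (d_power n a) * skew y g"
    by unfold_locales (intro skew_linear_intros)
  have R: "linear_second (\<lambda>x y. skew x a * skew y (d_power n g))"
    by unfold_locales (intro skew_linear_intros)
  have "coproduct_sum 1 (\<lambda>x y. skew x a * skew y g) (power_sum n * f) =
      coproduct_sum 1 (\<lambda>x y. skew x (d_power n a) * skew y g + skew x a * skew y (d_power n g)) f"
    using power_sum(1) by (simp add: \<Phi>.coproduct_sum_power_sum skew_power_sum_mult_left)
  also have "\<dots> = skew f (d_power n a * g) + skew f (a * d_power n g)"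
    by (simp add: L.coproduct_sum_add[OF R] power_sum)
  also have "\<dots> = skew (power_sum n * f) (a * g)"
    using power_sum(1) by (simp add: skew_power_sum_mult_left d_power_mult skew_linear_simps)
  finally show ?case by simp
qed

text \<open>
  In the step from \<open>f\<close> to \<open>p\<^sub>n f\<close>, the Leibniz rule yields two terms, and the one in which \<open>p\<^sub>n\<^sup>\<bottom>\<close> falls on
  \<open>a\<close> is cancelled by the negative term coming from the antipode.
\<close>

lemma mult_skew:
  "a * skew f g = coproduct_sum (-1) (\<lambda>x y. skew y (skew x a * g)) f"
proof (induction f arbitrary: a g rule: sym_induct_power_sum)
  case one
  interpret linear_second "\<lambda>x y. skew y (skew x a * g)"
    by unfold_locales (intro skew_linear_intros)
  show ?case by (simp add: coproduct_sum_1)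
next
  case (add f1 f2)
  interpret linear_second "\<lambda>x y. skew y (skew x a * g)"
    by unfold_locales (intro skew_linear_intros)
  show ?case by (simp add: skew_linear_simps distrib_left add linear_add[OF is_linear_coproduct_sum])
next
  case (scale c f)
  interpret linear_second "\<lambda>x y. skew y (skew x a * g)"
    by unfold_locales (intro skew_linear_intros)
  show ?case
    by (simp add: skew_linear_simps scale_mult_right scale linear_scale[OF is_linear_coproduct_sum])
next
  case (power_sum n f)
  interpret \<Phi>: linear_second "\<lambda>x y. skew y (skew x a * g)"
    by unfold_locales (intro skew_linear_intros)
  have "coproduct_sum (-1) (\<lambda>x y. skew y (skew x a * g)) (power_sum n * f) =
      coproduct_sum (-1) (\<lambda>x y. skew y (skew x a * d_power n g)) f"
    using power_sum(1)
    by (simp add: \<Phi>.coproduct_sum_power_sum skew_power_sum_mult_left d_power_mult d_power_skew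
        skew_linear_simps)
  also have "\<dots> = a * skew (power_sum n * f) g"
    using power_sum by (simp add: skew_power_sum_mult_left)
  finally show ?case by simp
qed

section \<open>The Kronecker product\<close>

lemma pcoord_sum: "pcoord (sum f S) A = (\<Sum>s\<in>S. pcoord (f s) A)"
  by (induction S rule: infinite_finite_induct) (auto simp: pcoord_add)

lemma pcoord_kronecker: "pcoord (kronecker f g) A = zee_mset A * pcoord f A * pcoord g A"
proof (cases "0 \<in># A")
  case False
  let ?T = "{lam. coord power_prod f lam \<noteq> 0}"
  have T: "finite ?T" by (simp add: finite_coord basis_power_prod)
  have "kronecker f g = (\<Sum>lam\<in>?T. (coord power_prod f lam * coord power_prod g lam * of_nat (zee lam)) *\<^sub>Q power_prod lam)"
    unfolding kronecker_def by (rule Sum_any.expand_superset) (use T in auto)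
  then have "pcoord (kronecker f g) A = (\<Sum>lam\<in>?T. if lam = partition_of A
      then zee_mset A * pcoord f A * pcoord g A else 0)"
    using False
    by (auto simp: pcoord_sum pcoord_scale power_prod_pp pcoord_pp zee_shape intro!: sum.cong)
       (auto simp: pcoord_def)
  also have "\<dots> = zee_mset A * pcoord f A * pcoord g A"
    using T False by (simp add: pcoord_def)
  finally show ?thesis .
qed (simp add: pcoord_zero_part)

lemma is_linear_kronecker: "is_linear (kronecker f)" and is_linear_kronecker_left: "is_linear (\<lambda>f. kronecker f g)"
  by (intro is_linearI pcoord_eqI; simp add: pcoord_kronecker pcoord_add pcoord_scale algebra_simps)+

lemmas kronecker_linear_simps =
  linear_0[OF is_linear_kronecker] linear_0[OF is_linear_kronecker_left]
  linear_add[OF is_linear_kronecker] linear_add[OF is_linear_kronecker_left]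
  linear_scale[OF is_linear_kronecker] linear_scale[OF is_linear_kronecker_left]

lemma is_linear_kronecker_compose:
  assumes "is_linear T"
  shows "is_linear (\<lambda>x. kronecker (T x) h)" and "is_linear (\<lambda>x. kronecker f (T x))"
  using is_linear_compose[OF is_linear_kronecker_left assms] is_linear_compose[OF is_linear_kronecker assms]
  by auto

lemmas kronecker_linear_intros = skew_linear_intros is_linear_kronecker_compose

lemma form_kronecker: "form (kronecker f g) h = form g (kronecker f h)"
proof -
  have "form (kronecker f g) h =
      (\<Sum>A | pcoord f A \<noteq> 0. zee_mset A * pcoord (kronecker f g) A * pcoord h A)"
    by (rule form_superset) (auto simp: finite_pcoord pcoord_kronecker)
  also have "\<dots> = (\<Sum>A | pcoord f A \<noteq> 0. zee_mset A * pcoord g A * pcoord (kronecker f h) A)"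
    by (simp add: pcoord_kronecker mult_ac)
  also have "\<dots> = form g (kronecker f h)"
    by (rule form_superset[symmetric]) (auto simp: finite_pcoord pcoord_kronecker)
  finally show ?thesis .
qed

lemma kronecker_pp_pp:
  "0 \<notin># A \<Longrightarrow> 0 \<notin># B \<Longrightarrow> kronecker (pp A) (pp B) = (if A = B then zee_mset A *\<^sub>Q pp A else 0)"
  by (rule pcoord_eqI) (auto simp: pcoord_kronecker pcoord_pp pcoord_scale)

text \<open>
  On products of power sums both sides are supported on \<open>g = p\<^sub>n f\<close>, where they agree by the recursion for
  \<open>z\<close>.
\<close>

lemma kronecker_power_sum_mult:
  assumes "n > 0"
  shows "kronecker (power_sum n * f) g = power_sum n * kronecker f (d_power n g)"
proof (rule form_nondegenerate)
  fix h
  show "form h (kronecker (power_sum n * f) g) = form h (power_sum n * kronecker f (d_power n g))"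
  proof (induction f rule: sym_induct_pp)
    case (pp A)
    show ?case
    proof (induction g rule: sym_induct_pp)
      case (pp B)
      have "kronecker (power_sum n * pp A) (pp B) = (if add_mset n A = B then zee_mset B *\<^sub>Q pp B else 0)"
        using pp \<open>0 \<notin># A\<close> assms kronecker_pp_pp[of "add_mset n A" B] by (auto simp: pp_add_mset)
      moreover have "kronecker (pp A) (pp (B - {#n#})) = (if A = B - {#n#} then zee_mset A *\<^sub>Q pp A else 0)"
        using pp \<open>0 \<notin># A\<close> by (intro kronecker_pp_pp) (auto dest: in_diffD)
      moreover have "add_mset n A = B \<longleftrightarrow> A = B - {#n#}" if "n \<in># B"
        using that by auto
      ultimately have "kronecker (power_sum n * pp A) (pp B) =
          of_nat (n * count B n) *\<^sub>Q (power_sum n * kronecker (pp A) (pp (B - {#n#})))"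
        using zee_mset_add_mset[of n "B - {#n#}"] pp_add_mset[of n "B - {#n#}"]
        by (cases "n \<in># B") (auto simp: not_in_iff scale_mult_right)
      then show ?case using pp by (simp add: d_power_pp kronecker_linear_simps scale_mult_right)
    qed (simp_all add: kronecker_linear_simps linear_0[OF is_linear_d_power] linear_add[OF is_linear_d_power]
        linear_scale[OF is_linear_d_power] sym_linear_simps form_add_right form_scale_right)
  qed (simp_all add: kronecker_linear_simps sym_linear_simps form_add_right form_scale_right)
qed

lemma kronecker_1: "kronecker 1 f = pcoord f {#} *\<^sub>Q 1"
  by (rule pcoord_eqI) (use pcoord_pp[of "{#}"] in \<open>auto simp: pcoord_kronecker pcoord_scale\<close>)

lemma pcoord_mult_empty: "pcoord (f * g) {#} = pcoord f {#} * pcoord g {#}"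
proof (induction f rule: sym_induct_pp)
  case (pp A)
  show ?case
  proof (induction g rule: sym_induct_pp)
    case (pp B)
    then show ?case using \<open>0 \<notin># A\<close> by (auto simp: pcoord_pp simp flip: pp_union)
  qed (simp_all add: sym_linear_simps pcoord_add pcoord_scale)
qed (simp_all add: sym_linear_simps pcoord_add pcoord_scale)

text \<open>
  The Kronecker product with \<open>f\<close> distributes over ordinary products through the coproduct of \<open>f\<close>. In the step from
  \<open>f\<close> to \<open>p\<^sub>n f\<close> the factor \<open>p\<^sub>n\<close> is pulled out, at the cost of a derivation on the argument.
\<close>

lemma kronecker_product:
  "kronecker f (a * g) = coproduct_sum 1 (\<lambda>x y. kronecker y a * kronecker x g) f"
proof (induction f arbitrary: a g rule: sym_induct_power_sum)
  case one
  interpret linear_second "\<lambda>x y. kronecker y a * kronecker x g"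
    by unfold_locales (intro kronecker_linear_intros)
  show ?case by (simp add: coproduct_sum_1 kronecker_1 pcoord_mult_empty scale_mult_left)
next
  case (add f1 f2)
  interpret linear_second "\<lambda>x y. kronecker y a * kronecker x g"
    by unfold_locales (intro kronecker_linear_intros)
  show ?case by (simp add: kronecker_linear_simps add linear_add[OF is_linear_coproduct_sum])
next
  case (scale c f)
  interpret linear_second "\<lambda>x y. kronecker y a * kronecker x g"
    by unfold_locales (intro kronecker_linear_intros)
  show ?case by (simp add: kronecker_linear_simps scale linear_scale[OF is_linear_coproduct_sum])
next
  case (power_sum n f)
  interpret \<Phi>: linear_second "\<lambda>x y. kronecker y a * kronecker x g"
    by unfold_locales (intro kronecker_linear_intros)
  interpret L: linear_second "\<lambda>x y. kronecker y a * kronecker x (d_power n g)"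
    by unfold_locales (intro kronecker_linear_intros)
  interpret R: linear_second "\<lambda>x y. kronecker y (d_power n a) * kronecker x g"
    by unfold_locales (intro kronecker_linear_intros)
  interpret L': linear_second "\<lambda>x y. power_sum n * (kronecker y a * kronecker x (d_power n g))"
    by unfold_locales (intro kronecker_linear_intros)
  have R': "linear_second (\<lambda>x y. power_sum n * (kronecker y (d_power n a) * kronecker x g))"
    by unfold_locales (intro kronecker_linear_intros)
  have "coproduct_sum 1 (\<lambda>x y. kronecker y a * kronecker x g) (power_sum n * f) =
      coproduct_sum 1 (\<lambda>x y. power_sum n * (kronecker y a * kronecker x (d_power n g)) +
        power_sum n * (kronecker y (d_power n a) * kronecker x g)) f"
    unfolding \<Phi>.coproduct_sum_power_sum[OF power_sum(1)]
    by (simp only: kronecker_power_sum_mult[OF power_sum(1)] sym.scale_one) (simp add: mult_ac)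
  also have "\<dots> = power_sum n * (kronecker f (a * d_power n g) + kronecker f (d_power n a * g))"
    unfolding L'.coproduct_sum_add[OF R'] power_sum distrib_left
    by (simp only: L.coproduct_sum_compose[OF is_linear_times[OF is_linear_id]]
        R.coproduct_sum_compose[OF is_linear_times[OF is_linear_id]])
  also have "\<dots> = kronecker (power_sum n * f) (a * g)"
    using power_sum(1)
    by (simp add: kronecker_power_sum_mult d_power_mult kronecker_linear_simps add.commute)
  finally show ?case by simp
qed

section \<open>Stabilised Kronecker operators\<close>

text \<open>
  Normally ordered operators: the derivations act first, the multiplications afterwards.
\<close>

definition normal_op :: "sym \<Rightarrow> sym \<Rightarrow> sym" where
  "normal_op q g = extend_pp (\<lambda>A. pp A * skew (pp A) g) q"

lemma normal_op_pp: "0 \<notin># A \<Longrightarrow> normal_op (pp A) g = pp A * skew (pp A) g"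
  by (simp add: normal_op_def)

lemma is_linear_normal_op_left: "is_linear (\<lambda>q. normal_op q g)"
  by (simp add: normal_op_def is_linear_extend_pp)

lemma is_linear_normal_op: "is_linear (normal_op q)"
  unfolding normal_op_def extend_pp_def by (intro skew_linear_intros)

lemmas normal_op_linear_simps =
  linear_0[OF is_linear_normal_op] linear_0[OF is_linear_normal_op_left]
  linear_add[OF is_linear_normal_op] linear_add[OF is_linear_normal_op_left]
  linear_scale[OF is_linear_normal_op] linear_scale[OF is_linear_normal_op_left]
  linear_diff[OF is_linear_normal_op] linear_diff[OF is_linear_normal_op_left]

lemma is_linear_normal_op_compose:
  assumes "is_linear T"
  shows "is_linear (\<lambda>x. normal_op (T x) h)" and "is_linear (\<lambda>x. normal_op f (T x))"
  using is_linear_compose[OF is_linear_normal_op_left assms] is_linear_compose[OF is_linear_normal_op assms]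
  by auto

lemma normal_op_1 [simp]: "normal_op 1 g = g"
  using normal_op_pp[of "{#}" g] by simp

text \<open>
  In a normally ordered operator a further generator is multiplied from the outside, while its derivation
  acts from the inside.
\<close>

lemma normal_op_power_sum_mult:
  assumes "n > 0"
  shows "normal_op (power_sum n * q) g = power_sum n * normal_op q (d_power n g)"
proof (rule linear_ext_pp[of "\<lambda>q. normal_op (power_sum n * q) g" "\<lambda>q. power_sum n * normal_op q (d_power n g)"])
  show "is_linear (\<lambda>q. normal_op (power_sum n * q) g)"
    "is_linear (\<lambda>q. power_sum n * normal_op q (d_power n g))"
    by (intro is_linear_normal_op_compose linear_intros)+
  show "normal_op (power_sum n * pp A) g = power_sum n * normal_op (pp A) (d_power n g)" if "0 \<notin># A" for A
    using normal_op_pp[of "add_mset n A" g] that assms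
    by (simp add: pp_add_mset normal_op_pp skew_power_sum_mult_left mult_ac)
qed

lemma form_normal_op: "form (normal_op q f) g = form f (normal_op q g)"
proof (induction q rule: sym_induct_pp)
  case (pp A)
  have "form (pp A * skew (pp A) f) g = form (skew (pp A) f) (skew (pp A) g)"
    by (rule skew_adjoint)
  also have "\<dots> = form f (pp A * skew (pp A) g)"
    unfolding form_commute[of f] skew_adjoint by (rule form_commute)
  finally show ?case using pp by (simp add: normal_op_pp)
qed (simp_all add: normal_op_linear_simps form_add_left form_add_right form_scale_left form_scale_right)

text \<open>
  For \<open>q = p\<^sub>B\<close>, the Kronecker product selects the term \<open>A = B\<close> of the coproduct sum and cancels its weight. On Schur
  functions this yields the inner sum over \<open>\<tau>\<close> in the identities for the stabilised operators.
\<close>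

lemma normal_op_eq_coproduct_sum:
  "normal_op q a = coproduct_sum 1 (\<lambda>x y. kronecker q x * y) a"
proof (rule linear_ext_pp[of "\<lambda>q. normal_op q a" "\<lambda>q. coproduct_sum 1 (\<lambda>x y. kronecker q x * y) a"])
  have lin: "linear_second (\<lambda>x y. kronecker q x * y)" for q
    by unfold_locales (intro kronecker_linear_intros)
  have eq: "coproduct_sum 1 (\<lambda>x y. kronecker q x * y) a =
      (\<Sum>A\<in>skew_support a. (1 / zee_mset A) *\<^sub>Q (kronecker q (pp A) * skew (pp A) a))" for q
    using linear_second.coproduct_sum_superset[OF lin finite_skew_support order_refl] by simp
  show "is_linear (\<lambda>q. coproduct_sum 1 (\<lambda>x y. kronecker q x * y) a)"
    unfolding eq by (intro kronecker_linear_intros)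
  fix B :: "nat multiset" assume B: "0 \<notin># B"
  have "coproduct_sum 1 (\<lambda>x y. kronecker (pp B) x * y) a =
      (\<Sum>A\<in>skew_support a. if A = B then pp B * skew (pp B) a else 0)"
    unfolding eq using B
    by (intro sum.cong) (auto simp: skew_support_def kronecker_pp_pp scale_mult_left)
  also have "\<dots> = pp B * skew (pp B) a"
    using B finite_skew_support[of a] by (subst sum.delta) (auto simp: skew_support_def)
  finally show "normal_op (pp B) a = coproduct_sum 1 (\<lambda>x y. kronecker (pp B) x * y) a"
    using B by (simp add: normal_op_pp)
qed (rule is_linear_normal_op_left)

text \<open>
  The substitution \<open>f \<mapsto> f[X - 1]\<close> in plethystic notation, that is, \<open>p\<^sub>n \<mapsto> p\<^sub>n - 1\<close>.
\<close>

definition shift_minus_one :: "sym \<Rightarrow> sym" where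
  "shift_minus_one = extend_pp (\<lambda>A. \<Prod>n\<in>#A. power_sum n - 1)"

lemma is_linear_shift_minus_one: "is_linear shift_minus_one"
  by (simp add: shift_minus_one_def is_linear_extend_pp)

lemmas shift_minus_one_linear_simps = linear_0[OF is_linear_shift_minus_one] linear_add[OF is_linear_shift_minus_one]
  linear_scale[OF is_linear_shift_minus_one]

lemma shift_minus_one_1 [simp]: "shift_minus_one 1 = 1"
  unfolding shift_minus_one_def using extend_pp_pp[of "{#}"] by simp

lemma shift_minus_one_power_sum_mult:
  assumes "n > 0"
  shows "shift_minus_one (power_sum n * f) = power_sum n * shift_minus_one f - shift_minus_one f"
proof (rule linear_ext_pp[of "\<lambda>f. shift_minus_one (power_sum n * f)" "\<lambda>f. power_sum n * shift_minus_one f - shift_minus_one f"])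
  show "is_linear (\<lambda>f. shift_minus_one (power_sum n * f))" "is_linear (\<lambda>f. power_sum n * shift_minus_one f - shift_minus_one f)"
    by (intro linear_intros is_linear_compose[OF is_linear_shift_minus_one] is_linear_shift_minus_one)+
  show "shift_minus_one (power_sum n * pp A) = power_sum n * shift_minus_one (pp A) - shift_minus_one (pp A)" if "0 \<notin># A" for A
    using that assms extend_pp_pp[of "add_mset n A" "\<lambda>A. \<Prod>n\<in>#A. power_sum n - 1"]
    by (simp add: shift_minus_one_def pp_add_mset algebra_simps)
qed

text \<open>
  Taylor expansion of \<open>f[X - 1]\<close>. The sum is finite, but the number of its nonzero terms depends on
  \<open>f\<close>; stating the equation for all large bounds makes it stable under sums and products.
\<close>

lemma shift_minus_one_eq_sum:
  "\<exists>N0. \<forall>N\<ge>N0. shift_minus_one f = (\<Sum>i\<le>N. skew (signed_e (int i)) f)"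
proof (induction f rule: sym_induct_power_sum)
  case one
  have "(\<Sum>i\<le>N. skew (signed_e (int i)) 1) = (\<Sum>i\<in>{0}. skew (signed_e (int i)) 1)" for N
    using skew_eq_0_degree[OF homog_signed_e homog_1] by (intro sum.mono_neutral_right) auto
  then show ?case by simp
next
  case (add f g)
  then obtain M N where M: "\<And>k. k \<ge> M \<Longrightarrow> shift_minus_one f = (\<Sum>i\<le>k. skew (signed_e (int i)) f)"
    and N: "\<And>k. k \<ge> N \<Longrightarrow> shift_minus_one g = (\<Sum>i\<le>k. skew (signed_e (int i)) g)" by blast
  have "shift_minus_one (f + g) = (\<Sum>i\<le>k. skew (signed_e (int i)) (f + g))" if "k \<ge> max M N" for k
    using that M[of k] N[of k] by (simp add: shift_minus_one_linear_simps skew_linear_simps sum.distrib)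
  then show ?case by blast
next
  case (scale c f)
  then show ?case by (auto simp: shift_minus_one_linear_simps skew_linear_simps simp flip: sym.scale_sum_right)
next
  case (power_sum n f)
  then obtain M where M: "\<And>k. k \<ge> M \<Longrightarrow> shift_minus_one f = (\<Sum>i\<le>k. skew (signed_e (int i)) f)" by blast
  have "shift_minus_one (power_sum n * f) = (\<Sum>i\<le>N. skew (signed_e (int i)) (power_sum n * f))" if N: "N \<ge> M + n" for N
  proof -
    have "(\<Sum>i\<le>N. skew (signed_e (int i)) (power_sum n * f)) =
        (\<Sum>i\<le>N. power_sum n * skew (signed_e (int i)) f) - (\<Sum>i\<le>N. skew (signed_e (int i - int n)) f)"
      using power_sum(1)
      by (simp add: skew_power_sum_mult d_power_signed_e skew_linear_simps sum_subtractf)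
    also have "(\<Sum>i\<le>N. skew (signed_e (int i - int n)) f) = (\<Sum>i\<in>{n..N}. skew (signed_e (int i - int n)) f)"
      by (intro sum.mono_neutral_right) auto
    also have "\<dots> = (\<Sum>i\<le>N - n. skew (signed_e (int i)) f)"
      using N by (intro sum.reindex_bij_witness[of _ "\<lambda>i. i + n" "\<lambda>i. i - n"]) (auto simp: of_nat_diff)
    finally show ?thesis
      using power_sum(1) N M[of N] M[of "N - n"]
      by (simp add: shift_minus_one_power_sum_mult flip: sum_distrib_left)
  qed
  then show ?case by blast
qed

lemma homog_linear_ext:
  assumes "homog d q" "is_linear S" "is_linear T"
    and "\<And>B. 0 \<notin># B \<Longrightarrow> int (\<Sum>\<^sub># B) = d \<Longrightarrow> S (pp B) = T (pp B)"
  shows "S q = T q"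
proof -
  let ?P = "{B. pcoord q B \<noteq> 0}"
  have q: "q = (\<Sum>B\<in>?P. pcoord q B *\<^sub>Q pp B)" by (simp add: sum_pcoord finite_pcoord)
  have "S (pp B) = T (pp B)" if "B \<in> ?P" for B
    using that assms(1) pcoord_zero_part by (intro assms(4)) (auto simp: homog_iff_pcoord)
  then show ?thesis
    by (subst (1 2) q) (simp add: linear_sum assms(2,3) linear_scale)
qed

lemma skew_pp_complete_h: "0 \<notin># A \<Longrightarrow> skew (pp A) (complete_h m) = complete_h (m - int (\<Sum>\<^sub># A))"
  by (induction A arbitrary: m)
     (auto simp: pp_add_mset skew_power_sum_mult_left d_power_complete_h algebra_simps)

lemma pcoord_complete_h:
  assumes "0 \<notin># A"
  shows "zee_mset A * pcoord (complete_h n) A = (if int (\<Sum>\<^sub># A) = n then 1 else 0)"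
proof -
  have "zee_mset A * pcoord (complete_h n) A = form 1 (complete_h (n - int (\<Sum>\<^sub># A)))"
    using assms skew_adjoint[of "pp A" 1 "complete_h n"]
    by (simp add: form_pp skew_pp_complete_h del: of_nat_sum_mset)
  also have "\<dots> = (if int (\<Sum>\<^sub># A) = n then 1 else 0)"
    using form_homog[OF homog_1 homog_complete_h, of "n - int (\<Sum>\<^sub># A)"]
    by (auto simp del: of_nat_sum_mset)
  finally show ?thesis .
qed

text \<open>
  In power-sum coordinates \<open>h\<^sub>n\<close> has the coefficient \<open>1 / z\<^sub>A\<close> at every \<open>A\<close> of degree \<open>n\<close>, so it is the
  identity of the Kronecker product in that degree.
\<close>

lemma kronecker_complete_h:
  assumes "homog n g"
  shows "kronecker (complete_h n) g = g"
proof (rule pcoord_eqI)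
  fix A
  show "pcoord (kronecker (complete_h n) g) A = pcoord g A"
  proof (cases "pcoord g A = 0")
    case False
    then have "0 \<notin># A" "int (\<Sum>\<^sub># A) = n"
      using assms pcoord_zero_part unfolding homog_iff_pcoord by blast+
    then show ?thesis by (simp add: pcoord_kronecker pcoord_complete_h del: of_nat_sum_mset)
  qed (simp add: pcoord_kronecker)
qed

lemma kronecker_pp_mult: "0 \<notin># A \<Longrightarrow> kronecker (pp A * f) g = pp A * kronecker f (skew (pp A) g)"
  by (induction A arbitrary: g)
     (auto simp: pp_add_mset mult.assoc kronecker_power_sum_mult skew_power_sum_mult_left)

text \<open>
  For \<open>q = p\<^sub>B\<close>, pull \<open>p\<^sub>B\<close> out of the Kronecker product; what remains is the Kronecker product of
  \<open>h\<^bsub>n-d\<^esub>\<close> with \<open>p\<^sub>B\<^sup>\<bottom> g\<close>, which has degree \<open>n - d\<close>.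
\<close>

lemma kronecker_complete_h_mult:
  assumes "homog d q" "homog n g"
  shows "kronecker (complete_h (n - d) * q) g = normal_op q g"
proof (rule homog_linear_ext[OF assms(1), of "\<lambda>q. kronecker (complete_h (n - d) * q) g" "\<lambda>q. normal_op q g"])
  show "is_linear (\<lambda>q. kronecker (complete_h (n - d) * q) g)"
    by (intro kronecker_linear_intros)
  fix B assume B: "0 \<notin># B" "int (\<Sum>\<^sub># B) = d"
  have "homog (n - d) (skew (pp B) g)"
    using skew_homog[OF homog_pp assms(2), of B] B by (simp del: of_nat_sum_mset)
  then show "kronecker (complete_h (n - d) * pp B) g = normal_op (pp B) g"
    using B kronecker_pp_mult[of B "complete_h (n - d)" g]
    by (simp add: normal_op_pp kronecker_complete_h mult.commute)
qed (rule is_linear_normal_op_left)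

text \<open>
  A description of the stabilised operators that does not refer to the degree of their argument.
\<close>

definition stable_op :: "sym \<Rightarrow> sym \<Rightarrow> sym" where
  "stable_op f g = normal_op (shift_minus_one f) g"

lemma is_linear_stable_op: "is_linear (stable_op f)"
  and is_linear_stable_op_left: "is_linear (\<lambda>f. stable_op f g)"
  unfolding stable_op_def
  by (intro is_linear_normal_op is_linear_normal_op_compose is_linear_shift_minus_one)+

lemma is_linear_stable_op_compose:
  assumes "is_linear T"
  shows "is_linear (\<lambda>x. stable_op (T x) h)" and "is_linear (\<lambda>x. stable_op f (T x))"
  using is_linear_compose[OF is_linear_stable_op_left assms] is_linear_compose[OF is_linear_stable_op assms]
  by auto

lemmas stable_op_linear_intros =
  kronecker_linear_intros is_linear_normal_op_compose is_linear_stable_op_compose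

lemmas stable_op_linear_simps =
  linear_0[OF is_linear_stable_op] linear_0[OF is_linear_stable_op_left]
  linear_add[OF is_linear_stable_op] linear_add[OF is_linear_stable_op_left]
  linear_scale[OF is_linear_stable_op] linear_scale[OF is_linear_stable_op_left]

lemma stable_op_1: "stable_op 1 g = g"
  by (simp add: stable_op_def)

lemma stable_op_power_sum_mult:
  "n > 0 \<Longrightarrow> stable_op (power_sum n * f) g = power_sum n * stable_op f (d_power n g) - stable_op f g"
  by (simp add: stable_op_def shift_minus_one_power_sum_mult normal_op_linear_simps normal_op_power_sum_mult)

lemma form_stable_op: "form (stable_op q f) g = form f (stable_op q g)"
  by (simp add: stable_op_def form_normal_op)

text \<open>
  Expand the determinant by Bernstein's formula; its \<open>i\<close>-th term is \<open>h\<^bsub>n-d\<^esub> q\<close> with \<open>q\<close> homogeneous of degree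
  \<open>d = |\<lambda>| - i\<close>, hence acts as a normally ordered operator, and the elements \<open>q\<close> add up to
  \<open>s\<^sub>\<lambda>[X - 1]\<close>.
\<close>

lemma kronecker_schur_seq_Cons:
  assumes "homog n g"
  shows "kronecker (schur_seq ((n - int (psize lam)) # map int (parts lam))) g = stable_op (schur lam) g"
proof -
  let ?l = "length (parts lam)"
  obtain N0 where N0: "\<And>N. N \<ge> N0 \<Longrightarrow> shift_minus_one (schur lam) = (\<Sum>i\<le>N. skew (signed_e (int i)) (schur lam))"
    using shift_minus_one_eq_sum by blast
  have "shift_minus_one (schur lam) = (\<Sum>i\<le>max N0 ?l. skew (signed_e (int i)) (schur lam))"
    by (rule N0) simp
  also have "\<dots> = (\<Sum>i\<le>?l. skew (signed_e (int i)) (schur lam))"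
    using skew_signed_e_schur_seq[of _ "map int (parts lam)" 0]
    by (intro sum.mono_neutral_right) (auto simp: schur_def)
  finally have shift_minus_one: "shift_minus_one (schur lam) = (\<Sum>i\<le>?l. skew (signed_e (int i)) (schur lam))" .
  have "kronecker (complete_h (n - int (psize lam) + int i) * skew (signed_e (int i)) (schur lam)) g =
      normal_op (skew (signed_e (int i)) (schur lam)) g" for i
    using kronecker_complete_h_mult[OF skew_homog[OF homog_signed_e[of "int i"] homog_schur[of lam]] assms]
    by (simp add: diff_diff_eq2 add_diff_eq diff_add_eq)
  then show ?thesis
    unfolding stable_op_def shift_minus_one schur_seq_Cons
    by (simp add: linear_sum[OF is_linear_kronecker_left] linear_sum[OF is_linear_normal_op_left] flip: schur_def)
qed

lemma Kbar_part_superset: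
  assumes "\<And>M. mcoeff g M \<noteq> 0 \<Longrightarrow> size M \<le> N"
  shows "Kbar_part lam g = (\<Sum>n\<le>N. stable_op (schur lam) (homogeneous_component n g))"
proof -
  have hc: "homog (int n) (homogeneous_component n g)" for n
    by (auto simp: homog_def mcoeff_homogeneous_component split: if_splits)
  have "homogeneous_component n g = 0" if "n > N" for n
    using assms that by (intro sym_eqI) (fastforce simp: mcoeff_homogeneous_component)
  then have *: "{n. stable_op (schur lam) (homogeneous_component n g) \<noteq> 0} \<subseteq> {..N}"
    by (force simp: stable_op_linear_simps not_less[symmetric])
  show ?thesis
    unfolding Kbar_part_def kronecker_schur_seq_Cons[OF hc]
    by (rule Sum_any.expand_superset) (use * in auto)
qed

lemma Kbar_part_eq: "Kbar_part lam g = stable_op (schur lam) g"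
proof -
  obtain N where N: "\<And>M. mcoeff g M \<noteq> 0 \<Longrightarrow> size M \<le> N" using mcoeff_bounded by blast
  have "(\<Sum>n\<le>N. homogeneous_component n g) = g"
  proof (rule sym_eqI)
    fix M
    have "mcoeff (\<Sum>n\<le>N. homogeneous_component n g) M = (if size M \<le> N then mcoeff g M else 0)"
      by (simp add: mcoeff_sum mcoeff_homogeneous_component)
    then show "mcoeff (\<Sum>n\<le>N. homogeneous_component n g) M = mcoeff g M" using N by auto
  qed
  then show ?thesis
    using Kbar_part_superset[of g N lam, OF N] by (simp flip: linear_sum[OF is_linear_stable_op])
qed

lemma Kbar_op_schur: "Kbar_op (schur lam) = stable_op (schur lam)"
proof
  fix g
  have "Kbar_op (schur lam) g = Sum_any (\<lambda>mu. if mu = lam then stable_op (schur lam) g else 0)"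
    unfolding Kbar_op_def Kbar_part_eq
    by (rule arg_cong[where f = Sum_any]) (auto simp: coord_basis basis_schur)
  then show "Kbar_op (schur lam) g = stable_op (schur lam) g" by simp
qed

text \<open>
  In the step from \<open>f\<close> to \<open>p\<^sub>n f\<close>, the Leibniz rule splits \<open>p\<^sub>n\<^sup>\<bottom>(a g)\<close>. The part acting on \<open>a\<close> belongs
  to the normally ordered factor, and the part acting on \<open>g\<close>, together with the subtracted term, to
  the stabilised one.
\<close>

lemma stable_op_product:
  "stable_op f (a * g) = coproduct_sum 1 (\<lambda>x y. normal_op y a * stable_op x g) f"
proof (induction f arbitrary: a g rule: sym_induct_power_sum)
  case one
  interpret linear_second "\<lambda>x y. normal_op y a * stable_op x g"
    by unfold_locales (intro stable_op_linear_intros)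
  show ?case by (simp add: coproduct_sum_1 stable_op_1)
next
  case (add f1 f2)
  interpret linear_second "\<lambda>x y. normal_op y a * stable_op x g"
    by unfold_locales (intro stable_op_linear_intros)
  show ?case by (simp add: stable_op_linear_simps add linear_add[OF is_linear_coproduct_sum])
next
  case (scale c f)
  interpret linear_second "\<lambda>x y. normal_op y a * stable_op x g"
    by unfold_locales (intro stable_op_linear_intros)
  show ?case by (simp add: stable_op_linear_simps scale linear_scale[OF is_linear_coproduct_sum])
next
  case (power_sum n f)
  interpret \<Phi>: linear_second "\<lambda>x y. normal_op y a * stable_op x g"
    by unfold_locales (intro stable_op_linear_intros)
  interpret L: linear_second "\<lambda>x y. normal_op y a * stable_op x (d_power n g)"
    by unfold_locales (intro stable_op_linear_intros)
  interpret R: linear_second "\<lambda>x y. normal_op y (d_power n a) * stable_op x g"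
    by unfold_locales (intro stable_op_linear_intros)
  interpret L': linear_second "\<lambda>x y. power_sum n * (normal_op y a * stable_op x (d_power n g))"
    by unfold_locales (intro stable_op_linear_intros)
  interpret R': linear_second "\<lambda>x y. power_sum n * (normal_op y (d_power n a) * stable_op x g)"
    by unfold_locales (intro stable_op_linear_intros)
  interpret LR: linear_second "\<lambda>x y. power_sum n * (normal_op y a * stable_op x (d_power n g)) +
        power_sum n * (normal_op y (d_power n a) * stable_op x g)"
    by unfold_locales (intro stable_op_linear_intros)
  have neg: "linear_second (\<lambda>x y. - (normal_op y a * stable_op x g))"
    by unfold_locales (intro stable_op_linear_intros)
  have "coproduct_sum 1 (\<lambda>x y. normal_op y a * stable_op x g) (power_sum n * f) =
      coproduct_sum 1 (\<lambda>x y. (power_sum n * (normal_op y a * stable_op x (d_power n g)) +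
        power_sum n * (normal_op y (d_power n a) * stable_op x g)) + - (normal_op y a * stable_op x g)) f"
    unfolding \<Phi>.coproduct_sum_power_sum[OF power_sum(1)]
    by (simp only: stable_op_power_sum_mult[OF power_sum(1)] normal_op_power_sum_mult[OF power_sum(1)]
        sym.scale_one) (simp add: algebra_simps)
  also have "\<dots> = power_sum n * stable_op f (a * d_power n g) + power_sum n * stable_op f (d_power n a * g)
      - stable_op f (a * g)"
    unfolding LR.coproduct_sum_add[OF neg] L'.coproduct_sum_add[OF R'.linear_second_axioms] power_sum
    by (simp add: L.coproduct_sum_compose[OF is_linear_times[OF is_linear_id]]
        R.coproduct_sum_compose[OF is_linear_times[OF is_linear_id]]
        \<Phi>.coproduct_sum_compose[OF is_linear_uminus[OF is_linear_id]])
  also have "\<dots> = stable_op (power_sum n * f) (a * g)"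
    using power_sum(1)
    by (simp add: stable_op_power_sum_mult d_power_mult stable_op_linear_simps distrib_left add.commute)
  finally show ?case by simp
qed

section \<open>The operator identities\<close>

lemma sum_fun_apply: "(sum F T) x = (\<Sum>i\<in>T. F i x)"
  by (induction T rule: infinite_finite_induct) auto

lemma has_finite_sumI:
  fixes F :: "'i \<Rightarrow> 'a \<Rightarrow> 'b :: comm_monoid_add"
  assumes T: "finite T" and F: "\<And>i. i \<notin> T \<Longrightarrow> F i = 0" and S: "\<And>x. S x = (\<Sum>i\<in>T. F i x)"
  shows "F has_finite_sum S"
proof -
  have sub: "{i. F i \<noteq> 0} \<subseteq> T" using F by auto
  have "Sum_any F = sum F T" by (rule Sum_any.expand_superset[OF T sub])
  then have "S = Sum_any F" by (simp add: fun_eq_iff S sum_fun_apply)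
  then show ?thesis using finite_subset[OF sub T] by (simp add: has_finite_sum_def)
qed

lemma skew_schur_0: "psize lam > psize al \<Longrightarrow> skew (schur lam) (schur al) = 0"
  by (rule skew_eq_0_degree[OF homog_schur homog_schur]) simp

text \<open>
  The antipode preserves degrees and sends a Schur function to that of the conjugate partition.
\<close>

lemma psize_conj_partition: "psize (conj_partition lam) = psize lam"
proof (rule ccontr)
  let ?s = "schur (conj_partition lam)"
  assume "psize (conj_partition lam) \<noteq> psize lam"
  moreover have "homog (int (psize lam)) ?s"
    using homog_scale[OF homog_antipode[OF homog_schur[of lam]], of "(-1) ^ psize lam"]
    by (simp add: antipode_schur flip: power_mult_distrib)
  ultimately have "form ?s ?s = 0"
    using form_homog[OF homog_schur[of "conj_partition lam"]] by simp
  then show False by (simp add: form_schur)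
qed

lemma normal_op_schur:
  "normal_op q (schur al) = (\<Sum>tau | psize tau \<le> psize al. kronecker q (schur tau) * skew (schur tau) (schur al))"
proof -
  interpret linear_second "\<lambda>x y. kronecker q x * y"
    by unfold_locales (intro kronecker_linear_intros)
  show ?thesis
    unfolding normal_op_eq_coproduct_sum
    by (rule coproduct_sum_schur[OF _ homog_schur]) (intro kronecker_linear_intros)
qed

lemma D_U_sum:
  "skew (schur be) (schur al * g) =
    (\<Sum>lam | psize lam \<le> psize be. skew (schur lam) (schur al) * skew (skew (schur lam) (schur be)) g)"
proof -
  interpret linear_second "\<lambda>x y. skew x (schur al) * skew y g"
    by unfold_locales (intro skew_linear_intros)
  show ?thesis
    unfolding skew_product by (rule coproduct_sum_schur[OF _ homog_schur]) (intro skew_linear_intros)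
qed

lemma U_D_sum:
  "schur al * skew (schur be) g =
    (\<Sum>lam | psize lam \<le> psize be. (-1) ^ psize lam *\<^sub>Q
       skew (skew (schur (conj_partition lam)) (schur be)) (skew (schur lam) (schur al) * g))"
proof -
  interpret linear_second "\<lambda>x y. skew y (skew x (schur al) * g)"
    by unfold_locales (intro skew_linear_intros)
  show ?thesis
    unfolding mult_skew by (rule coproduct_sum_schur_signed[OF _ homog_schur]) (intro skew_linear_intros)
qed

lemma K_U_sum:
  "kronecker (schur be) (schur al * g) =
    (\<Sum>lam | psize lam \<le> psize be. kronecker (skew (schur lam) (schur be)) (schur al) * kronecker (schur lam) g)"
proof -
  interpret linear_second "\<lambda>x y. kronecker y (schur al) * kronecker x g"
    by unfold_locales (intro kronecker_linear_intros)
  show ?thesis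
    unfolding kronecker_product by (rule coproduct_sum_schur[OF _ homog_schur]) (intro kronecker_linear_intros)
qed

lemma Kbar_U_sum:
  "stable_op (schur be) (schur al * g) =
    (\<Sum>(tau, nu)\<in>{tau. psize tau \<le> psize al} \<times> {nu. psize nu \<le> psize be}.
      kronecker (skew (schur nu) (schur be)) (schur tau) * skew (schur tau) (schur al) * stable_op (schur nu) g)"
proof -
  interpret linear_second "\<lambda>x y. normal_op y (schur al) * stable_op x g"
    by unfold_locales (intro stable_op_linear_intros)
  have "stable_op (schur be) (schur al * g) =
      (\<Sum>nu | psize nu \<le> psize be. normal_op (skew (schur nu) (schur be)) (schur al) * stable_op (schur nu) g)"
    unfolding stable_op_product by (rule coproduct_sum_schur[OF _ homog_schur]) (intro stable_op_linear_intros)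
  then show ?thesis
    by (simp add: normal_op_schur sum_distrib_right sum.cartesian_product[symmetric] sum.swap[of _ "{nu. psize nu \<le> psize be}"])
qed

theorem theorem1p1:
  fixes \<alpha> \<beta> :: partition
  shows
    "((\<lambda>lam. U_op (skew_schur \<alpha> lam) \<circ> D_op (skew_schur \<beta> lam))
        has_finite_sum (D_op (schur \<beta>) \<circ> U_op (schur \<alpha>))) \<and>
     ((\<lambda>lam. sym_scale ((-1) ^ psize lam) \<circ>
              (D_op (skew_schur \<beta> (conj_partition lam)) \<circ> U_op (skew_schur \<alpha> lam)))
        has_finite_sum (U_op (schur \<alpha>) \<circ> D_op (schur \<beta>))) \<and>
     ((\<lambda>lam. U_op (kronecker (skew_schur \<beta> lam) (schur \<alpha>)) \<circ> K_op (schur lam))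
        has_finite_sum (K_op (schur \<beta>) \<circ> U_op (schur \<alpha>))) \<and>
     ((\<lambda>lam. K_op (schur lam) \<circ> D_op (kronecker (skew_schur \<beta> lam) (schur \<alpha>)))
        has_finite_sum (D_op (schur \<alpha>) \<circ> K_op (schur \<beta>))) \<and>
     ((\<lambda>(\<tau>, \<nu>). U_op (kronecker (skew_schur \<beta> \<nu>) (schur \<tau>) * skew_schur \<alpha> \<tau>) \<circ>
              Kbar_op (schur \<nu>))
        has_finite_sum (Kbar_op (schur \<beta>) \<circ> U_op (schur \<alpha>))) \<and>
     ((\<lambda>(\<tau>, \<nu>). Kbar_op (schur \<nu>) \<circ>
              D_op (kronecker (skew_schur \<beta> \<nu>) (schur \<tau>) * skew_schur \<alpha> \<tau>))
        has_finite_sum (D_op (schur \<alpha>) \<circ> Kbar_op (schur \<beta>)))"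
    (is "?DU \<and> ?UD \<and> ?KU \<and> ?DK \<and> ?KbarU \<and> ?DKbar")
proof -
  let ?L = "{lam. psize lam \<le> psize \<beta>}"
  let ?P = "{\<tau>. psize \<tau> \<le> psize \<alpha>} \<times> ?L"
  note unfold_ops = D_op_eq_skew skew_schur_eq Kbar_op_schur
  note op_defs = U_op_def K_op_def comp_def
  note zeros = skew_schur_0 kronecker_linear_simps stable_op_linear_simps
  have "?DU"
    unfolding unfold_ops
    by (rule has_finite_sumI[of ?L]) (auto simp: op_defs fun_eq_iff zeros D_U_sum not_le)
  moreover have "?UD"
    unfolding unfold_ops
    by (rule has_finite_sumI[of ?L]) (auto simp: op_defs fun_eq_iff zeros psize_conj_partition U_D_sum not_le)
  moreover have "?KU"
    unfolding unfold_ops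
    by (rule has_finite_sumI[of ?L]) (auto simp: op_defs fun_eq_iff zeros K_U_sum not_le)
  \<comment> \<open>The adjoint of the preceding identity, as Kronecker multiplication is self-adjoint.\<close>
  moreover have "?DK"
  proof (unfold unfold_ops, rule has_finite_sumI[of ?L])
    fix g
    show "(skew (schur \<alpha>) \<circ> K_op (schur \<beta>)) g = (\<Sum>lam\<in>?L. (K_op (schur lam) \<circ>
        skew (kronecker (skew (schur lam) (schur \<beta>)) (schur \<alpha>))) g)"
      unfolding comp_apply
    proof (rule skew_unique)
      fix f
      have "form (schur \<alpha> * f) (K_op (schur \<beta>) g) = form (kronecker (schur \<beta>) (schur \<alpha> * f)) g"
        by (simp add: K_op_def form_kronecker)
      also have "\<dots> = form f (\<Sum>lam\<in>?L. K_op (schur lam)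
          (skew (kronecker (skew (schur lam) (schur \<beta>)) (schur \<alpha>)) g))"
        unfolding K_U_sum form_sum_left form_sum_right
        by (intro sum.cong) (auto simp: skew_adjoint form_kronecker K_op_def)
      finally show "form (schur \<alpha> * f) (K_op (schur \<beta>) g) = form f (\<Sum>lam\<in>?L. K_op (schur lam)
          (skew (kronecker (skew (schur lam) (schur \<beta>)) (schur \<alpha>)) g))" .
    qed
  qed (auto simp: op_defs fun_eq_iff zeros not_le)
  moreover have "?KbarU"
    unfolding unfold_ops
  proof (rule has_finite_sumI[of ?P])
    fix i assume "i \<notin> ?P"
    then show "(case i of (\<tau>, \<nu>) \<Rightarrow> U_op (kronecker (skew (schur \<nu>) (schur \<beta>)) (schur \<tau>) *
        skew (schur \<tau>) (schur \<alpha>)) \<circ> stable_op (schur \<nu>)) = 0"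
      by (cases i) (auto simp: op_defs fun_eq_iff zeros not_le)
  qed (auto simp: op_defs Kbar_U_sum intro!: sum.cong)
  \<comment> \<open>The adjoint of the preceding identity, as the stabilised operators are self-adjoint.\<close>
  moreover have "?DKbar"
  proof (unfold unfold_ops, rule has_finite_sumI[of ?P])
    fix g
    let ?q = "\<lambda>\<tau> \<nu>. kronecker (skew (schur \<nu>) (schur \<beta>)) (schur \<tau>) * skew (schur \<tau>) (schur \<alpha>)"
    have "skew (schur \<alpha>) (stable_op (schur \<beta>) g) = (\<Sum>(\<tau>, \<nu>)\<in>?P. stable_op (schur \<nu>) (skew (?q \<tau> \<nu>) g))"
    proof (rule skew_unique)
      fix f
      have "form (schur \<alpha> * f) (stable_op (schur \<beta>) g) = form (stable_op (schur \<beta>) (schur \<alpha> * f)) g"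
        by (simp add: form_stable_op)
      also have "\<dots> = form f (\<Sum>(\<tau>, \<nu>)\<in>?P. stable_op (schur \<nu>) (skew (?q \<tau> \<nu>) g))"
        unfolding Kbar_U_sum form_sum_left form_sum_right
        by (intro sum.cong) (auto simp: skew_adjoint[of "_ * _"] form_stable_op)
      finally show "form (schur \<alpha> * f) (stable_op (schur \<beta>) g) =
          form f (\<Sum>(\<tau>, \<nu>)\<in>?P. stable_op (schur \<nu>) (skew (?q \<tau> \<nu>) g))" .
    qed
    then show "(skew (schur \<alpha>) \<circ> stable_op (schur \<beta>)) g = (\<Sum>i\<in>?P. (case i of (\<tau>, \<nu>) \<Rightarrow>
        stable_op (schur \<nu>) \<circ> skew (?q \<tau> \<nu>)) g)"
      by (auto intro!: sum.cong)
  next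
    fix i assume "i \<notin> ?P"
    then show "(case i of (\<tau>, \<nu>) \<Rightarrow> stable_op (schur \<nu>) \<circ> skew (kronecker (skew (schur \<nu>) (schur \<beta>)) (schur \<tau>) *
        skew (schur \<tau>) (schur \<alpha>))) = 0"
      by (cases i) (auto simp: op_defs fun_eq_iff zeros not_le)
  qed simp
  ultimately show ?thesis by blast
qed

end
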